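(* As $n\to\infty$ we have $C^S_4(n)=\Theta(n^2)$, and for every fixed integer $k\ge 5$ with $k\notin\{6,7,9\}$, \[ C^S_k(n)= \begin{cases} \tilde{\Theta}\left(n^{\lfloor 2k/5\rfloor}\right), & \text{if } k\equiv 0,1,3,4 \pmod 5,\\[4pt] \tilde{\Theta}\left(n^{\lfloor 2k/5\rfloor+1/3}\right), & \text{if } k\equiv 2 \pmod 5. \end{cases} \]
   Context: $\mathbb{S}^2$ denotes the sphere of radius $1/\sqrt{2}$ in $\mathbb{R}^3$ (centred at the origin), and two of its points are at unit distance if their Euclidean distance in $\mathbb{R}^3$ is $1$. For $k\ge 3$, a unit distance cycle with $k$ vertices (a $k$-cycle) in a finite set $P\subseteq\mathbb{S}^2$ is a $k$-tuple $(p_1,\dots,p_k)$ of pairwise distinct points of $P$ such that $\|p_i-p_{i+1}\|=1$ for all $1\le i\le k$, where $p_{k+1}=p_1$. $C^S_k(n)$ denotes the maximum, over all sets $P$ of $n$ points of $\mathbb{S}^2$, of the number of unit distance cycles with $k$ vertices in $P$. Notation: $\Theta$ is the usual order-of-magnitude notation. $\tilde{\Theta}$ hides polylogarithmic factors, i.e. $f(n)=\tilde{\Theta}(g(n))$ means that there are constants $C,c>0$ (which may depend on $k$) such that $\frac{g(n)}{C(\log n)^{c}}\le f(n)\le C\,g(n)(\log n)^{c}$ for all sufficiently large $n$. *)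

theory Defs
  imports "HOL-Analysis.Analysis" "HOL-Library.Landau_Symbols"
begin

definition S2 :: "(real ^ 3) set" where
  "S2 = sphere 0 (1 / sqrt 2)"

text \<open>Cycles are counted as labelled, rooted tuples: rotations and reflections of a cycle are
  counted separately. Indices run from 0 and are taken modulo \<open>k\<close>.\<close>

definition unit_cycles :: "nat \<Rightarrow> (real ^ 3) set \<Rightarrow> (real ^ 3) list set" where
  "unit_cycles k P = {p. length p = k \<and> set p \<subseteq> P \<and> distinct p \<and>
     (\<forall>i<k. dist (p ! i) (p ! (Suc i mod k)) = 1)}"

definition cycle_counts :: "nat \<Rightarrow> nat \<Rightarrow> nat set" where
  "cycle_counts k n = {card (unit_cycles k P) | P. P \<subseteq> S2 \<and> finite P \<and> card P = n}"

definition max_cycles :: "nat \<Rightarrow> nat \<Rightarrow> nat" where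
  "max_cycles k n = Max (cycle_counts k n)"

definition soft_Theta :: "(nat \<Rightarrow> real) \<Rightarrow> (nat \<Rightarrow> real) \<Rightarrow> bool" where
  "soft_Theta f g \<longleftrightarrow> (\<exists>C>0. \<exists>c>0. \<forall>\<^sub>F n in sequentially.
     g n / (C * ln (real n) powr c) \<le> f n \<and> f n \<le> C * g n * ln (real n) powr c)"

text \<open>\<^const>\<open>Max\<close> is only meaningful on finite nonempty sets; both conditions hold here.\<close>

lemma finite_unit_cycles:
  assumes "finite P"
  shows "finite (unit_cycles k P)" "card (unit_cycles k P) \<le> card P ^ k"
proof -
  have sub: "unit_cycles k P \<subseteq> {p. set p \<subseteq> P \<and> length p = k}"
    by (auto simp: unit_cycles_def)
  have fin: "finite {p. set p \<subseteq> P \<and> length p = k}"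
    using assms by (rule finite_lists_length_eq)
  show "finite (unit_cycles k P)"
    using sub fin by (rule finite_subset)
  show "card (unit_cycles k P) \<le> card P ^ k"
    using card_mono[OF fin sub] assms by (simp add: card_lists_length_eq)
qed

lemma finite_cycle_counts: "finite (cycle_counts k n)"
proof (rule finite_subset)
  show "cycle_counts k n \<subseteq> {..n ^ k}"
    using finite_unit_cycles(2) by (fastforce simp: cycle_counts_def)
qed simp

lemma infinite_S2: "infinite S2"
proof
  assume "finite S2"
  moreover have "connected S2"
    unfolding S2_def by (rule connected_sphere) simp
  ultimately obtain a where a: "S2 \<subseteq> {a}"
    by (metis connected_finite_iff_sing empty_subsetI order_refl)
  define v :: "real ^ 3" where "v = (1 / sqrt 2) *\<^sub>R axis 1 1"
  have "norm v = 1 / sqrt 2" by (simp add: v_def norm_axis_1)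
  then have "v \<in> S2" "- v \<in> S2" by (auto simp: S2_def)
  with a have "v = - v" by blast
  then have "v = 0" by (simp add: vec_eq_iff)
  with \<open>norm v = 1 / sqrt 2\<close> show False by simp
qed

lemma cycle_counts_nonempty: "cycle_counts k n \<noteq> {}"
  using infinite_arbitrarily_large[OF infinite_S2, of n] by (auto simp: cycle_counts_def)

end

theory Submission
  imports Defs
begin

text \<open>On the sphere of radius \<open>1/sqrt 2\<close>, unit distance means orthogonality, so two points have at most
  two common neighbours unless they are equal or antipodal, and the Szemeredi-Trotter bound holds for
  the number of unit distances. For the upper bound, pigeonholing reduces to a family of cycles whose
  projections to single positions and to pairs of consecutive positions have fibres of almost constant
  size. Walking along such a cycle, each step costs the average degree, and a vertex with
  two known, non-antipodal neighbours is free. Positions with at most \<open>sqrt n\<close> vertices (heavy ones) cut the cycle;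
  a block \<open>p, x, -p\<close> with \<open>p\<close> heavy costs one factor \<open>n\<close> for three vertices, and the remaining gaps
  are paths bounded by induction. For the lower bound, five consecutive vertices
  \<open>p, x, -p, x', y\<close> with \<open>p\<close> fixed, \<open>x, x'\<close> free on the great circle of \<open>p\<close> and \<open>y\<close> determined by
  \<open>x'\<close> and the next fixed point give \<open>n\<^sup>2\<close> choices; the exponent \<open>1/3\<close> comes from inserting an edge
  of a grid with many incidences.\<close>

section \<open>The Szemeredi-Trotter theorem\<close>

text \<open>The obstacle is antipodality: \<open>p\<close> and \<open>-p\<close> have a whole great
  circle of common neighbours, so a vertex between two known ones need not be determined. Were it
  always determined, a cycle would cost no more than a path with \<open>k - 2\<close> edges, since
  the last vertex is free. That path bound exceeds the claimed exponent for \<open>k \<ge> 5\<close>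
  exactly when \<open>k\<close> is 6, 7 or 9, which is why these lengths are excluded.
  Szemeredi-Trotter controls only average degrees, while walking along a cycle needs a bound at
  every vertex. Regularization closes this gap at the price of polylogarithmic factors. In
  logarithms to base \<open>n\<close> they become one error \<open>eps\<close>, incurred a number of
  times bounded in terms of \<open>k\<close>. The threshold \<open>sqrt n\<close> is natural: if the
  exponents \<open>x\<close>, \<open>y\<close> of two neighbouring positions lie above 1/2 and are
  at most 1, then \<open>2/3 * (x + y)\<close> is at least \<open>max x y\<close>, so the main
  Szemeredi-Trotter term governs every step between two positions that are not heavy.\<close>

type_synonym pt = "real \<times> real"
type_synonym seg = "pt \<times> pt"

section \<open>Linear edge bound for straight-line drawings without crossings\<close>

definition slope :: "seg \<Rightarrow> real" where
  "slope e = (snd (snd e) - snd (fst e)) / (fst (snd e) - fst (fst e))"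

definition height :: "seg \<Rightarrow> real \<Rightarrow> real" where
  "height e x = snd (fst e) + slope e * (x - fst (fst e))"

definition crosses :: "seg \<Rightarrow> seg \<Rightarrow> bool" where
  "crosses e f \<longleftrightarrow> e \<noteq> f \<and> (\<exists>x. fst (fst e) < x \<and> x < fst (snd e) \<and>
     fst (fst f) < x \<and> x < fst (snd f) \<and> height e x = height f x)"

text \<open>Keeping vertices out of the interiors of edges excludes overlapping collinear edges, so
  distinct edges with a common interior point have different slopes.\<close>

definition geometric_graph :: "pt set \<Rightarrow> seg set \<Rightarrow> bool" where
  "geometric_graph V E \<longleftrightarrow> finite V \<and> E \<subseteq> V \<times> V \<and> (\<forall>e\<in>E. fst (fst e) < fst (snd e)) \<and>
     (\<forall>e\<in>E. \<forall>w\<in>V. fst (fst e) < fst w \<and> fst w < fst (snd e) \<longrightarrow> snd w \<noteq> height e (fst w))"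

lemma height_left [simp]: "height e (fst (fst e)) = snd (fst e)"
  by (simp add: height_def)

lemma height_right: "fst (fst e) < fst (snd e) \<Longrightarrow> height e (fst (snd e)) = snd (snd e)"
  by (simp add: height_def slope_def)

lemma sign_change_crosses:
  assumes "fst (fst e) \<le> a" "fst (fst f) \<le> a" "b \<le> fst (snd e)" "b \<le> fst (snd f)" "a < b"
    and "height e a < height f a" "height f b < height e b"
  shows "crosses e f"
proof -
  let ?g = "\<lambda>x. height f x - height e x"
  have "continuous_on {a..b} ?g"
    unfolding height_def by (intro continuous_intros)
  then obtain x where x: "a \<le> x" "x \<le> b" "?g x = 0"
    using IVT2'[of ?g b 0 a] assms by auto
  moreover have "x \<noteq> a" "x \<noteq> b" using x(3) assms by auto
  moreover have "e \<noteq> f" using assms by auto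
  ultimately show ?thesis
    unfolding crosses_def using assms by (intro conjI exI[of _ x]) auto
qed

text \<open>Otherwise the shorter of the two edges would end at a vertex inside the longer
  one.\<close>

lemma same_slope_eq:
  assumes "geometric_graph V E" "e \<in> E" "f \<in> E" "fst e = fst f" "slope e = slope f"
  shows "e = f"
proof (rule ccontr)
  assume ne: "e \<noteq> f"
  have h: "height e = height f" using assms by (auto simp: height_def)
  have lt: "fst (fst e) < fst (snd e)" "fst (fst f) < fst (snd f)" and V: "snd e \<in> V" "snd f \<in> V"
    and nv: "\<And>e w. e\<in>E \<Longrightarrow> w\<in>V \<Longrightarrow> fst (fst e) < fst w \<Longrightarrow> fst w < fst (snd e) \<Longrightarrow> snd w \<noteq> height e (fst w)"
    using assms by (auto simp: geometric_graph_def)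
  have hr: "height e (fst (snd e)) = snd (snd e)" "height f (fst (snd f)) = snd (snd f)"
    using lt by (simp_all add: height_right)
  consider "fst (snd e) < fst (snd f)" | "fst (snd f) < fst (snd e)" | "fst (snd e) = fst (snd f)"
    by linarith
  then show False
  proof cases
    case 1 then show False using nv[OF assms(3) V(1)] lt hr h assms(4) by auto
  next
    case 2 then show False using nv[OF assms(2) V(2)] lt hr h assms(4) by auto
  next
    case 3
    then have "snd e = snd f" using hr h by (simp add: prod_eq_iff)
    with ne assms(4) show False by (simp add: prod_eq_iff)
  qed
qed


text \<open>Here \<open>e'\<close> is the next edge below \<open>e\<close> at their common left
  endpoint, and \<open>w\<close> is a leftmost vertex, apart from the apex, of the closed triangle
  that they span up to the nearer right end.\<close>

definition is_wedge :: "pt set \<Rightarrow> seg set \<Rightarrow> seg \<Rightarrow> seg \<Rightarrow> pt \<Rightarrow> bool" where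
  "is_wedge V E e e' w \<longleftrightarrow> e' \<in> E \<and> fst e' = fst e \<and> slope e' < slope e \<and>
    (\<forall>f\<in>E. fst f = fst e \<longrightarrow> slope f < slope e \<longrightarrow> slope f \<le> slope e') \<and>
    w \<in> V \<and> fst (fst e) < fst w \<and> fst w \<le> fst (snd e) \<and> fst w \<le> fst (snd e') \<and>
    height e' (fst w) \<le> snd w \<and> snd w \<le> height e (fst w) \<and>
    (\<forall>v\<in>V. fst (fst e) < fst v \<and> fst v < fst w \<longrightarrow> snd v < height e' (fst v) \<or> height e (fst v) < snd v)"

lemma wedge_exists:
  assumes G: "geometric_graph V E" and e: "e \<in> E" and ex: "\<exists>e'\<in>E. fst e' = fst e \<and> slope e' < slope e"
  shows "\<exists>e' w. is_wedge V E e e' w"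
proof -
  have fin: "finite V" "finite E" using G finite_subset[of E "V \<times> V"] by (auto simp: geometric_graph_def)
  let ?S = "{f\<in>E. fst f = fst e \<and> slope f < slope e}"
  have S: "finite ?S" "?S \<noteq> {}" using fin(2) ex by (simp, blast)
  then obtain e' where e': "e' \<in> ?S" "slope e' = Max (slope ` ?S)"
    using Max_in[of "slope ` ?S"] by (metis (no_types, lifting) finite_imageI image_iff image_is_empty)
  have e'max: "\<forall>f\<in>?S. slope f \<le> slope e'" using S(1) e'(2) by auto
  have lt: "fst (fst e) < fst (snd e)" "fst (fst e') < fst (snd e')" and V: "snd e \<in> V" "snd e' \<in> V"
    using G e e' by (auto simp: geometric_graph_def)
  have fe: "fst e' = fst e" and sl: "slope e' < slope e" using e' by auto
  have le: "height e' x \<le> height e x" if "x \<ge> fst (fst e)" for x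
    using that sl unfolding height_def fe by (simp add: mult_right_mono)
  let ?W = "{w\<in>V. fst (fst e) < fst w \<and> fst w \<le> fst (snd e) \<and> fst w \<le> fst (snd e') \<and>
    height e' (fst w) \<le> snd w \<and> snd w \<le> height e (fst w)}"
  \<comment> \<open>The nearer of the two right ends lies in the triangle, so there is a vertex to
    choose from.\<close>
  have "(if fst (snd e) \<le> fst (snd e') then snd e else snd e') \<in> ?W"
    using lt V le fe by (auto simp: height_right[symmetric])
  then have W: "finite ?W" "?W \<noteq> {}" using fin(1) by (simp, blast)
  then have "Min (fst ` ?W) \<in> fst ` ?W" by (intro Min_in finite_imageI) (simp_all only: image_is_empty not_False_eq_True)
  then obtain w where w: "Min (fst ` ?W) = fst w" "w \<in> ?W" by (rule imageE)
  have wmin: "\<forall>v\<in>?W. fst w \<le> fst v" unfolding w(1)[symmetric] using W(1) by (intro ballI Min_le finite_imageI imageI)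
  have mn: "snd v < height e' (fst v) \<or> height e (fst v) < snd v"
    if "v \<in> V" "fst (fst e) < fst v" "fst v < fst w" for v
  proof (rule ccontr)
    assume "\<not> ?thesis"
    then have "v \<in> ?W" using that w(2) by auto
    with wmin that(3) show False by (meson linorder_not_less)
  qed
  have "\<forall>f\<in>E. fst f = fst e \<longrightarrow> slope f < slope e \<longrightarrow> slope f \<le> slope e'" using e'max by blast
  then have "is_wedge V E e e' w" unfolding is_wedge_def using e'(1) fe w(2) mn by blast
  then show ?thesis by blast
qed

lemma height_mono_slope:
  "fst e = fst f \<Longrightarrow> fst (fst e) < x \<Longrightarrow> height e x < height f x \<longleftrightarrow> slope e < slope f"
  by (simp add: height_def)

text \<open>Injectivity of the charging. Wedges with one apex cannot hold \<open>w\<close> in the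
  same way, because no edge runs between \<open>e'\<close> and \<open>e\<close>; wedges with
  different apexes would produce a crossing.\<close>

lemma wedge_inj:
  assumes G: "geometric_graph V E" and nc: "\<And>e f. e \<in> E \<Longrightarrow> f \<in> E \<Longrightarrow> \<not> crosses e f"
    and w1: "is_wedge V E e1 f1 w" and w2: "is_wedge V E e2 f2 w" and E: "e1 \<in> E" "e2 \<in> E"
    and le: "fst (fst e1) \<le> fst (fst e2)"
    and t: "height f1 (fst w) < snd w \<and> snd w < height e1 (fst w) \<and> height f2 (fst w) < snd w \<and> snd w < height e2 (fst w)
      \<or> snd w = height e1 (fst w) \<and> snd w = height e2 (fst w)
      \<or> snd w = height f1 (fst w) \<and> snd w = height f2 (fst w)"
  shows "e1 = e2"
proof -
  have fE: "f1 \<in> E" "f2 \<in> E" using w1 w2 by (auto simp: is_wedge_def)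
  have ff: "fst f1 = fst e1" "fst f2 = fst e2" "slope f1 < slope e1" "slope f2 < slope e2"
    and x: "fst (fst e1) < fst w" "fst w \<le> fst (snd e1)" "fst w \<le> fst (snd f1)"
       "fst (fst e2) < fst w" "fst w \<le> fst (snd e2)" "fst w \<le> fst (snd f2)"
    and y: "height f1 (fst w) \<le> snd w" "snd w \<le> height e1 (fst w)"
       "height f2 (fst w) \<le> snd w" "snd w \<le> height e2 (fst w)"
    and pr: "\<And>f. f\<in>E \<Longrightarrow> fst f = fst e1 \<Longrightarrow> slope f < slope e1 \<Longrightarrow> slope f \<le> slope f1"
       "\<And>f. f\<in>E \<Longrightarrow> fst f = fst e2 \<Longrightarrow> slope f < slope e2 \<Longrightarrow> slope f \<le> slope f2"
    and mn: "\<And>v. v\<in>V \<Longrightarrow> fst (fst e1) < fst v \<Longrightarrow> fst v < fst w \<Longrightarrow>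
       snd v < height f1 (fst v) \<or> height e1 (fst v) < snd v"
    using w1 w2 by (auto simp: is_wedge_def)
  have st: "height f1 (fst w) < height e1 (fst w)" "height f2 (fst w) < height e2 (fst w)"
    using ff x by (simp_all add: height_mono_slope)
  have V: "fst e2 \<in> V" using G E by (auto simp: geometric_graph_def)
  show ?thesis
  proof (cases "fst e1 = fst e2")
    case True
    have "slope e1 \<le> slope e2" 
    proof (rule ccontr)
      assume "\<not> ?thesis"
      then have "slope e2 \<le> slope f1" using pr(1)[OF E(2)] True by auto
      then have "height e2 (fst w) \<le> height f1 (fst w)"
        using True ff(1) x(1) height_mono_slope[of f1 e2 "fst w"] by (auto simp: not_less[symmetric])
      then show False using t y st by linarith
    qed
    moreover have "slope e2 \<le> slope e1" 
    proof (rule ccontr)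
      assume "\<not> ?thesis"
      then have "slope e1 \<le> slope f2" using pr(2)[OF E(1)] True by auto
      then have "height e1 (fst w) \<le> height f2 (fst w)"
        using True ff(2) x(4) height_mono_slope[of f2 e1 "fst w"] by (auto simp: not_less[symmetric])
      then show False using t y st by linarith
    qed
    ultimately show ?thesis using same_slope_eq[OF G E True] by simp
  next
    case False
    \<comment> \<open>The second apex is a vertex left of \<open>w\<close>, hence outside the first
      wedge; if the apexes lie above each other, this holds because \<open>e1\<close> and
      \<open>f1\<close> meet there. An edge of the second wedge then starts on one side of an edge
      of the first and lies on the other side above \<open>w\<close>.\<close>
    have "snd (fst e2) < height f1 (fst (fst e2)) \<or> height e1 (fst (fst e2)) < snd (fst e2)"
    proof (cases "fst (fst e1) = fst (fst e2)")
      case True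
      then have "snd (fst e1) \<noteq> snd (fst e2)" using False by (simp add: prod_eq_iff)
      moreover have "height e1 (fst (fst e2)) = snd (fst e1)" "height f1 (fst (fst e2)) = snd (fst e1)"
        using True ff(1) by (simp_all add: height_def)
      ultimately show ?thesis by linarith
    qed (use mn[OF V] le x in auto)
    then show ?thesis
    proof
      assume a: "height e1 (fst (fst e2)) < snd (fst e2)"
      have "height f2 (fst w) < height e1 (fst w)" using t y st by linarith
      then have "crosses e1 f2"
        using a x le height_left[of f2, unfolded ff(2)] ff(2)
        by (intro sign_change_crosses[of e1 "fst (fst e2)" f2 "fst w"]) auto
      then show ?thesis using nc E fE by blast
    next
      assume a: "snd (fst e2) < height f1 (fst (fst e2))"
      have "height f1 (fst w) < height e2 (fst w)" using t y st by linarith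
      then have "crosses e2 f1"
        using a x le ff(1) by (intro sign_change_crosses[of e2 "fst (fst e2)" f1 "fst w"]) auto
      then show ?thesis using nc E fE by blast
    qed
  qed
qed

text \<open>Every edge that is not the lowest one leaving its left endpoint to the right is charged to the
  leftmost vertex of the wedge between it and the next lower edge; a vertex is charged at most once
  from the inside, once as an upper and once as a lower end.\<close>

lemma noncrossing_edges_le:
  assumes G: "geometric_graph V E" and nc: "\<And>e f. e \<in> E \<Longrightarrow> f \<in> E \<Longrightarrow> \<not> crosses e f"
  shows "card E \<le> 4 * card V"
proof -
  have fin: "finite V" using G by (auto simp: geometric_graph_def)
  define ex where "ex e \<longleftrightarrow> (\<exists>e'\<in>E. fst e' = fst e \<and> slope e' < slope e)" for e
  have "\<forall>e\<in>{e\<in>E. ex e}. \<exists>g. is_wedge V E e (fst g) (snd g)"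
    using wedge_exists[OF G] unfolding ex_def by auto
  then have "\<exists>g. \<forall>e\<in>{e\<in>E. ex e}. is_wedge V E e (fst (g e)) (snd (g e))" by (rule bchoice)
  then obtain g where g: "\<And>e. e\<in>E \<Longrightarrow> ex e \<Longrightarrow> is_wedge V E e (fst (g e)) (snd (g e))" by blast
  define w where "w e = snd (g e)" for e
  define pr where "pr e = fst (g e)" for e
  \<comment> \<open>Type 0 edges are charged to their left endpoint, the others to \<open>w\<close>,
    with a type telling whether \<open>w\<close> lies on the upper edge, on the lower edge or
    strictly between. Four types give the constant 4.\<close>
  define ty :: "seg \<Rightarrow> nat" where "ty e = (if \<not> ex e then 0 else if snd (w e) = height e (fst (w e)) then 1
     else if snd (w e) = height (pr e) (fst (w e)) then 2 else 3)" for e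
  define h where "h e = (if ex e then w e else fst e, ty e)" for e
  have wd: "is_wedge V E e (pr e) (w e)" if "e\<in>E" "ex e" for e
    using g[OF that] by (simp add: w_def pr_def)
  have inj: "e1 = e2" if e: "e1 \<in> E" "e2 \<in> E" and h: "h e1 = h e2" and le: "fst (fst e1) \<le> fst (fst e2)" for e1 e2
  proof -
    have ty: "ty e1 = ty e2" using h by (simp add: h_def)
    show ?thesis
    proof (cases "ex e1")
      case True
      then have ex2: "ex e2" using ty by (auto simp: ty_def split: if_splits)
      have ww: "w e1 = w e2" using h True ex2 by (simp add: h_def)
      have wd1: "is_wedge V E e1 (pr e1) (w e1)" and wd2: "is_wedge V E e2 (pr e2) (w e1)"
        using wd[OF e(1) True] wd[OF e(2) ex2] ww by simp_all
      show ?thesis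
        by (rule wedge_inj[OF G nc wd1 wd2 e le])
          (use ty True ex2 ww wd1 wd2 in \<open>auto simp: ty_def is_wedge_def split: if_splits\<close>)
    next
      case False
      then have ex2: "\<not> ex e2" using ty by (auto simp: ty_def split: if_splits)
      have "fst e1 = fst e2" using h False ex2 by (simp add: h_def)
      moreover have "slope e1 = slope e2" using False ex2 e calculation unfolding ex_def
        by (metis linorder_less_linear)
      ultimately show ?thesis using same_slope_eq[OF G e] by simp
    qed
  qed
  have "inj_on h E" by (rule inj_onI) (metis inj linorder_linear)
  moreover have "h ` E \<subseteq> V \<times> {..<4}"
  proof
    fix y assume "y \<in> h ` E"
    then obtain e where e: "e \<in> E" "y = h e" by blast
    have "fst e \<in> V" using e(1) G by (auto simp: geometric_graph_def)
    moreover have "ex e \<Longrightarrow> w e \<in> V" using wd[OF e(1)] by (simp add: is_wedge_def)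
    moreover have "ty e < 4" by (simp add: ty_def)
    ultimately show "y \<in> V \<times> {..<4}" by (simp add: e(2) h_def)
  qed
  ultimately have "card E \<le> card (V \<times> {..<4::nat})"
    using fin by (metis card_inj_on_le finite_SigmaI finite_lessThan)
  then show ?thesis by (simp add: card_cartesian_product)
qed

section \<open>Crossing inequality by random sampling\<close>

definition crossing_pairs :: "seg set \<Rightarrow> (seg \<times> seg) set" where
  "crossing_pairs E = {(e, f) \<in> E \<times> E. crosses e f}"

lemma geometric_graph_subset: "geometric_graph V E \<Longrightarrow> F \<subseteq> E \<Longrightarrow> geometric_graph V F"
  by (auto simp: geometric_graph_def)

lemma geometric_graph_finite: "geometric_graph V E \<Longrightarrow> finite E"
  using finite_subset[of E "V \<times> V"] by (auto simp: geometric_graph_def)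

text \<open>Deleting one edge of a crossing destroys at least one crossing pair, so a graph without
  crossings is reached after at most as many deletions as there are pairs.\<close>

lemma edges_le_crossings:
  "geometric_graph V E \<Longrightarrow> card E \<le> 4 * card V + card (crossing_pairs E)"
proof (induction "card E" arbitrary: E rule: less_induct)
  case less
  have finE: "finite E" using less.prems by (rule geometric_graph_finite)
  then have finC: "finite (crossing_pairs E)"
    by (rule_tac finite_subset[of _ "E \<times> E"]) (auto simp: crossing_pairs_def)
  show ?case
  proof (cases "\<exists>e\<in>E. \<exists>f\<in>E. crosses e f")
    case True
    then obtain e f where ef: "e \<in> E" "f \<in> E" "crosses e f" by blast
    let ?F = "E - {e}"
    have c: "card E = Suc (card ?F)" using card_Suc_Diff1[OF finE ef(1)] by simp
    have "card ?F \<le> 4 * card V + card (crossing_pairs ?F)"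
      using less c geometric_graph_subset[of V E ?F] by auto
    moreover have "crossing_pairs ?F \<subset> crossing_pairs E"
      using ef by (auto simp: crossing_pairs_def)
    then have "card (crossing_pairs ?F) < card (crossing_pairs E)" using finC by (rule psubset_card_mono[rotated])
    ultimately show ?thesis using c by linarith
  next
    case False
    then show ?thesis using noncrossing_edges_le[OF less.prems] by force
  qed
qed

text \<open>Edges with a common endpoint and a further common point are collinear and would overlap.
  Four distinct endpoints are what gives a crossing the survival probability
  \<open>1 / t ^ 4\<close> under sampling.\<close>

lemma crossing_endpoints:
  assumes G: "geometric_graph V E" and E: "e \<in> E" "f \<in> E" and c: "crosses e f"
  shows "card {fst e, snd e, fst f, snd f} = 4"
proof -
  from c obtain x where x: "fst (fst e) < x" "x < fst (snd e)" "fst (fst f) < x" "x < fst (snd f)"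
    "height e x = height f x" and ne: "e \<noteq> f" by (auto simp: crosses_def)
  have "fst e \<noteq> fst f"
  proof
    assume a: "fst e = fst f"
    then have "slope e = slope f" using x by (auto simp: height_def)
    then show False using same_slope_eq[OF G E a] ne by simp
  qed
  moreover have "snd e \<noteq> snd f"
  proof
    assume a: "snd e = snd f"
    have r: "height e (fst (snd e)) = height f (fst (snd e))"
      using x a by (metis height_right order_less_trans)
    have h: "height g z = height g x + slope g * (z - x)" for g z by (simp add: height_def algebra_simps)
    have s: "slope e = slope f" using r x(2,5) by (simp add: h[of _ "fst (snd e)"])
    then have he: "height e z = height f z" for z using x(5) by (simp add: h[of _ z])
    have nv: "\<And>e w. e\<in>E \<Longrightarrow> w\<in>V \<Longrightarrow> fst (fst e) < fst w \<Longrightarrow> fst w < fst (snd e) \<Longrightarrow> snd w \<noteq> height e (fst w)"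
      and V: "fst e \<in> V" "fst f \<in> V" using G E by (auto simp: geometric_graph_def)
    have l: "snd (fst e) = height f (fst (fst e))" "snd (fst f) = height e (fst (fst f))"
      using he height_left by metis+
    have "fst (fst e) = fst (fst f)"
      using nv[OF E(1) V(2)] nv[OF E(2) V(1)] l x by fastforce
    then have "fst e = fst f" using l by (simp add: prod_eq_iff)
    then show False using \<open>fst e \<noteq> fst f\<close> by simp
  qed
  moreover have "fst e \<noteq> snd e" "fst f \<noteq> snd f" "fst e \<noteq> snd f" "snd e \<noteq> fst f" using x by auto
  ultimately show ?thesis by simp
qed

text \<open>The colour class \<open>{a. c a = 0}\<close> of a random colouring \<open>c\<close> with \<open>t\<close> colours samples the vertices
  with probability \<open>1/t\<close>.\<close>

lemma card_colourings:
  assumes "finite V" "T \<subseteq> V" "t \<ge> 1"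
  shows "card {c \<in> V \<rightarrow>\<^sub>E {..<t}. \<forall>a\<in>T. c a = (0::nat)} * t ^ card T = t ^ card V"
proof -
  have "{c \<in> V \<rightarrow>\<^sub>E {..<t}. \<forall>a\<in>T. c a = 0} = PiE V (\<lambda>a. if a \<in> T then {0} else {..<t})"
  proof -
    have "c a \<in> (if a \<in> T then {0} else {..<t}) \<longleftrightarrow> c a \<in> {..<t} \<and> (a \<in> T \<longrightarrow> c a = 0)" for a and c :: "'a \<Rightarrow> nat"
      using assms(3) by auto
    then show ?thesis using assms(2) unfolding PiE_iff set_eq_iff mem_Collect_eq Pi_iff by blast
  qed
  then have "card {c \<in> V \<rightarrow>\<^sub>E {..<t}. \<forall>a\<in>T. c a = 0} = (\<Prod>a\<in>V. card (if a \<in> T then {0} else {..<t}))"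
    using assms(1) by (simp add: card_PiE)
  also have "\<dots> = (\<Prod>a\<in>V - T. t)"
    using assms(1) by (intro prod.mono_neutral_cong_right) auto
  finally have "card {c \<in> V \<rightarrow>\<^sub>E {..<t}. \<forall>a\<in>T. c a = 0} = t ^ (card V - card T)"
    using assms(1,2) by (simp add: card_Diff_subset finite_subset)
  then show ?thesis using assms card_mono[of V T] by (simp add: power_add[symmetric])
qed


lemma sum_card_filter:
  assumes "finite A" "finite B"
  shows "(\<Sum>c\<in>A. card {b\<in>B. R c b}) = (\<Sum>b\<in>B. card {c\<in>A. R c b})"
proof -
  have "(\<Sum>c\<in>A. card {b\<in>B. R c b}) = (\<Sum>c\<in>A. \<Sum>b\<in>B. if R c b then 1 else 0)"
    using assms by (simp add: sum.inter_filter[symmetric])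
  also have "\<dots> = (\<Sum>b\<in>B. \<Sum>c\<in>A. if R c b then 1 else 0)" by (rule sum.swap)
  also have "\<dots> = (\<Sum>b\<in>B. card {c\<in>A. R c b})"
    using assms by (simp add: sum.inter_filter[symmetric])
  finally show ?thesis .
qed

text \<open>Average \<open>edges_le_crossings\<close> over all induced subgraphs on the colour class
  0: vertices, edges and crossings survive with probability \<open>1 / t\<close>,
  \<open>1 / t ^ 2\<close> and \<open>1 / t ^ 4\<close>. Multiplying by \<open>t ^ 2\<close> gives
  the bound; \<open>t\<close> stays free and is optimised in \<open>incidences_le\<close>.\<close>

lemma crossing_lemma:
  assumes G: "geometric_graph V E" and t: "t \<ge> (1::nat)"
  shows "real (card E) \<le> 4 * real (card V) * t + real (card (crossing_pairs E)) / t\<^sup>2"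
proof -
  have fin: "finite V" "finite E" using G geometric_graph_finite by (auto simp: geometric_graph_def)
  have finC: "finite (crossing_pairs E)" using fin(2)
    by (rule_tac finite_subset[of _ "E \<times> E"]) (auto simp: crossing_pairs_def)
  define K where "K = V \<rightarrow>\<^sub>E {..<t}"
  have finK: "finite K" unfolding K_def using fin by (intro finite_PiE) auto
  have cnt: "real (card {c\<in>K. \<forall>a\<in>T. c a = (0::nat)}) = real t ^ card V / real t ^ card T" if "T \<subseteq> V" for T
  proof -
    have "card {c\<in>K. \<forall>a\<in>T. c a = 0} * t ^ card T = t ^ card V"
      unfolding K_def by (rule card_colourings[OF fin(1) that t])
    then have "real (card {c\<in>K. \<forall>a\<in>T. c a = 0}) * real t ^ card T = real t ^ card V"
      unfolding of_nat_mult[symmetric] of_nat_power[symmetric] by (rule arg_cong)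
    then show ?thesis using t by (simp add: field_simps)
  qed
  let ?E = "\<lambda>c. {e\<in>E. \<forall>a\<in>{fst e, snd e}. c a = (0::nat)}"
  let ?V = "\<lambda>c. {v\<in>V. \<forall>a\<in>{v}. c a = (0::nat)}"
  let ?C = "\<lambda>c. {p\<in>crossing_pairs E. \<forall>a\<in>{fst (fst p), snd (fst p), fst (snd p), snd (snd p)}. c a = (0::nat)}"
  have le: "card (?E c) \<le> 4 * card (?V c) + card (?C c)" for c
  proof -
    have g: "geometric_graph (?V c) (?E c)" using G by (auto simp: geometric_graph_def)
    have "crossing_pairs (?E c) = ?C c" by (auto simp: crossing_pairs_def)
    then show ?thesis using edges_le_crossings[OF g] by (simp only:)
  qed
  have E: "real (\<Sum>c\<in>K. card (?E c)) = card E * (real t ^ card V / real t ^ 2)"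
  proof -
    have "real (card {c\<in>K. \<forall>a\<in>{fst e, snd e}. c a = 0}) = real t ^ card V / real t ^ 2" if "e\<in>E" for e
    proof -
      have "fst e \<noteq> snd e" "{fst e, snd e} \<subseteq> V" using G that by (auto simp: geometric_graph_def)
      then show ?thesis using cnt[of "{fst e, snd e}"] by (simp add: numeral_2_eq_2)
    qed
    then show ?thesis unfolding sum_card_filter[OF finK fin(2)] of_nat_sum by simp
  qed
  have V: "real (\<Sum>c\<in>K. card (?V c)) = card V * (real t ^ card V / real t)"
  proof -
    have "real (card {c\<in>K. \<forall>a\<in>{v}. c a = 0}) = real t ^ card V / real t" if "v\<in>V" for v
      using cnt[of "{v}"] that by simp
    then show ?thesis unfolding sum_card_filter[OF finK fin(1)] of_nat_sum by simp
  qed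
  have C: "real (\<Sum>c\<in>K. card (?C c)) = card (crossing_pairs E) * (real t ^ card V / real t ^ 4)"
  proof -
    have "real (card {c\<in>K. \<forall>a\<in>{fst (fst p), snd (fst p), fst (snd p), snd (snd p)}. c a = 0}) = real t ^ card V / real t ^ 4"
      if "p \<in> crossing_pairs E" for p
    proof -
      have p: "fst p \<in> E" "snd p \<in> E" "crosses (fst p) (snd p)" using that by (auto simp: crossing_pairs_def)
      have sub: "{fst (fst p), snd (fst p), fst (snd p), snd (snd p)} \<subseteq> V"
        using G p by (auto simp: geometric_graph_def)
      show ?thesis using cnt[OF sub] unfolding crossing_endpoints[OF G p] .
    qed
    then show ?thesis unfolding sum_card_filter[OF finK finC] of_nat_sum by simp
  qed
  have "(\<Sum>c\<in>K. card (?E c)) \<le> (\<Sum>c\<in>K. 4 * card (?V c) + card (?C c))" by (intro sum_mono le)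
  then have "(\<Sum>c\<in>K. card (?E c)) \<le> 4 * (\<Sum>c\<in>K. card (?V c)) + (\<Sum>c\<in>K. card (?C c))"
    by (simp add: sum.distrib sum_distrib_left)
  then have "real (\<Sum>c\<in>K. card (?E c)) \<le> 4 * real (\<Sum>c\<in>K. card (?V c)) + real (\<Sum>c\<in>K. card (?C c))"
    by linarith
  then have "card E * (real t ^ card V / real t ^ 2) \<le> 4 * (card V * (real t ^ card V / real t))
      + card (crossing_pairs E) * (real t ^ card V / real t ^ 4)"
    unfolding E V C .
  moreover have "real t ^ card V > 0" using t by simp
  moreover have "a / T2 \<le> 4 * (b / T1) + c / T4"
    if "a * (Q / T2) \<le> 4 * (b * (Q / T1)) + c * (Q / T4)" "Q > 0" for a b c Q T1 T2 T4 :: real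
  proof -
    have "(a / T2) * Q \<le> (4 * (b / T1) + c / T4) * Q" using that(1) by (simp add: algebra_simps)
    then show ?thesis using that(2) by (rule mult_right_le_imp_le)
  qed
  ultimately have "card E / real t ^ 2 \<le> 4 * (card V / real t) + card (crossing_pairs E) / real t ^ 4"
    by blast
  then have "card E / real t ^ 2 * real t ^ 2 \<le> (4 * (card V / real t) + card (crossing_pairs E) / real t ^ 4) * real t ^ 2"
    by (intro mult_right_mono) auto
  moreover have "card E / real t ^ 2 * real t ^ 2 = card E" using t by simp
  moreover have "(4 * (card V / real t) + card (crossing_pairs E) / real t ^ 4) * real t ^ 2
      = 4 * real (card V) * t + real (card (crossing_pairs E)) / t\<^sup>2"
    using t by (simp add: field_simps eval_nat_numeral)
  ultimately show ?thesis by simp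
qed

section \<open>Incidences between points and non-vertical lines, given by slope and
  intercept\<close>

definition on_line :: "pt \<Rightarrow> pt \<Rightarrow> bool" where
  "on_line p l \<longleftrightarrow> snd p = fst l * fst p + snd l"

text \<open>Joining only neighbouring points keeps the interiors of edges free of points, and a line
  with \<open>m \<ge> 1\<close> points still contributes \<open>m - 1\<close> edges.\<close>

definition consecutive :: "pt set \<Rightarrow> pt \<Rightarrow> seg set" where
  "consecutive P l = {(p, q). p \<in> P \<and> q \<in> P \<and> on_line p l \<and> on_line q l \<and> fst p < fst q \<and>
     (\<forall>r\<in>P. on_line r l \<longrightarrow> \<not> (fst p < fst r \<and> fst r < fst q))}"

lemma card_on_line_le:
  assumes "finite P"
  shows "card {p\<in>P. on_line p l} \<le> card (consecutive P l) + 1"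
proof (cases "{p\<in>P. on_line p l} = {}")
  case False
  let ?Q = "{p\<in>P. on_line p l}"
  have finQ: "finite ?Q" using assms by simp
  have eqI: "p = q" if "p\<in>?Q" "q\<in>?Q" "fst p = fst q" for p q
    using that by (auto simp: on_line_def prod_eq_iff)
  obtain m where m: "m \<in> ?Q" "fst m = Max (fst ` ?Q)"
    using Max_in[of "fst ` ?Q"] finQ False by (metis (no_types, lifting) finite_imageI image_iff image_is_empty)
  have mmax: "fst p \<le> fst m" if "p\<in>?Q" for p using m that finQ by simp
  have "?Q - {m} \<subseteq> fst ` consecutive P l"
  proof
    fix p assume p: "p \<in> ?Q - {m}"
    then have "fst p \<le> fst m" "p \<noteq> m" using mmax by auto
    moreover have "fst p \<noteq> fst m" using eqI[of p m] p m(1) by blast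
    ultimately have "fst p < fst m" by linarith
    then have S: "finite {q\<in>?Q. fst p < fst q}" "m \<in> {q\<in>?Q. fst p < fst q}" using assms m(1) by simp_all
    then have "{q\<in>?Q. fst p < fst q} \<noteq> {}" by blast
    with S(1) have "Min (fst ` {q\<in>?Q. fst p < fst q}) \<in> fst ` {q\<in>?Q. fst p < fst q}"
      by (intro Min_in finite_imageI) (simp_all only: image_is_empty not_False_eq_True)
    then obtain q where q: "Min (fst ` {q\<in>?Q. fst p < fst q}) = fst q" "q \<in> {q\<in>?Q. fst p < fst q}"
      by (rule imageE)
    have "\<forall>r\<in>{q\<in>?Q. fst p < fst q}. fst q \<le> fst r"
      unfolding q(1)[symmetric] using S(1) by (intro ballI Min_le finite_imageI imageI)
    then have "(p, q) \<in> consecutive P l" using p q(2) by (force simp: consecutive_def)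
    then show "p \<in> fst ` consecutive P l" by force
  qed
  moreover have "finite (consecutive P l)"
    by (rule finite_subset[of _ "P \<times> P"]) (use assms in \<open>auto simp: consecutive_def\<close>)
  ultimately have "card (?Q - {m}) \<le> card (consecutive P l)"
    by (meson card_image_le card_mono finite_imageI le_trans)
  then show ?thesis using m(1) finQ by (simp add: card_Diff_singleton_if split: if_splits)
next
  case True
  then show ?thesis unfolding True by simp
qed

lemma height_consecutive:
  assumes "e \<in> consecutive P l" shows "height e x = fst l * x + snd l"
proof -
  have "snd (fst e) = fst l * fst (fst e) + snd l" "snd (snd e) = fst l * fst (snd e) + snd l" "fst (fst e) < fst (snd e)"
    using assms by (auto simp: consecutive_def on_line_def)
  then show ?thesis by (simp add: height_def slope_def field_simps)
qed

lemma consecutive_same_line: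
  assumes "e \<in> consecutive P l" "f \<in> consecutive P l" and x: "fst (fst e) < x" "x < fst (snd e)" "fst (fst f) < x" "x < fst (snd f)"
  shows "e = f"
proof -
  have "fst (fst e) = fst (fst f)" "fst (snd e) = fst (snd f)"
    using assms unfolding consecutive_def by (force simp: not_less)+
  then show ?thesis using assms by (auto simp: consecutive_def on_line_def prod_eq_iff)
qed

lemma consecutive_disjoint:
  assumes "e \<in> consecutive P l" "e \<in> consecutive P l'" shows "l = l'"
proof -
  have "fst l * x + snd l = fst l' * x + snd l'" for x using assms height_consecutive by metis
  from this[of 0] this[of 1] show ?thesis by (simp add: prod_eq_iff)
qed

theorem szemeredi_trotter:
  assumes P: "finite P" and L: "finite L" and t: "t \<ge> (1::nat)"
  shows "real (card {(p, l) \<in> P \<times> L. on_line p l}) \<le> 4 * real (card P) * t + (real (card L))\<^sup>2 / t\<^sup>2 + card L"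
proof -
  define E where "E = (\<Union>l\<in>L. consecutive P l)"
  have finc: "finite (consecutive P l)" for l
    by (rule finite_subset[of _ "P \<times> P"]) (use P in \<open>auto simp: consecutive_def\<close>)
  have G: "geometric_graph P E"
    unfolding geometric_graph_def
  proof (intro conjI ballI impI)
    fix e w assume "e \<in> E" "w \<in> P" and x: "fst (fst e) < fst w \<and> fst w < fst (snd e)"
    then obtain l where l: "e \<in> consecutive P l" by (auto simp: E_def)
    then have "\<not> on_line w l" using x \<open>w \<in> P\<close> by (auto simp: consecutive_def)
    then show "snd w \<noteq> height e (fst w)" unfolding height_consecutive[OF l] by (simp add: on_line_def)
  qed (use P in \<open>auto simp: E_def consecutive_def\<close>)
  have cE: "card E = (\<Sum>l\<in>L. card (consecutive P l))"
    unfolding E_def using L finc consecutive_disjoint by (intro card_UN_disjoint) auto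
  have "\<forall>e\<in>E. \<exists>l\<in>L. e \<in> consecutive P l" by (auto simp: E_def)
  then obtain ln where ln: "\<And>e. e\<in>E \<Longrightarrow> ln e \<in> L \<and> e \<in> consecutive P (ln e)" by metis
  have "card (crossing_pairs E) \<le> card (L \<times> L)"
  proof (rule card_inj_on_le)
    show "map_prod ln ln ` crossing_pairs E \<subseteq> L \<times> L" using ln by (auto simp: crossing_pairs_def)
    \<comment> \<open>Edges that cross lie on different lines, which meet over a single abscissa,
      and over it a line has at most one edge. So the two lines determine the crossing.\<close>
    show "inj_on (map_prod ln ln) (crossing_pairs E)"
    proof (rule inj_onI, clarify)
      fix e f e' f' assume c: "(e, f) \<in> crossing_pairs E" "(e', f') \<in> crossing_pairs E"
        and eq: "map_prod ln ln (e, f) = map_prod ln ln (e', f')"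
      then have E: "e\<in>E" "f\<in>E" "e'\<in>E" "f'\<in>E" and cr: "crosses e f" "crosses e' f'" by (auto simp: crossing_pairs_def)
      have eq: "ln e = ln e'" "ln f = ln f'" using eq by auto
      note l = ln[OF E(1)] ln[OF E(2)] ln[OF E(3), folded eq] ln[OF E(4), folded eq]
      obtain x where x: "fst (fst e) < x" "x < fst (snd e)" "fst (fst f) < x" "x < fst (snd f)" "height e x = height f x"
        and ne: "e \<noteq> f" using cr by (auto simp: crosses_def)
      obtain y where y: "fst (fst e') < y" "y < fst (snd e')" "fst (fst f') < y" "y < fst (snd f')" "height e' y = height f' y"
        using cr by (auto simp: crosses_def)
      have hx: "fst (ln e) * x + snd (ln e) = fst (ln f) * x + snd (ln f)"
        using x(5) l height_consecutive by metis
      have hy: "fst (ln e) * y + snd (ln e) = fst (ln f) * y + snd (ln f)"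
        using y(5) l height_consecutive by metis
      have "ln e \<noteq> ln f" using consecutive_same_line[of e P "ln e" f x] l x ne by auto
      then have "fst (ln e) \<noteq> fst (ln f)" using hx by (auto simp: prod_eq_iff)
      moreover have "(fst (ln e) - fst (ln f)) * (x - y) = 0" using hx hy by (simp add: algebra_simps)
      ultimately have xy: "x = y" by simp
      show "e = e' \<and> f = f'"
        using consecutive_same_line[of e P "ln e" e' x] consecutive_same_line[of f P "ln f" f' x] l x y xy by auto
    qed
  qed (use L in auto)
  then have cr: "real (card (crossing_pairs E)) \<le> (real (card L))\<^sup>2"
    by (simp add: card_cartesian_product power2_eq_square flip: of_nat_mult)
  have "card {(p, l) \<in> P \<times> L. on_line p l} = (\<Sum>l\<in>L. card {p\<in>P. on_line p l})"
  proof -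
    have "{(p, l) \<in> P \<times> L. on_line p l} = prod.swap ` (SIGMA l:L. {p\<in>P. on_line p l})" by force
    then show ?thesis using P L by (simp add: card_image inj_on_def)
  qed
  also have "\<dots> \<le> (\<Sum>l\<in>L. card (consecutive P l) + 1)" by (intro sum_mono card_on_line_le P)
  also have "\<dots> = card E + card L" unfolding cE sum.distrib by simp
  finally have "real (card {(p, l) \<in> P \<times> L. on_line p l}) \<le> card E + real (card L)" by linarith
  also have "real (card E) \<le> 4 * real (card P) * t + real (card (crossing_pairs E)) / t\<^sup>2"
    by (rule crossing_lemma[OF G t])
  also have "real (card (crossing_pairs E)) / t\<^sup>2 \<le> (real (card L))\<^sup>2 / t\<^sup>2"
    using cr by (intro divide_right_mono) auto
  finally show ?thesis by simp
qed

section \<open>Unit distances on the sphere\<close>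

text \<open>Taking \<open>t\<close> near \<open>(l\<^sup>2 / v) powr (1/3)\<close> balances
  \<open>v * t\<close> against \<open>l\<^sup>2 / t\<^sup>2\<close>. This requires
  \<open>l\<^sup>2 \<ge> v\<close> for \<open>t\<close> to be at least 1; otherwise
  \<open>t = 1\<close> already makes the bound linear in \<open>v\<close>.\<close>

lemma incidences_le:
  assumes P: "finite P" and L: "finite L"
  defines "v \<equiv> real (card P)" and "l \<equiv> real (card L)"
  shows "real (card {(p, l) \<in> P \<times> L. on_line p l}) \<le> 16 * max ((v * l) powr (2/3)) (max v l)"
proof (cases "v = 0")
  case True
  then have "P = {}" using P by (simp add: v_def)
  then show ?thesis by (simp add: l_def v_def)
next
  case False
  then have v: "v \<ge> 1" unfolding v_def using P by (simp add: Suc_leI card_gt_0_iff)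
  have l0: "l \<ge> 0" by (simp add: l_def)
  let ?A = "(v * l) powr (2/3)"
  show ?thesis
  proof (cases "l\<^sup>2 \<ge> v")
    case True
    define s where "s = (l\<^sup>2 / v) powr (1/3)"
    have lpos: "l > 0" using True v l0 by (cases "l = 0") auto
    have s1: "s \<ge> 1" unfolding s_def using True v by (intro ge_one_powr_ge_zero) auto
    have s3: "s ^ 3 = l\<^sup>2 / v" unfolding s_def using v lpos by (simp add: powr_power)
    define t where "t = nat \<lceil>s\<rceil>"
    have t: "t \<ge> 1" "real t \<ge> s" "real t \<le> 2 * s" unfolding t_def using s1 by linarith+
    have cub: "(v * s) ^ 3 = ?A ^ 3"
    proof -
      have "(v * s) ^ 3 = (v * l)\<^sup>2" unfolding power_mult_distrib s3 using v
        by (simp add: power2_eq_square power3_eq_cube)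
      also have "\<dots> = ?A ^ 3" using v lpos by (simp add: powr_power)
      finally show ?thesis .
    qed
    have "0 \<le> v * s" using v s1 by simp
    then have vs: "v * s = ?A" by (rule power_eq_imp_eq_base[OF cub]) simp_all
    have "l\<^sup>2 / t\<^sup>2 \<le> l\<^sup>2 / s\<^sup>2" using t s1 by (intro divide_left_mono power_mono mult_pos_pos) auto
    also have "\<dots> = v * s"
    proof -
      have l2: "l\<^sup>2 = v * (s * s * s)" using s3 v by (simp add: power3_eq_cube)
      show ?thesis unfolding l2 unfolding power2_eq_square using s1 by simp
    qed
    finally have "l\<^sup>2 / t\<^sup>2 \<le> ?A" using vs by simp
    moreover have "4 * v * t \<le> 4 * v * (2 * s)" using t v by (intro mult_left_mono) auto
    then have "4 * v * t \<le> 8 * ?A" unfolding vs[symmetric] by simp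
    ultimately show ?thesis using szemeredi_trotter[OF P L t(1)] v l0 unfolding v_def l_def by linarith
  next
    case False
    have "l \<le> l\<^sup>2" unfolding l_def power2_eq_square by (simp flip: of_nat_mult)
    then have "l \<le> v" using False by linarith
    moreover have "real (card {(p, l) \<in> P \<times> L. on_line p l}) \<le> 4 * v + l\<^sup>2 + l"
      using szemeredi_trotter[OF P L, of 1] by (simp add: v_def l_def)
    ultimately show ?thesis using False v by linarith
  qed
qed

section \<open>Unit distance as orthogonality\<close>

lemma S2_inner: "p \<in> S2 \<longleftrightarrow> p \<bullet> p = 1 / 2"
proof -
  have "p \<in> S2 \<longleftrightarrow> norm p = sqrt (1 / 2)" by (auto simp: S2_def real_sqrt_divide)
  also have "\<dots> \<longleftrightarrow> p \<bullet> p = 1 / 2" by (simp add: norm_eq_sqrt_inner)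
  finally show ?thesis .
qed

lemma S2_nonzero: "p \<in> S2 \<Longrightarrow> p \<noteq> 0"
  by (auto simp: S2_inner)

lemma S2_uminus [simp]: "- p \<in> S2 \<longleftrightarrow> p \<in> S2"
  by (simp add: S2_inner)

lemma dist_S2:
  assumes "p \<in> S2" "q \<in> S2"
  shows "dist p q = 1 \<longleftrightarrow> p \<bullet> q = 0"
proof -
  have "(dist p q)\<^sup>2 = 1 - 2 * (p \<bullet> q)"
    using assms by (simp add: S2_inner dist_norm power2_norm_eq_inner inner_diff inner_commute)
  then show ?thesis
    by (smt (verit) one_power2 power2_eq_1_iff zero_le_dist)
qed

lemma S2_parallel:
  assumes "p \<in> S2" "q \<in> S2" "p = c *\<^sub>R q"
  shows "p = q \<or> p = - q"
proof -
  have "p \<bullet> p = c\<^sup>2 * (q \<bullet> q)" using assms(3) by (simp add: power2_eq_square)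
  then have "1 / 2 = c\<^sup>2 * (1 / 2)" using assms(1,2) unfolding S2_inner by metis
  then have "c\<^sup>2 = 1" by simp
  then show ?thesis using assms(3) by (auto simp: power2_eq_1_iff)
qed

lemma card_le_fibres:
  assumes "finite A" "\<And>a. a \<in> A \<Longrightarrow> card {x\<in>A. f x = f a} \<le> k"
  shows "card A \<le> k * card (f ` A)"
proof -
  have "A = (\<Union>y\<in>f ` A. {x\<in>A. f x = y})" by auto
  then have "card A \<le> (\<Sum>y\<in>f ` A. card {x\<in>A. f x = y})"
    using card_UN_le[of "f ` A" "\<lambda>y. {x\<in>A. f x = y}"] assms(1) by simp
  also have "\<dots> \<le> (\<Sum>y\<in>f ` A. k)" using assms(2) by (intro sum_mono) auto
  finally show ?thesis by (simp add: mult.commute)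
qed

text \<open>Projective duality: where \<open>q $ k\<close> and \<open>p $ j\<close> do not vanish,
  orthogonality of \<open>p\<close> and \<open>q\<close> says that an affine point obtained from
  \<open>q\<close> lies on an affine line obtained from \<open>p\<close>. Both maps forget only the
  sign, whence the factor 4. The hypotheses \<open>inner\<close> and \<open>eqI\<close> express that
  \<open>i\<close>, \<open>j\<close>, \<open>k\<close> are the three coordinates in some
  order.\<close>

lemma incidences_coordinates:
  fixes X Y :: "(real ^ 3) set" and i j k :: 3
  assumes fin: "finite X" "finite Y" and sub: "X \<subseteq> S2" "Y \<subseteq> S2"
    and inner: "\<And>p q :: real ^ 3. p \<bullet> q = p $ i * q $ i + p $ j * q $ j + p $ k * q $ k"
    and eqI: "\<And>p q :: real ^ 3. p $ i = q $ i \<Longrightarrow> p $ j = q $ j \<Longrightarrow> p $ k = q $ k \<Longrightarrow> p = q"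
  shows "real (card {(p, q) \<in> X \<times> Y. p \<bullet> q = 0 \<and> p $ j \<noteq> 0 \<and> q $ k \<noteq> 0})
     \<le> 64 * max ((real (card X) * real (card Y)) powr (2/3)) (max (card X) (card Y))"
proof -
  let ?A = "{(p, q) \<in> X \<times> Y. p \<bullet> q = 0 \<and> p $ j \<noteq> 0 \<and> q $ k \<noteq> 0}"
  define pt where "pt q = (q $ i / q $ k, q $ j / q $ k)" for q :: "real ^ 3"
  define ln where "ln p = (- p $ i / p $ j, - p $ k / p $ j)" for p :: "real ^ 3"
  let ?P = "pt ` Y" and ?L = "ln ` X"
  let ?f = "\<lambda>(p, q). (pt q, ln p)"
  have pt: "q = q' \<or> q = - q'" if "q\<in>Y" "q'\<in>Y" "q $ k \<noteq> 0" "q' $ k \<noteq> 0" "pt q = pt q'" for q q'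
  proof (rule S2_parallel)
    show "q = (q $ k / q' $ k) *\<^sub>R q'"
      using that by (intro eqI) (auto simp: pt_def field_simps)
  qed (use that sub in auto)
  have ln: "p = p' \<or> p = - p'" if "p\<in>X" "p'\<in>X" "p $ j \<noteq> 0" "p' $ j \<noteq> 0" "ln p = ln p'" for p p'
  proof (rule S2_parallel)
    show "p = (p $ j / p' $ j) *\<^sub>R p'"
      using that by (intro eqI) (auto simp: ln_def field_simps)
  qed (use that sub in auto)
  have finA: "finite ?A" by (rule finite_subset[of _ "X \<times> Y"]) (use fin in auto)
  have "card ?A \<le> 4 * card (?f ` ?A)"
  proof (rule card_le_fibres[OF finA])
    fix a assume a: "a \<in> ?A"
    have "{x\<in>?A. ?f x = ?f a} \<subseteq> {fst a, - fst a} \<times> {snd a, - snd a}"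
      using pt ln a by fastforce
    then have "card {x\<in>?A. ?f x = ?f a} \<le> card ({fst a, - fst a} \<times> {snd a, - snd a})"
      by (rule card_mono[rotated]) auto
    also have "\<dots> \<le> 2 * 2" unfolding card_cartesian_product
      by (intro mult_mono card_insert_le_m1) auto
    finally show "card {x\<in>?A. ?f x = ?f a} \<le> 4" by simp
  qed
  also have "?f ` ?A \<subseteq> {(p, l) \<in> ?P \<times> ?L. on_line p l}"
    using inner by (auto simp: on_line_def pt_def ln_def field_simps)
  then have "card (?f ` ?A) \<le> card {(p, l) \<in> ?P \<times> ?L. on_line p l}"
    by (rule card_mono[rotated]) (rule finite_subset[of _ "?P \<times> ?L"], use fin in auto)
  finally have "real (card ?A) \<le> 4 * real (card {(p, l) \<in> ?P \<times> ?L. on_line p l})"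
    by linarith
  also have "\<dots> \<le> 4 * (16 * max ((real (card ?P) * real (card ?L)) powr (2/3)) (max (card ?P) (card ?L)))"
    using incidences_le[of ?P ?L] fin by simp
  also have "\<dots> \<le> 4 * (16 * max ((real (card X) * real (card Y)) powr (2/3)) (max (card X) (card Y)))"
  proof -
    have c: "real (card ?P) \<le> card Y" "real (card ?L) \<le> card X" using fin by (simp_all add: card_image_le)
    then have "(real (card ?P) * real (card ?L)) powr (2/3) \<le> (real (card X) * real (card Y)) powr (2/3)"
      unfolding mult.commute[of "real (card ?P)"] by (intro powr_mono2 mult_mono) auto
    with c show ?thesis by linarith
  qed
  finally show ?thesis by simp
qed

text \<open>Orthogonal nonzero vectors have nonzero entries at two different positions
  \<open>j\<close> of \<open>p\<close> and \<open>k\<close> of \<open>q\<close>; otherwise both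
  would be supported on one and the same axis. The six ordered pairs of positions give
  \<open>384 = 6 * 64\<close>.\<close>

theorem unit_pairs_le:
  fixes X Y :: "(real ^ 3) set"
  assumes fin: "finite X" "finite Y" and sub: "X \<subseteq> S2" "Y \<subseteq> S2"
  shows "real (card {(p, q) \<in> X \<times> Y. dist p q = 1})
     \<le> 384 * max ((real (card X) * real (card Y)) powr (2/3)) (max (card X) (card Y))"
proof -
  define B where "B j k = {(p, q) \<in> X \<times> Y. p \<bullet> q = 0 \<and> p $ j \<noteq> 0 \<and> q $ k \<noteq> 0}" for j k :: 3
  let ?M = "max ((real (card X) * real (card Y)) powr (2/3)) (max (card X) (card Y))"
  have finB: "finite (B j k)" for j k
    by (rule finite_subset[of _ "X \<times> Y"]) (use fin in \<open>auto simp: B_def\<close>)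
  note coords = inner_vec_def sum_3 vec_eq_iff forall_3
  have B12: "real (card (B 1 2)) \<le> 64 * ?M"
    unfolding B_def by (rule incidences_coordinates[OF fin sub, where i=3 and j=1 and k=2]) (simp_all add: coords)
  have B13: "real (card (B 1 3)) \<le> 64 * ?M"
    unfolding B_def by (rule incidences_coordinates[OF fin sub, where i=2 and j=1 and k=3]) (simp_all add: coords)
  have B21: "real (card (B 2 1)) \<le> 64 * ?M"
    unfolding B_def by (rule incidences_coordinates[OF fin sub, where i=3 and j=2 and k=1]) (simp_all add: coords)
  have B23: "real (card (B 2 3)) \<le> 64 * ?M"
    unfolding B_def by (rule incidences_coordinates[OF fin sub, where i=1 and j=2 and k=3]) (simp_all add: coords)
  have B31: "real (card (B 3 1)) \<le> 64 * ?M"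
    unfolding B_def by (rule incidences_coordinates[OF fin sub, where i=2 and j=3 and k=1]) (simp_all add: coords)
  have B32: "real (card (B 3 2)) \<le> 64 * ?M"
    unfolding B_def by (rule incidences_coordinates[OF fin sub, where i=1 and j=3 and k=2]) (simp_all add: coords)
  have six: "a \<noteq> 0 \<and> y \<noteq> 0 \<or> a \<noteq> 0 \<and> z \<noteq> 0 \<or> b \<noteq> 0 \<and> x \<noteq> 0 \<or> b \<noteq> 0 \<and> z \<noteq> 0 \<or> c \<noteq> 0 \<and> x \<noteq> 0 \<or> c \<noteq> 0 \<and> y \<noteq> 0"
    if "a * x + b * y + c * z = 0" "a \<noteq> 0 \<or> b \<noteq> 0 \<or> c \<noteq> 0" "x \<noteq> 0 \<or> y \<noteq> 0 \<or> z \<noteq> 0" for a b c x y z :: real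
    using that by (cases "a = 0"; cases "b = 0"; cases "c = 0") auto
  let ?U = "B 1 2 \<union> (B 1 3 \<union> (B 2 1 \<union> (B 2 3 \<union> (B 3 1 \<union> B 3 2))))"
  have "{(p, q) \<in> X \<times> Y. dist p q = 1} \<subseteq> ?U"
  proof
    fix a assume "a \<in> {(p, q) \<in> X \<times> Y. dist p q = 1}"
    then obtain p q where a: "a = (p, q)" and pq: "p \<in> X" "q \<in> Y" "dist p q = 1" by blast
    then have S: "p \<in> S2" "q \<in> S2" and o: "p \<bullet> q = 0" using sub dist_S2[of p q] by auto
    have nz: "p $ 1 \<noteq> 0 \<or> p $ 2 \<noteq> 0 \<or> p $ 3 \<noteq> 0" "q $ 1 \<noteq> 0 \<or> q $ 2 \<noteq> 0 \<or> q $ 3 \<noteq> 0"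
      using S2_nonzero[OF S(1)] S2_nonzero[OF S(2)] by (auto simp: vec_eq_iff forall_3)
    have "p $ 1 * q $ 1 + p $ 2 * q $ 2 + p $ 3 * q $ 3 = 0" using o by (simp add: inner_vec_def sum_3)
    from six[OF this nz] show "a \<in> ?U" using o pq(1,2) unfolding B_def a by blast
  qed
  then have "card {(p, q) \<in> X \<times> Y. dist p q = 1} \<le> card ?U"
    using finB by (intro card_mono) auto
  also have "\<dots> \<le> card (B 1 2) + (card (B 1 3) + (card (B 2 1) + (card (B 2 3) + (card (B 3 1) + card (B 3 2)))))"
    by (intro order_trans[OF card_Un_le] add_left_mono order_refl)
  finally show ?thesis using B12 B13 B21 B23 B31 B32 by linarith
qed

section \<open>Exponents of cycles\<close>

text \<open>Three times the exponent claimed for \<open>k\<close>-cycles.\<close>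

definition phi :: "nat \<Rightarrow> nat" where
  "phi k = 6 * (k div 5) + (if k mod 5 = 2 then 1 else if k mod 5 \<ge> 3 then 3 else 0)"

text \<open>Three times the exponent for paths with \<open>j\<close> edges that contain no heavy
  vertex with its antipode two steps further on. The first values 3, 4, 6 stand for a vertex, for an
  edge by Szemeredi-Trotter and for two edges with free outer vertices.\<close>

definition path_exponent :: "nat \<Rightarrow> nat" where
  "path_exponent j = j + 3 + (if j mod 3 = 2 then 1 else 0)"

lemma phi_add: "phi (5 * c + d) = 6 * c + phi d"
  by (simp add: phi_def)

text \<open>Adds up the costs of the two gaps on either side of an antipodal block.\<close>

lemma phi_superadditive: "phi a + phi b \<le> phi (a + b)"
proof -
  define m r where "m = a div 5" and "r = a mod 5"
  define m' r' where "m' = b div 5" and "r' = b mod 5"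
  have a: "a = 5 * m + r" and b: "b = 5 * m' + r'" and r: "r < 5" "r' < 5"
    by (simp_all add: m_def r_def m'_def r'_def)
  have "a + b = 5 * (m + m') + (r + r')" using a b by simp
  then have ph: "phi (a + b) = 6 * (m + m') + phi (r + r')" by (simp only: phi_add)
  have "r = 0 \<or> r = 1 \<or> r = 2 \<or> r = 3 \<or> r = 4" "r' = 0 \<or> r' = 1 \<or> r' = 2 \<or> r' = 3 \<or> r' = 4"
    using r by linarith+
  then have "phi r + phi r' \<le> phi (r + r')" by (elim disjE) (simp_all add: phi_def)
  then show ?thesis unfolding ph unfolding a b phi_add by simp
qed

lemma phi_ge: "a + a div 5 \<le> phi a + 1"
proof -
  define m r where "m = a div 5" and "r = a mod 5"
  have a: "a = 5 * m + r" and r: "r < 5" by (simp_all add: m_def r_def)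
  have "r = 0 \<or> r = 1 \<or> r = 2 \<or> r = 3 \<or> r = 4" using r by linarith
  then have "r \<le> phi r + 1" by (elim disjE) (simp_all add: phi_def)
  then show ?thesis unfolding m_def[symmetric] unfolding a phi_add by simp
qed

text \<open>In a gap of \<open>L\<close> edges between known ends, the vertices next to the ends
  come for free and a path with \<open>L - 4\<close> edges is left. The 3 is the price of an
  antipodal block that closes the gap to a cycle of length \<open>L + 2\<close>.\<close>

lemma path_exponent_le_gap:
  assumes "L \<ge> 4" shows "path_exponent (L - 4) + 3 \<le> phi (L + 2)"
proof -
  define N where "N = L - 4"
  have "N + 6 + (if N mod 3 = 2 then 1 else 0) \<le> phi (N + 6)"
  proof (cases "N < 9")
    case True
    then have "N = 0 \<or> N = 1 \<or> N = 2 \<or> N = 3 \<or> N = 4 \<or> N = 5 \<or> N = 6 \<or> N = 7 \<or> N = 8" by linarith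
    then show ?thesis by (elim disjE) (simp_all add: phi_def)
  next
    case False
    then have "(N + 6) div 5 \<ge> 3" by linarith
    then show ?thesis using phi_ge[of "N + 6"] by simp
  qed
  then show ?thesis using assms by (simp add: N_def path_exponent_def)
qed

text \<open>The excluded lengths are genuine exceptions here: for 6, 7, 9 the left side is 7, 9, 10
  and the right side 6, 7, 9.\<close>

lemma path_exponent_le_cycle:
  assumes "k \<ge> 5" "k \<notin> {6, 7, 9}" shows "path_exponent (k - 2) \<le> phi k"
proof -
  define N where "N = k - 5"
  have N: "N \<noteq> 1" "N \<noteq> 2" "N \<noteq> 4" using assms by (auto simp: N_def)
  have "N + 6 + (if (N + 3) mod 3 = 2 then 1 else 0) \<le> phi (N + 5)"
  proof (cases "N < 10")
    case True
    then have "N = 0 \<or> N = 3 \<or> N = 5 \<or> N = 6 \<or> N = 7 \<or> N = 8 \<or> N = 9" using N by presburger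
    then show ?thesis by (elim disjE) (simp_all add: phi_def)
  next
    case False
    then have "(N + 5) div 5 \<ge> 3" by linarith
    then show ?thesis using phi_ge[of "N + 5"] by simp
  qed
  moreover have "k = N + 5" using assms(1) by (simp add: N_def)
  ultimately show ?thesis by (simp add: path_exponent_def)
qed

text \<open>For \<open>path_bound\<close>, with \<open>d\<close> the distance between the first and
  the last heavy position: when neither cut alone is affordable, \<open>d\<close> is not divisible
  by 3, and then the piece between the two cuts has no surcharge.\<close>

lemma mod_3_cuts:
  assumes "(d + c) mod 3 = 1" "(i + d) mod 3 = 1" "(i + d + c) mod 3 \<noteq> (2::nat)"
  shows "d mod 3 = 1 \<or> d mod 3 = 2"
proof (rule ccontr)
  assume "\<not> ?thesis"
  moreover have "d mod 3 < 3" by simp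
  ultimately have "d mod 3 = 0" by linarith
  then obtain q where d: "d = 3 * q" by auto
  have "c mod 3 = 1" "i mod 3 = 1" using assms(1,2) by (simp_all add: d)
  then have "(i + c) mod 3 = 2" using mod_add_eq[of i 3 c] by simp
  then show False using assms(3) by (simp add: d add.assoc add.left_commute[of i])
qed

text \<open>\<open>hb J I r\<close> stands for: once the vertices at the positions in \<open>J\<close> are known, there are at most
  \<open>n\<^sup>r\<close> choices for the vertices at the positions in \<open>I\<close>. There are \<open>n\<close> to the power \<open>x i\<close> vertices at
  position \<open>i\<close> and \<open>n\<close> to the power \<open>e i\<close> pairs at the positions \<open>i\<close> and \<open>i + 1\<close>. The set \<open>A\<close> consists of the
  positions whose two neighbours are antipodal.\<close>

locale tours =
  fixes hb :: "nat set \<Rightarrow> nat set \<Rightarrow> real \<Rightarrow> bool" and x e :: "nat \<Rightarrow> real" and A :: "nat set" and eps :: real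
  assumes chain: "hb J I r \<Longrightarrow> hb (J \<union> I) I' r' \<Longrightarrow> hb J (I \<union> I') (r + r')"
    and weaken: "hb J I r \<Longrightarrow> J \<subseteq> J' \<Longrightarrow> I' \<subseteq> I \<union> J' \<Longrightarrow> r \<le> r' \<Longrightarrow> hb J' I' r'"
    and known: "hb {} {} 0"
    and vertex: "hb {} {i} (x i)"
    and fwd: "hb {i} {Suc i} (e i - x i + eps)"
    and bwd: "hb {Suc i} {i} (e i - x (Suc i) + eps)"
    and x0: "0 \<le> x i" and x1: "x i \<le> 1"
    and e_le: "e i \<le> max (2/3 * (x i + x (Suc i))) (max (x i) (x (Suc i))) + eps"
    and skip: "Suc i \<notin> A \<Longrightarrow> hb {i, i + 2} {Suc i} eps"
    and anti: "Suc i \<in> A \<Longrightarrow> hb {i} {i + 2} 0"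
    and x_anti: "Suc i \<in> A \<Longrightarrow> x (i + 2) = x i"
    and A_iso: "i \<in> A \<Longrightarrow> i + 2 \<notin> A"
    and eps: "0 \<le> eps"
begin

lemma extend:
  assumes "hb J I r" "hb K I' r'" "K \<subseteq> J \<union> I" "M \<subseteq> I \<union> I' \<union> J" "r + r' \<le> s"
  shows "hb J M s"
proof -
  have "hb (J \<union> I) I' r'" using assms(2,3) by (rule weaken) auto
  from chain[OF assms(1) this] show ?thesis by (rule weaken) (use assms in auto)
qed

lemma join_skip:
  assumes "hb J {a..p} r" "hb J {p + 2..b} s" "Suc p \<notin> A" "a \<le> p" "p + 2 \<le> b" "r + s + eps \<le> t"
  shows "hb J {a..b} t"
proof -
  have "hb J ({a..p} \<union> {p + 2..b}) (r + s)"
    by (rule extend[OF assms(1,2)]) auto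
  then show ?thesis
  proof (rule extend[OF _ skip[OF assms(3)]])
    show "{a..b} \<subseteq> {a..p} \<union> {p + 2..b} \<union> {Suc p} \<union> J"
    proof
      fix y assume "y \<in> {a..b}"
      then have "y \<in> {a..p} \<or> y \<in> {p + 2..b} \<or> y = Suc p" by auto
      then show "y \<in> {a..p} \<union> {p + 2..b} \<union> {Suc p} \<union> J" by blast
    qed
  qed (use assms in auto)
qed

lemma e_cases:
  "3 * e i \<le> 2 * x i + 2 * x (Suc i) + 3 * eps \<or> e i \<le> x i + eps \<or> e i \<le> x (Suc i) + eps"
  using e_le[of i] by (auto simp: max_def field_simps split: if_splits)

definition heavy :: "nat \<Rightarrow> bool" where "heavy i \<longleftrightarrow> x i \<le> 1 / 2"

text \<open>The last vertex carries the potential \<open>2 * x / 3\<close>. A step from weight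
  \<open>x\<close> to weight \<open>x'\<close>, both above 1/2, costs
  \<open>(2 * x' - x) / 3\<close> up to errors, and \<open>x \<le> 1\<close> for the vertex left
  behind leaves one third per edge.\<close>

lemma lin_right:
  "(\<And>i. i \<le> j \<Longrightarrow> \<not> heavy (a + i)) \<Longrightarrow> hb {} {a..a + j} ((real j + 1 + 2 * x (a + j)) / 3 + 2 * real j * eps)"
proof (induction j)
  case 0
  show ?case by (rule weaken[OF vertex[of a]]) (use x1[of a] in auto)
next
  case (Suc j)
  have nh: "x (a + j) > 1/2" "x (Suc (a + j)) > 1/2" using Suc.prems[of j] Suc.prems[of "Suc j"] by (auto simp: heavy_def)
  have IH: "hb {} {a..a + j} ((real j + 1 + 2 * x (a + j)) / 3 + 2 * real j * eps)" using Suc by simp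
  show ?case
  proof (rule extend[OF IH fwd[of "a + j"]])
    have "3 * e (a + j) \<le> 2 * x (a + j) + 2 * x (Suc (a + j)) + 3 * eps"
      using e_cases[of "a + j"] nh x1[of "a + j"] x1[of "Suc (a + j)"] by (elim disjE) linarith+
    then show "(real j + 1 + 2 * x (a + j)) / 3 + 2 * real j * eps + (e (a + j) - x (a + j) + eps)
        \<le> (real (Suc j) + 1 + 2 * x (a + Suc j)) / 3 + 2 * real (Suc j) * eps"
      using x1[of "a + j"] by (simp add: field_simps)
  qed auto
qed

lemma lin_left:
  "(\<And>i. i \<le> j \<Longrightarrow> \<not> heavy (a + i)) \<Longrightarrow> hb {} {a..a + j} ((real j + 1 + 2 * x a) / 3 + 2 * real j * eps)"
proof (induction j arbitrary: a)
  case 0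
  show ?case by (rule weaken[OF vertex[of a]]) (use x1[of a] in auto)
next
  case (Suc j)
  have nh: "x a > 1/2" "x (Suc a) > 1/2" using Suc.prems[of 0] Suc.prems[of "Suc 0"] by (auto simp: heavy_def)
  have IH: "hb {} {Suc a..Suc a + j} ((real j + 1 + 2 * x (Suc a)) / 3 + 2 * real j * eps)"
    by (rule Suc.IH) (use Suc.prems[of "Suc _"] in simp)
  have sub: "{a..a + Suc j} \<subseteq> {Suc a..Suc a + j} \<union> {a} \<union> {}" by auto
  show ?case
  proof (rule extend[OF IH bwd[of a] _ sub])
    have "3 * e a \<le> 2 * x a + 2 * x (Suc a) + 3 * eps"
      using e_cases[of a] nh x1[of a] x1[of "Suc a"] by (elim disjE) linarith+
    then show "(real j + 1 + 2 * x (Suc a)) / 3 + 2 * real j * eps + (e a - x (Suc a) + eps)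
        \<le> (real (Suc j) + 1 + 2 * x a) / 3 + 2 * real (Suc j) * eps"
      using x1[of "Suc a"] by (simp add: field_simps)
  qed auto
qed

text \<open>A heavy end saves one third against \<open>j + 3\<close>: in every case of
  \<open>e_cases\<close> the last step costs at most \<open>(2 - 2 * x) / 3\<close> up to errors,
  where \<open>x\<close> belongs to the vertex before it, and this cancels the potential in
  \<open>lin_right\<close>.\<close>

lemma first_heavy:
  assumes "\<And>i. i < j \<Longrightarrow> \<not> heavy (a + i)" "heavy (a + j)"
  shows "hb {} {a..a + j} ((real j + 2) / 3 + 2 * real j * eps)"
proof (cases j)
  case 0
  show ?thesis unfolding 0 by (rule weaken[OF vertex[of a]]) (use assms(2) 0 in \<open>auto simp: heavy_def\<close>)
next
  case (Suc m)
  have nh: "x (a + m) > 1/2" "x (Suc (a + m)) \<le> 1/2" using assms(1)[of m] assms(2) Suc by (auto simp: heavy_def)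
  have IH: "hb {} {a..a + m} ((real m + 1 + 2 * x (a + m)) / 3 + 2 * real m * eps)" using assms Suc by (intro lin_right) auto
  show ?thesis unfolding Suc
  proof (rule extend[OF IH fwd[of "a + m"]])
    have "3 * e (a + m) \<le> x (a + m) + 2 + 3 * eps"
      using e_cases[of "a + m"] nh x1[of "a + m"] by (elim disjE) linarith+
    then show "(real m + 1 + 2 * x (a + m)) / 3 + 2 * real m * eps + (e (a + m) - x (a + m) + eps)
        \<le> (real (Suc m) + 2) / 3 + 2 * real (Suc m) * eps"
      using x1[of "a + m"] by (simp add: field_simps)
  qed auto
qed

lemma last_heavy:
  assumes "\<And>i. 0 < i \<Longrightarrow> i \<le> j \<Longrightarrow> \<not> heavy (a + i)" "heavy a"
  shows "hb {} {a..a + j} ((real j + 2) / 3 + 2 * real j * eps)"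
proof (cases j)
  case 0
  show ?thesis unfolding 0 by (rule weaken[OF vertex[of a]]) (use assms(2) 0 in \<open>auto simp: heavy_def\<close>)
next
  case (Suc m)
  have nh: "x a \<le> 1/2" "x (Suc a) > 1/2" using assms(1)[of 1] assms(2) Suc by (auto simp: heavy_def)
  have IH: "hb {} {Suc a..Suc a + m} ((real m + 1 + 2 * x (Suc a)) / 3 + 2 * real m * eps)"
    by (rule lin_left) (use assms(1)[of "Suc _"] Suc in simp)
  have sub: "{a..a + Suc m} \<subseteq> {Suc a..Suc a + m} \<union> {a} \<union> {}" by auto
  show ?thesis unfolding Suc
  proof (rule extend[OF IH bwd[of a] _ sub])
    have "3 * e a \<le> x (Suc a) + 2 + 3 * eps"
      using e_cases[of a] nh x1[of "Suc a"] by (elim disjE) linarith+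
    then show "(real m + 1 + 2 * x (Suc a)) / 3 + 2 * real m * eps + (e a - x (Suc a) + eps)
        \<le> (real (Suc m) + 2) / 3 + 2 * real (Suc m) * eps"
      using x1[of "Suc a"] by (simp add: field_simps)
  qed auto
qed

text \<open>Excludes antipodal heavy vertices two steps apart. Testing the left one suffices, since
  \<open>x_anti\<close> gives both the same weight.\<close>

definition mild :: "nat \<Rightarrow> nat \<Rightarrow> bool" where
  "mild a b \<longleftrightarrow> (\<forall>i. a \<le> i \<and> i + 2 \<le> b \<and> heavy i \<longrightarrow> Suc i \<notin> A)"

lemma mild_left: "mild a b \<Longrightarrow> a \<le> i \<Longrightarrow> i + 2 \<le> b \<Longrightarrow> heavy (i + 2) \<Longrightarrow> Suc i \<notin> A"
  using x_anti[of i] by (auto simp: mild_def heavy_def)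

lemma mild_subset: "mild a b \<Longrightarrow> a \<le> a' \<Longrightarrow> b' \<le> b \<Longrightarrow> mild a' b'"
  by (auto simp: mild_def)

text \<open>With exponents in thirds: up to the first heavy vertex a path of \<open>i\<close> edges costs only \<open>i + 2\<close>, and the
  vertex after it is determined by its two neighbours; likewise from the last heavy vertex on. One of
  these two cuts, or both together, gives the bound by induction.\<close>

lemma path_bound:
  "mild a (a + j) \<Longrightarrow> hb {} {a..a + j} (path_exponent j / 3 + (2 * real j + 2) * eps)"
proof (induction j arbitrary: a rule: less_induct)
  case (less j)
  note mild = less.prems
  show ?case
  proof (cases "\<exists>i\<le>j. heavy (a + i)")
    case False
    then have "hb {} {a..a + j} ((real j + 1 + 2 * x (a + j)) / 3 + 2 * real j * eps)" by (intro lin_right) auto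
    then show ?thesis
    proof (rule weaken)
      have "real j + 3 \<le> real (path_exponent j)" by (simp add: path_exponent_def)
      then show "(real j + 1 + 2 * x (a + j)) / 3 + 2 * real j * eps \<le> path_exponent j / 3 + (2 * real j + 2) * eps"
        using x1[of "a + j"] eps by (simp add: field_simps)
    qed auto
  next
    case True
    define i where "i = (LEAST i. heavy (a + i))"
    obtain t0 where t0: "t0 \<le> j" "heavy (a + t0)" using True by blast
    have hi: "heavy (a + i)" unfolding i_def using t0(2) by (rule LeastI)
    have ij: "i \<le> j" unfolding i_def using Least_le[of "\<lambda>i. heavy (a + i)" t0] t0 by simp
    have i_min: "\<not> heavy (a + t)" if "t < i" for t using that not_less_Least unfolding i_def by blast
    define l where "l = (GREATEST i. i \<le> j \<and> heavy (a + i))"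
    have hl: "l \<le> j \<and> heavy (a + l)"
      unfolding l_def using t0 by (rule_tac GreatestI_ex_nat[where P="\<lambda>i. i \<le> j \<and> heavy (a + i)" and b=j]) auto
    have l_max: "t \<le> l" if "t \<le> j" "heavy (a + t)" for t
      unfolding l_def using that by (rule_tac Greatest_le_nat[where P="\<lambda>i. i \<le> j \<and> heavy (a + i)" and b=j]) auto
    have il: "i \<le> l" using hi ij l_max by blast
    have Lb: "hb {} {a..a + i} ((real i + 2) / 3 + 2 * real i * eps)" using i_min hi by (rule first_heavy)
    have Rb: "hb {} {a + l..a + j} ((real (j - l) + 2) / 3 + 2 * real (j - l) * eps)"
    proof -
      have "hb {} {a + l..a + l + (j - l)} ((real (j - l) + 2) / 3 + 2 * real (j - l) * eps)"
      proof (rule last_heavy)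
        fix t assume t: "0 < t" "t \<le> j - l"
        show "\<not> heavy (a + l + t)"
        proof
          assume "heavy (a + l + t)"
          then have "l + t \<le> l" using t hl by (intro l_max) (auto simp: add.assoc)
          then show False using t by simp
        qed
      qed (use hl in auto)
      then show ?thesis using hl by simp
    qed
    \<comment> \<open>A cut after \<open>i\<close> leaves a path with \<open>j - i - 2\<close>
      edges, which has the surcharge exactly when \<open>j - i\<close> is 1 modulo 3. The cut is
      affordable if it does not, or if \<open>j\<close> has the surcharge as well; a cut before
      \<open>l\<close> is symmetric. In the last case both cuts are made.\<close>
    consider "i = j" | "l = 0"
      | "i < j" "(j - i) mod 3 \<noteq> 1 \<or> j mod 3 = 2" | "0 < l" "l mod 3 \<noteq> 1 \<or> j mod 3 = 2"
      | "(j - i) mod 3 = 1" "l mod 3 = 1" "j mod 3 \<noteq> 2"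
      using ij le_neq_implies_less not_gr_zero by blast
    then show ?thesis
    proof cases
      case 1
      then have "(real i + 2) / 3 + 2 * real i * eps \<le> path_exponent j / 3 + (2 * real j + 2) * eps"
        using eps by (simp add: path_exponent_def field_simps)
      then show ?thesis by (rule_tac weaken[OF Lb]) (use 1 in auto)
    next
      case 2
      then have "(real (j - l) + 2) / 3 + 2 * real (j - l) * eps \<le> path_exponent j / 3 + (2 * real j + 2) * eps"
        using eps by (simp add: path_exponent_def field_simps)
      then show ?thesis by (rule_tac weaken[OF Rb]) (use 2 in auto)
    next
      case 3
      show ?thesis
      proof (cases "Suc i = j")
        case True
        \<comment> \<open>A single vertex is left, with no neighbour beyond it to determine it. Its
          full factor \<open>n\<close> is paid by the surcharge of \<open>j\<close>.\<close>
        then have j2: "j mod 3 = 2" using 3 by auto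
        have sub: "{a..a + j} \<subseteq> {a..a + i} \<union> {a + j} \<union> {}" using True by auto
        have "(real i + 2) / 3 + 2 * real i * eps + x (a + j) \<le> path_exponent j / 3 + (2 * real j + 2) * eps"
          using x1[of "a + j"] eps j2 unfolding True[symmetric] by (simp add: path_exponent_def field_simps)
        then show ?thesis by (intro extend[OF Lb vertex _ sub]) auto
      next
        case False
        define m where "m = j - i - 2"
        have m: "j = i + 2 + m" using 3 False by (simp add: m_def)
        have "hb {} {a + i + 2..a + i + 2 + m} (path_exponent m / 3 + (2 * real m + 2) * eps)"
          by (rule less.IH) (use mild m in \<open>auto elim: mild_subset\<close>)
        then have M: "hb {} {a + i + 2..a + j} (path_exponent m / 3 + (2 * real m + 2) * eps)"
          by (simp add: m algebra_simps)
        have "Suc (a + i) \<notin> A" using mild hi ij m by (auto simp: mild_def)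
        moreover have "(if m mod 3 = 2 then 1 else 0::nat) \<le> (if j mod 3 = 2 then 1 else 0)"
          using 3(2) unfolding m by (auto split: if_splits) presburger+
        then have "i + 2 + path_exponent m \<le> path_exponent j" by (simp add: path_exponent_def m)
        then have "real i + 2 + real (path_exponent m) \<le> real (path_exponent j)" by linarith
        moreover have "2 * real i * eps + (2 * real m + 2) * eps + eps \<le> (2 * real j + 2) * eps"
          using eps by (simp add: m algebra_simps)
        ultimately show ?thesis
          by (intro join_skip[OF Lb M]) (auto simp: m field_simps)
      qed
    next
      case 4
      show ?thesis
      proof (cases "l = 1")
        case True
        then have j2: "j mod 3 = 2" using 4 by auto
        have jl: "real (j - l) = real j - 1" using True hl by simp
        have sub: "{a..a + j} \<subseteq> {a + l..a + j} \<union> {a} \<union> {}" using True by auto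
        have "(real (j - l) + 2) / 3 + 2 * real (j - l) * eps + x a \<le> path_exponent j / 3 + (2 * real j + 2) * eps"
          using x1[of a] eps j2 unfolding jl by (simp add: path_exponent_def field_simps)
        then show ?thesis by (intro extend[OF Rb vertex _ sub]) auto
      next
        case False
        define m where "m = l - 2"
        have m: "l = m + 2" using 4 False by (simp add: m_def)
        have M: "hb {} {a..a + m} (path_exponent m / 3 + (2 * real m + 2) * eps)"
          by (rule less.IH) (use mild m hl in \<open>auto elim: mild_subset\<close>)
        have R: "hb {} {a + m + 2..a + j} ((real (j - l) + 2) / 3 + 2 * real (j - l) * eps)"
          using Rb by (simp add: m)
        have "Suc (a + m) \<notin> A" using mild_left[OF mild, of "a + m"] hl m by auto
        moreover have "(if m mod 3 = 2 then 1 else 0::nat) \<le> (if j mod 3 = 2 then 1 else 0)"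
          using 4(2) unfolding m by (auto split: if_splits) presburger+
        then have "j - l + 2 + path_exponent m \<le> path_exponent j" using hl by (simp add: path_exponent_def m)
        then have "real (j - l) + 2 + real (path_exponent m) \<le> real (path_exponent j)" by linarith
        moreover have "2 * real (j - l) * eps + (2 * real m + 2) * eps + eps \<le> (2 * real j + 2) * eps"
          using eps hl by (simp add: m of_nat_diff algebra_simps)
        ultimately show ?thesis using hl m
          by (intro join_skip[OF M R]) (auto simp: field_simps)
      qed
    next
      case 5
      define d where "d = l - i"
      have d: "l = i + d" using il by (simp add: d_def)
      have jl: "real (j - l) = real j - real l" using hl by (simp add: of_nat_diff)
      have dm: "d mod 3 = 1 \<or> d mod 3 = 2"
        using mod_3_cuts[of d "j - l" i] 5 hl unfolding d by simp
      have "d \<noteq> 0" "d \<noteq> 3" using dm by (intro notI; simp)+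
      then consider "d = 1" | "d = 2" | "d \<ge> 4" by linarith
      then show ?thesis
      proof cases
        case 1
        have sub: "{a..a + j} \<subseteq> {a..a + i} \<union> {a + l..a + j} \<union> {}" using 1 d by auto
        have "(real i + 2) / 3 + 2 * real i * eps + ((real (j - l) + 2) / 3 + 2 * real (j - l) * eps)
            \<le> path_exponent j / 3 + (2 * real j + 2) * eps"
          using eps unfolding jl by (simp add: d 1 path_exponent_def field_simps)
        then show ?thesis by (intro extend[OF Lb Rb _ sub]) auto
      next
        case 2
        have "Suc (a + i) \<notin> A" using mild hi hl d 2 by (auto simp: mild_def)
        moreover have "hb {} {a + i + 2..a + j} ((real (j - l) + 2) / 3 + 2 * real (j - l) * eps)"
          using Rb by (simp add: d 2 add.assoc)
        ultimately show ?thesis using hl d 2 eps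
          by (intro join_skip[OF Lb]) (auto simp: jl path_exponent_def field_simps)
      next
        case 3
        define m where "m = d - 4"
        have m: "d = m + 4" using 3 by (simp add: m_def)
        have "hb {} {a + i + 2..a + i + 2 + m} (path_exponent m / 3 + (2 * real m + 2) * eps)"
          by (rule less.IH) (use mild m hl d in \<open>auto elim: mild_subset\<close>)
        then have M: "hb {} {a + i + 2..a + i + 2 + m} ((real m + 3) / 3 + (2 * real m + 2) * eps)"
        proof -
          \<comment> \<open>Without a surcharge in the middle the three pieces cost
            \<open>i + 2\<close>, \<open>m + 3\<close> and \<open>j - l + 2\<close> thirds, together
            \<open>j + 3\<close>.\<close>
          have "m mod 3 \<noteq> 2" using dm unfolding m by presburger
          with \<open>hb {} {a + i + 2..a + i + 2 + m} _\<close> show ?thesis by (simp add: path_exponent_def)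
        qed
        have al: "a + l = a + i + 2 + m + 2" by (simp add: d m)
        have R: "hb {} {a + i + 2 + m + 2..a + j} ((real (j - l) + 2) / 3 + 2 * real (j - l) * eps)"
          using Rb by (simp only: al)
        have n1: "Suc (a + i) \<notin> A" using mild hi hl d m by (auto simp: mild_def)
        have "heavy (a + i + 2 + m + 2)" using hl by (simp only: al)
        then have n2: "Suc (a + i + 2 + m) \<notin> A" using hl d m by (intro mild_left[OF mild]) auto
        have "hb {} {a..a + i + 2 + m} ((real i + 2) / 3 + 2 * real i * eps + ((real m + 3) / 3 + (2 * real m + 2) * eps) + eps)"
          by (rule join_skip[OF Lb M n1]) auto
        then show ?thesis using n2 hl d m eps
          by (intro join_skip[OF _ R]) (auto simp: jl path_exponent_def field_simps)
      qed
    qed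
  qed
qed

text \<open>A pair of antipodal heavy vertices with a common neighbour between them costs at most \<open>n\<close>; this is the
  only place where a cycle can gain over a path in the plane.\<close>

lemma severe_block:
  assumes "Suc m \<in> A" "heavy m"
  shows "hb {} {m, Suc m, m + 2} (1 + 2 * eps)"
proof -
  have "x m \<le> 1 / 2" using assms(2) by (simp add: heavy_def)
  then have "e m \<le> 1 + eps" using e_cases[of m] x1[of m] x1[of "Suc m"] by (elim disjE) linarith+
  then have "hb {} {m, Suc m} (1 + 2 * eps)" by (intro extend[OF vertex fwd]) auto
  then show ?thesis by (rule extend[OF _ anti[OF assms(1)]]) auto
qed

text \<open>A block \<open>p, x, -p\<close> would close the gap to a cycle of length
  \<open>L + 2\<close>, and the subtracted 3 is what that block costs. Another severe block inside
  splits the gap: its cost 3 makes up for one of the two subtractions, and \<open>A_iso\<close>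
  supplies the conditions at the new ends.\<close>

lemma gap_bound:
  assumes "L \<ge> 2" "Suc a \<notin> A" "a + L - 1 \<notin> A"
  shows "hb {a, a + L} {a..a + L} ((real (phi (L + 2)) - 3) / 3 + 3 * real L * eps)"
  using assms
proof (induction L arbitrary: a rule: less_induct)
  case (less L)
  show ?case
  proof (cases "\<exists>m. a + 2 \<le> m \<and> m + 4 \<le> a + L \<and> Suc m \<in> A \<and> heavy m")
    case True
    then obtain m where m: "a + 2 \<le> m" "m + 4 \<le> a + L" "Suc m \<in> A" "heavy m" by blast
    define L1 where "L1 = m - a"
    define L2 where "L2 = a + L - (m + 2)"
    have L: "m = a + L1" "a + L = m + 2 + L2" "L = L1 + L2 + 2" using m by (auto simp: L1_def L2_def)
    have "m - 1 \<notin> A" using A_iso[of "m - 1"] m by (cases m) auto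
    then have G1: "hb {a, m} {a..m} ((real (phi (L1 + 2)) - 3) / 3 + 3 * real L1 * eps)"
      using less.IH[of L1 a] less.prems m L by auto
    have "Suc (m + 2) \<notin> A" using A_iso[OF m(3)] by simp
    then have G2: "hb {m + 2, a + L} {m + 2..a + L} ((real (phi (L2 + 2)) - 3) / 3 + 3 * real L2 * eps)"
      using less.IH[of L2 "m + 2"] less.prems m L by (auto simp: add.assoc)
    have "phi (L1 + 2) + phi (L2 + 2) \<le> phi (L + 2)"
      using phi_superadditive[of "L1 + 2" "L2 + 2"] L(3) by (simp add: algebra_simps)
    then have ph: "real (phi (L1 + 2)) + real (phi (L2 + 2)) \<le> real (phi (L + 2))" by linarith
    have "hb {a, a + L} {m, Suc m, m + 2} (1 + 2 * eps)"
      by (rule weaken[OF severe_block[OF m(3,4)]]) auto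
    then have "hb {a, a + L} ({m, Suc m, m + 2} \<union> {a..m}) (1 + 2 * eps + ((real (phi (L1 + 2)) - 3) / 3 + 3 * real L1 * eps))"
      by (rule extend[OF _ G1]) auto
    then show ?thesis
    proof (rule extend[OF _ G2])
      show "{a..a + L} \<subseteq> {m, Suc m, m + 2} \<union> {a..m} \<union> {m + 2..a + L} \<union> {a, a + L}" by auto
      show "1 + 2 * eps + ((real (phi (L1 + 2)) - 3) / 3 + 3 * real L1 * eps) + ((real (phi (L2 + 2)) - 3) / 3 + 3 * real L2 * eps)
         \<le> (real (phi (L + 2)) - 3) / 3 + 3 * real L * eps"
        using ph eps by (simp add: L(3) field_simps)
    qed auto
  next
    case False
    consider "L = 2" | "L = 3" | "L \<ge> 4" using less.prems(1) by linarith
    then show ?thesis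
    proof cases
      case 1
      have sub: "{a..a + L} \<subseteq> {Suc a} \<union> {a, a + L}" using 1 by auto
      show ?thesis
        by (rule weaken[OF skip[OF less.prems(2)] _ sub]) (use 1 eps in \<open>auto simp: phi_def\<close>)
    next
      case 2
      have n: "Suc (Suc a) \<notin> A" using less.prems(3) 2 by simp
      have sub: "{a..a + L} \<subseteq> {Suc a} \<union> {Suc (Suc a)} \<union> {a, a + L}" using 2 by auto
      have "hb {a, a + L} {Suc a} (x (Suc a))" by (rule weaken[OF vertex]) auto
      then show ?thesis
        by (rule extend[OF _ skip[OF n] _ sub]) (use 2 eps x1[of "Suc a"] in \<open>auto simp: phi_def\<close>)
    next
      case 3
      \<comment> \<open>The positions \<open>a + 1\<close> and \<open>a + L - 1\<close> are left to
        skips; only the path between \<open>a + 2\<close> and \<open>a + L - 2\<close> is paid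
        for.\<close>
      define N where "N = L - 4"
      have N: "L = N + 4" using 3 by (simp add: N_def)
      have "mild (a + 2) (a + 2 + N)" using False N by (auto simp: mild_def)
      from path_bound[OF this]
      have P: "hb {a, a + L} {a + 2..a + 2 + N} (path_exponent N / 3 + (2 * real N + 2) * eps)" by (rule weaken) auto
      have Z: "hb {a, a + L} {a..a} 0" "hb {a, a + L} {a + 2 + N + 2..a + L} 0"
        by (rule weaken[OF known]; auto simp: N)+
      have Q: "hb {a, a + L} {a..a + 2 + N} (path_exponent N / 3 + (2 * real N + 3) * eps)"
        by (rule join_skip[OF Z(1) P less.prems(2)]) (use eps in \<open>auto simp: algebra_simps\<close>)
      have "path_exponent N + 3 \<le> phi (L + 2)" using path_exponent_le_gap[OF 3] by (simp add: N)
      then have "real (path_exponent N) + 3 \<le> real (phi (L + 2))" by linarith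
      moreover have "(2 * real N + 3) * eps + eps \<le> 3 * real L * eps" using eps by (simp add: N algebra_simps)
      ultimately have ar: "path_exponent N / 3 + (2 * real N + 3) * eps + 0 + eps
          \<le> (real (phi (L + 2)) - 3) / 3 + 3 * real L * eps" by (simp add: diff_divide_distrib)
      have "a + L - 1 = Suc (a + 2 + N)" by (simp add: N)
      then have "Suc (a + 2 + N) \<notin> A" using less.prems(3) by (simp only: not_False_eq_True)
      from join_skip[OF Q Z(2) this _ _ ar] show ?thesis by (simp add: N)
    qed
  qed
qed

end

section \<open>Closing the tour: positions run over all naturals, with period
  \<open>k\<close>\<close>

locale cyclic_tours = tours +
  fixes k :: nat
  assumes k: "k \<ge> 5"
    and per: "hb {i} {i + k} 0"
    and A_per: "i + k \<in> A \<longleftrightarrow> i \<in> A"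
begin

lemma cycle_bound:
  assumes "k \<notin> {6, 7, 9}"
  shows "\<exists>s. hb {} {s..<s + k} (real (phi k) / 3 + 3 * real k * eps)"
proof (cases "\<exists>m. Suc m \<in> A \<and> heavy m")
  case True
  then obtain m where m: "Suc m \<in> A" "heavy m" by blast
  have n1: "Suc (m + 2) \<notin> A" using A_iso[OF m(1)] by simp
  have "m + k - 1 + 2 = Suc m + k" using k by simp
  then have "m + k - 1 \<notin> A" using A_iso[of "m + k - 1"] A_per[of "Suc m"] m(1) by auto
  moreover have "m + 2 + (k - 2) - 1 = m + k - 1" using k by simp
  ultimately have n2: "m + 2 + (k - 2) - 1 \<notin> A" by (simp only: not_False_eq_True)
  have km: "m + 2 + (k - 2) = m + k" using k by simp
  have G: "hb {m + 2, m + k} {m + 2..m + k} ((real (phi k) - 3) / 3 + 3 * real (k - 2) * eps)"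
  proof -
    have "hb {m + 2, m + k} {m + 2..m + k} ((real (phi (k - 2 + 2)) - 3) / 3 + 3 * real (k - 2) * eps)"
      using gap_bound[OF _ n1 n2] k unfolding km by simp
    moreover have "k - 2 + 2 = k" using k by simp
    ultimately show ?thesis by (simp only:)
  qed
  have k2: "real (k - 2) = real k - 2" using k by simp
  have "hb {} {m, Suc m, m + 2, m + k} (1 + 2 * eps)"
    by (rule extend[OF severe_block[OF m] per[of m]]) auto
  then have "hb {} {m..<m + k} (real (phi k) / 3 + 3 * real k * eps)"
  proof (rule extend[OF _ G])
    show "{m..<m + k} \<subseteq> {m, Suc m, m + 2, m + k} \<union> {m + 2..m + k} \<union> {}" by auto
    show "1 + 2 * eps + ((real (phi k) - 3) / 3 + 3 * real (k - 2) * eps) \<le> real (phi k) / 3 + 3 * real k * eps"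
      using eps by (simp add: k2 field_simps)
  qed auto
  then show ?thesis by blast
next
  case False
  \<comment> \<open>The path leaves one vertex out, at position \<open>a + k - 1\<close>, and it is
    recovered from its two neighbours. That position must lie outside \<open>A\<close>; one of
    \<open>k\<close> and \<open>k + 2\<close> does.\<close>
  have "k \<notin> A \<or> k + 2 \<notin> A" using A_iso by blast
  then obtain a where a: "a + k - 1 \<notin> A" "a \<ge> 1"
    by (metis add.commute add_diff_cancel_left' diff_add_inverse le_add1 numeral_2_eq_2 one_add_one add.assoc le_numeral_extra(4))
  have km: "a + (k - 2) = a + k - 2" using k by simp
  have "mild a (a + (k - 2))" using False by (auto simp: mild_def)
  from path_bound[OF this]
  have "hb {} {a..a + k - 2} (path_exponent (k - 2) / 3 + (2 * real (k - 2) + 2) * eps)" unfolding km .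
  then have "hb {} ({a..a + k - 2} \<union> {a + k}) (path_exponent (k - 2) / 3 + (2 * real (k - 2) + 2) * eps)"
    by (rule extend[OF _ per[of a]]) (use k in auto)
  moreover have "hb {a + k - 2, a + k - 2 + 2} {Suc (a + k - 2)} eps"
  proof (rule skip)
    have "Suc (a + k - 2) = a + k - 1" using k by simp
    then show "Suc (a + k - 2) \<notin> A" using a by (simp only: not_False_eq_True)
  qed
  ultimately have "hb {} {a..<a + k} (real (phi k) / 3 + 3 * real k * eps)"
  proof (rule extend)
    have "real (path_exponent (k - 2)) \<le> real (phi k)" using path_exponent_le_cycle[OF k assms] by simp
    moreover have "(2 * real (k - 2) + 2) * eps + eps \<le> 3 * real k * eps" using k eps by (simp add: of_nat_diff algebra_simps mult_right_mono)
    ultimately show "path_exponent (k - 2) / 3 + (2 * real (k - 2) + 2) * eps + eps \<le> real (phi k) / 3 + 3 * real k * eps"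
      by (simp add: field_simps)
  qed (use k in auto)
  then show ?thesis by blast
qed

end

section \<open>Regularization\<close>

lemma fibres_le_card:
  assumes "finite B" "A \<subseteq> B" "\<And>a. a \<in> A \<Longrightarrow> k \<le> real (card {x\<in>B. f x = f a})"
  shows "k * real (card (f ` A)) \<le> real (card B)"
proof -
  have "k * real (card (f ` A)) = (\<Sum>y\<in>f ` A. k)" by simp
  also have "\<dots> \<le> (\<Sum>y\<in>f ` A. real (card {x\<in>B. f x = y}))" using assms(3) by (intro sum_mono) auto
  also have "\<dots> = real (card (\<Union>y\<in>f ` A. {x\<in>B. f x = y}))"
    using assms finite_subset[of A B] by (subst card_UN_disjoint) auto
  also have "\<dots> \<le> real (card B)" using assms by (intro of_nat_mono card_mono) auto
  finally show ?thesis .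
qed

lemma card_le_fibres_real:
  assumes "finite A" "\<And>a. a \<in> A \<Longrightarrow> real (card {x\<in>A. f x = f a}) \<le> k"
  shows "real (card A) \<le> k * real (card (f ` A))"
proof -
  have "A = (\<Union>y\<in>f ` A. {x\<in>A. f x = y})" by auto
  then have "card A \<le> (\<Sum>y\<in>f ` A. card {x\<in>A. f x = y})"
    using card_UN_le[of "f ` A" "\<lambda>y. {x\<in>A. f x = y}"] assms(1) by simp
  then have "real (card A) \<le> real (\<Sum>y\<in>f ` A. card {x\<in>A. f x = y})" by (rule of_nat_mono)
  also have "\<dots> \<le> (\<Sum>y\<in>f ` A. k)" unfolding of_nat_sum using assms(2) by (intro sum_mono) auto
  finally show ?thesis by (simp add: mult.commute)
qed

lemma popular_fibre:
  assumes "finite A" "A \<noteq> {}"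
  shows "\<exists>a\<in>A. card A \<le> card (f ` A) * card {x\<in>A. f x = f a}"
proof (rule ccontr)
  assume "\<not> ?thesis"
  then have lt: "card (f ` A) * card {x\<in>A. f x = f a} < card A" if "a \<in> A" for a using that by auto
  define k where "k = Max ((\<lambda>a. card {x\<in>A. f x = f a}) ` A)"
  have "k \<in> (\<lambda>a. card {x\<in>A. f x = f a}) ` A" unfolding k_def using assms by (intro Max_in) auto
  then have "card (f ` A) * k < card A" using lt by auto
  moreover have "card A \<le> k * card (f ` A)"
    by (rule card_le_fibres) (use assms in \<open>auto simp: k_def\<close>)
  ultimately show False by (simp add: mult.commute)
qed

text \<open>First all dyadic fibre sizes are fixed by pigeonholing, which bounds fibres from above and their number
  from above; then a subset maximising the number of its elements minus a weighted number of its fibres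
  has no small fibres, since removing one would increase this quantity.\<close>

lemma regularize:
  fixes f :: "'j \<Rightarrow> 'c \<Rightarrow> 'v"
  assumes C: "finite C" "C \<noteq> {}" and J: "finite J" "J \<noteq> {}" and l: "card C < 2 ^ l"
  shows "\<exists>C' (T :: 'j \<Rightarrow> real). C' \<subseteq> C \<and> C' \<noteq> {} \<and> card C \<le> 2 * l ^ card J * card C' \<and>
    (\<forall>j\<in>J. \<forall>c\<in>C'. T j \<le> real (card {c'\<in>C'. f j c' = f j c}) \<and>
       real (card {c'\<in>C'. f j c' = f j c}) \<le> (4 * card J * l ^ card J) * T j \<and> 0 < T j)"
proof -
  define fib where "fib j c = card {c'\<in>C. f j c' = f j c}" for j c
  have fib: "1 \<le> fib j c" "fib j c < 2 ^ l" if "c \<in> C" for j c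
  proof -
    have "c \<in> {c'\<in>C. f j c' = f j c}" using that by simp
    then show "1 \<le> fib j c" unfolding fib_def using C
      by (intro Suc_leI[of 0, folded One_nat_def]) (auto simp: card_gt_0_iff)
    show "fib j c < 2 ^ l" unfolding fib_def using l card_mono[OF C(1), of "{c'\<in>C. f j c' = f j c}"] by auto
  qed
  define d where "d j c = floor_log (fib j c)" for j c
  have d: "2 ^ d j c \<le> fib j c" "fib j c < 2 ^ Suc (d j c)" "d j c < l" if "c \<in> C" for j c
  proof -
    show a: "2 ^ d j c \<le> fib j c" "fib j c < 2 ^ Suc (d j c)"
      using fib(1)[OF that, of j] floor_log_exp2_le[of "fib j c"] floor_log_exp2_gt[of "fib j c"] by (simp_all add: d_def)
    have "2 ^ d j c < (2::nat) ^ l" using a(1) fib(2)[OF that, of j] by linarith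
    then show "d j c < l" by simp
  qed
  let ?g = "\<lambda>c. restrict (\<lambda>j. d j c) J"
  obtain c0 where c0: "c0 \<in> C" "card C \<le> card (?g ` C) * card {c\<in>C. ?g c = ?g c0}"
    using popular_fibre[OF C, of ?g] by blast
  define C1 where "C1 = {c\<in>C. ?g c = ?g c0}"
  define t where "t j = d j c0" for j
  have dC1: "d j c = t j" if "c \<in> C1" "j \<in> J" for c j
    using that unfolding C1_def t_def by (metis (mono_tags, lifting) mem_Collect_eq restrict_apply)
  have C1: "C1 \<subseteq> C" "finite C1" "C1 \<noteq> {}" using c0 C by (auto simp: C1_def)
  have "card (?g ` C) \<le> card (J \<rightarrow>\<^sub>E {..<l})" using d J by (intro card_mono finite_PiE) auto
  then have gl: "card (?g ` C) \<le> l ^ card J" using J by (simp add: card_PiE)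
  have cC: "card C \<le> l ^ card J * card C1"
    using c0(2) mult_le_mono1[OF gl, of "card C1"] unfolding C1_def[symmetric] by linarith
  have pos: "real (card C1) > 0" "real (card C) > 0" "real (card J) > 0" using C1 C J by (simp_all add: card_gt_0_iff)
  \<comment> \<open>On \<open>C1\<close> there are at most \<open>card C / 2 ^ t j\<close> fibres of
    \<open>f j\<close>, so with this weight each \<open>j\<close> is penalised by at most
    \<open>card C1 / (2 * card J)\<close>, and at least half of \<open>card C1\<close>
    remains.\<close>
  define \<delta> where "\<delta> j = 2 ^ t j * real (card C1) / (2 * real (card J) * real (card C))" for j
  have \<delta>: "\<delta> j > 0" for j unfolding \<delta>_def using pos by simp
  define pot where "pot S = real (card S) - (\<Sum>j\<in>J. \<delta> j * real (card (f j ` S)))" for S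
  have pot1: "pot C1 \<ge> real (card C1) / 2"
  proof -
    have "(\<Sum>j\<in>J. \<delta> j * real (card (f j ` C1))) \<le> (\<Sum>j\<in>J. real (card C1) / (2 * real (card J)))"
    proof (rule sum_mono)
      fix j assume j: "j \<in> J"
      have "2 ^ t j * real (card (f j ` C1)) \<le> real (card C)"
      proof (rule fibres_le_card[OF C(1) C1(1)])
        fix a assume a: "a \<in> C1"
        then have "2 ^ t j \<le> fib j a" using d(1)[of a j] dC1[OF a j] C1(1) by auto
        then show "2 ^ t j \<le> real (card {x \<in> C. f j x = f j a})" unfolding fib_def
          by (metis of_nat_le_iff of_nat_numeral of_nat_power)
      qed
      then have "2 ^ t j * real (card (f j ` C1)) * (real (card C1) / (2 * real (card J) * real (card C)))
          \<le> real (card C) * (real (card C1) / (2 * real (card J) * real (card C)))"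
        by (intro mult_right_mono) auto
      also have "\<dots> = real (card C1) / (2 * real (card J))" using pos by simp
      finally show "\<delta> j * real (card (f j ` C1)) \<le> real (card C1) / (2 * real (card J))"
        by (simp add: \<delta>_def mult_ac)
    qed
    also have "\<dots> = real (card C1) / 2" using pos by simp
    finally show ?thesis by (simp add: pot_def)
  qed
  have fP: "finite (pot ` Pow C1)" "pot ` Pow C1 \<noteq> {}" using C1 by auto
  have "Max (pot ` Pow C1) \<in> pot ` Pow C1" by (rule Max_in[OF fP])
  then obtain S where S: "Max (pot ` Pow C1) = pot S" "S \<in> Pow C1" by (rule imageE)
  have Smax: "pot S' \<le> pot S" if "S' \<subseteq> C1" for S'
    unfolding S(1)[symmetric] using that fP by (intro Max_ge) auto
  have finS: "finite S" and SC1: "S \<subseteq> C1" using S C1 finite_subset by auto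
  have "(\<Sum>j\<in>J. \<delta> j * real (card (f j ` S))) \<ge> 0" using \<delta> by (intro sum_nonneg) (simp add: less_imp_le)
  then have "pot S \<le> real (card S)" by (simp add: pot_def)
  then have cS: "real (card C1) / 2 \<le> real (card S)" using pot1 Smax[OF order_refl] by linarith
  have low: "\<delta> j \<le> real (card {c'\<in>S. f j c' = f j c})" if j: "j \<in> J" and c: "c \<in> S" for j c
  proof (rule ccontr)
    assume lt: "\<not> ?thesis"
    define F where "F = {c'\<in>S. f j c' = f j c}"
    have F: "F \<subseteq> S" "finite F" using finS by (auto simp: F_def)
    have cd: "real (card (S - F)) = real (card S) - real (card F)"
      using F finS by (simp add: card_Diff_subset card_mono of_nat_diff)
    have im: "f j ` (S - F) = f j ` S - {f j c}" by (auto simp: F_def)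
    have "real (card (f j ` (S - F))) = real (card (f j ` S)) - 1"
    proof -
      have "card (f j ` S) \<ge> 1" using c finS card_gt_0_iff[of "f j ` S"] by fastforce
      then show ?thesis unfolding im using c by (simp add: card_Diff_singleton of_nat_diff)
    qed
    then have "\<delta> j * real (card (f j ` (S - F))) = \<delta> j * real (card (f j ` S)) - \<delta> j"
      by (simp only: right_diff_distrib mult_1_right)
    moreover have "(\<Sum>i\<in>J - {j}. \<delta> i * real (card (f i ` (S - F)))) \<le> (\<Sum>i\<in>J - {j}. \<delta> i * real (card (f i ` S)))"
      using finS \<delta> by (intro sum_mono mult_left_mono of_nat_mono card_mono) (auto simp: less_imp_le)
    ultimately have "(\<Sum>i\<in>J. \<delta> i * real (card (f i ` (S - F)))) \<le> (\<Sum>i\<in>J. \<delta> i * real (card (f i ` S))) - \<delta> j"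
      using J(1) j by (simp add: sum.remove[of J j])
    then have "pot (S - F) > pot S" using lt cd unfolding pot_def F_def by linarith
    then show False using Smax[of "S - F"] SC1 by fastforce
  qed
  have up: "real (card {c'\<in>S. f j c' = f j c}) \<le> (4 * card J * l ^ card J) * \<delta> j" if j: "j \<in> J" and c: "c \<in> S" for j c
  proof -
    have "card {c'\<in>S. f j c' = f j c} \<le> fib j c" unfolding fib_def using C SC1 C1 by (intro card_mono) auto
    also have "fib j c < 2 ^ Suc (t j)"
    proof -
      have c1: "c \<in> C1" "c \<in> C" using c SC1 C1(1) by blast+
      show ?thesis using d(2)[OF c1(2), of j] unfolding dC1[OF c1(1) j] .
    qed
    finally have "card {c'\<in>S. f j c' = f j c} \<le> 2 ^ Suc (t j)" by simp
    then have "real (card {c'\<in>S. f j c' = f j c}) \<le> 2 * 2 ^ t j"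
      by (metis of_nat_le_iff of_nat_numeral of_nat_power power_Suc)
    also have "\<dots> = 4 * real (card J) * \<delta> j * (real (card C) / real (card C1))"
      unfolding \<delta>_def using pos by simp
    also have "\<dots> \<le> 4 * real (card J) * \<delta> j * real (l ^ card J)"
    proof (intro mult_left_mono)
      have "real (card C) \<le> real (l ^ card J) * real (card C1)" using cC by (metis of_nat_le_iff of_nat_mult)
      then show "real (card C) / real (card C1) \<le> real (l ^ card J)" using pos by (simp add: divide_le_eq)
    qed (use \<delta>[of j] in auto)
    finally show ?thesis by (simp add: mult_ac)
  qed
  have "S \<noteq> {}" using cS pos by auto
  moreover have "card C \<le> 2 * l ^ card J * card S"
  proof -
    have "card C1 \<le> 2 * card S" using cS by linarith
    then have "l ^ card J * card C1 \<le> l ^ card J * (2 * card S)" by (rule mult_le_mono2)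
    also have "\<dots> = 2 * l ^ card J * card S" by (simp only: mult_ac)
    finally show ?thesis using cC by linarith
  qed
  ultimately show ?thesis using SC1 C1(1) low up \<delta>
    by (intro exI[of _ S] exI[of _ \<delta>]) auto
qed

text \<open>Every degree is at most \<open>L\<^sup>2\<close> times the average degree. One factor
  \<open>L\<close> comes from the size of a fibre of \<open>f\<close>, the other from bounding
  \<open>card C\<close> by the number of fibres of \<open>h\<close>.\<close>

lemma degree_bound:
  fixes f :: "'c \<Rightarrow> 'v" and g :: "'c \<Rightarrow> 'w" and h :: "'c \<Rightarrow> 'u"
  assumes C: "finite C" "c \<in> C" and h: "\<And>c c'. h c = h c' \<longleftrightarrow> f c = f c' \<and> g c = g c'"
    and T: "0 < T" "0 < U" "0 \<le> L"
    and f: "\<And>c. c \<in> C \<Longrightarrow> T \<le> real (card {c'\<in>C. f c' = f c})" "\<And>c. c \<in> C \<Longrightarrow> real (card {c'\<in>C. f c' = f c}) \<le> L * T"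
    and hU: "\<And>c. c \<in> C \<Longrightarrow> U \<le> real (card {c'\<in>C. h c' = h c})" "\<And>c. c \<in> C \<Longrightarrow> real (card {c'\<in>C. h c' = h c}) \<le> L * U"
  shows "real (card (g ` {c'\<in>C. f c' = f c})) \<le> L\<^sup>2 * real (card (h ` C)) / real (card (f ` C))"
proof -
  let ?S = "{c'\<in>C. f c' = f c}"
  let ?N = "real (card (g ` ?S))"
  have "U * ?N \<le> real (card ?S)"
  proof (rule fibres_le_card)
    fix a assume a: "a \<in> ?S"
    then have "{x \<in> ?S. g x = g a} = {c'\<in>C. h c' = h a}" using h by auto
    then show "U \<le> real (card {x \<in> ?S. g x = g a})" using hU(1)[of a] a by simp
  qed (use C in auto)
  then have N: "U * ?N \<le> L * T" using f(2)[OF C(2)] by linarith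
  have X: "T * real (card (f ` C)) \<le> real (card C)" by (rule fibres_le_card) (use C f in auto)
  have E: "real (card C) \<le> L * U * real (card (h ` C))" by (rule card_le_fibres_real) (use C hU in auto)
  have X0: "real (card (f ` C)) > 0" using C by (auto simp: card_gt_0_iff)
  have "U * ?N * real (card (f ` C)) \<le> L * (T * real (card (f ` C)))"
    using mult_right_mono[OF N, of "real (card (f ` C))"] by (simp add: mult_ac)
  also have "\<dots> \<le> L * (L * U * real (card (h ` C)))" using X E T by (intro mult_left_mono) auto
  finally have "U * (?N * real (card (f ` C))) \<le> U * (L\<^sup>2 * real (card (h ` C)))"
    by (simp add: power2_eq_square mult_ac)
  then have "?N * real (card (f ` C)) \<le> L\<^sup>2 * real (card (h ` C))" using T by simp
  then show ?thesis using X0 by (simp add: pos_le_divide_eq)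
qed

text \<open>The concrete form of \<open>hb\<close>, with \<open>B\<close> in place of
  \<open>n\<^sup>r\<close>. Restricting to \<open>I\<close> turns the vertices at these positions
  into one object that can be counted.\<close>

definition bnd :: "'c set \<Rightarrow> (nat \<Rightarrow> 'c \<Rightarrow> 'a) \<Rightarrow> nat set \<Rightarrow> nat set \<Rightarrow> real \<Rightarrow> bool" where
  "bnd C q J I B \<longleftrightarrow> (\<forall>c\<in>C. real (card ((\<lambda>c'. restrict (\<lambda>i. q i c') I) ` {c'\<in>C. \<forall>j\<in>J. q j c' = q j c})) \<le> B)"

lemma bnd_weaken:
  assumes C: "finite C" and b: "bnd C q J I B" and sub: "J \<subseteq> J'" "I' \<subseteq> I \<union> J'" and le: "B \<le> B'"
  shows "bnd C q J' I' B'"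
  unfolding bnd_def
proof
  fix c assume c: "c \<in> C"
  let ?X = "{c'\<in>C. \<forall>j\<in>J. q j c' = q j c}" and ?X' = "{c'\<in>C. \<forall>j\<in>J'. q j c' = q j c}"
  let ?r = "\<lambda>I c'. restrict (\<lambda>i. q i c') I"
  have "?r I' ` ?X' \<subseteq> (\<lambda>y. \<lambda>i\<in>I'. if i \<in> I then y i else q i c) ` (?r I ` ?X)"
  proof
    fix z assume "z \<in> ?r I' ` ?X'"
    then obtain c' where c': "c' \<in> ?X'" "z = ?r I' c'" by blast
    have "z = (\<lambda>i\<in>I'. if i \<in> I then ?r I c' i else q i c)"
      unfolding c'(2) using c'(1) sub by (intro restrict_ext) auto
    moreover have "c' \<in> ?X" using c' sub by auto
    ultimately show "z \<in> (\<lambda>y. \<lambda>i\<in>I'. if i \<in> I then y i else q i c) ` (?r I ` ?X)" by blast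
  qed
  then have "card (?r I' ` ?X') \<le> card ((\<lambda>y. \<lambda>i\<in>I'. if i \<in> I then y i else q i c) ` (?r I ` ?X))"
    by (rule card_mono[rotated]) (use C in simp)
  also have "\<dots> \<le> card (?r I ` ?X)" by (rule card_image_le) (use C in simp)
  finally have "card (?r I' ` ?X') \<le> card (?r I ` ?X)" .
  then show "real (card (?r I' ` ?X')) \<le> B'" using b c le unfolding bnd_def by fastforce
qed

text \<open>Group the choices on \<open>I \<union> I'\<close> by their values on \<open>I\<close>:
  fixing those values is the same as enlarging \<open>J\<close> by \<open>I\<close>.\<close>

lemma bnd_chain:
  assumes C: "finite C" and b: "bnd C q J I B" "bnd C q (J \<union> I) I' B'" and B: "0 \<le> B'"
  shows "bnd C q J (I \<union> I') (B * B')"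
  unfolding bnd_def
proof
  fix c assume c: "c \<in> C"
  let ?X = "{c'\<in>C. \<forall>j\<in>J. q j c' = q j c}"
  let ?r = "\<lambda>I c'. restrict (\<lambda>i. q i c') I"
  let ?Y = "\<lambda>y. {c'\<in>?X. ?r I c' = y}"
  have b2: "bnd C q (J \<union> I) (I \<union> I') B'" by (rule bnd_weaken[OF C b(2)]) auto
  have fX: "finite ?X" using C by simp
  have un: "?r (I \<union> I') ` ?X = (\<Union>y\<in>?r I ` ?X. ?r (I \<union> I') ` ?Y y)" by blast
  have "card (?r (I \<union> I') ` ?X) \<le> (\<Sum>y\<in>?r I ` ?X. card (?r (I \<union> I') ` ?Y y))"
    by (subst un, rule card_UN_le, rule finite_imageI, rule fX)
  then have "real (card (?r (I \<union> I') ` ?X)) \<le> real (\<Sum>y\<in>?r I ` ?X. card (?r (I \<union> I') ` ?Y y))"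
    by (rule of_nat_mono)
  also have "\<dots> \<le> (\<Sum>y\<in>?r I ` ?X. B')"
    unfolding of_nat_sum
  proof (rule sum_mono)
    fix y assume "y \<in> ?r I ` ?X"
    then obtain c0 where c0: "c0 \<in> ?X" "y = ?r I c0" by blast
    have "(?r I c' = ?r I c0) \<longleftrightarrow> (\<forall>j\<in>I. q j c' = q j c0)" for c'
      by (auto simp: restrict_def fun_eq_iff)
    then have "?Y y = {c'\<in>C. \<forall>j\<in>J \<union> I. q j c' = q j c0}" using c0 by auto
    then show "real (card (?r (I \<union> I') ` ?Y y)) \<le> B'" using b2 c0 unfolding bnd_def by auto
  qed
  also have "\<dots> = real (card (?r I ` ?X)) * B'" by simp
  also have "\<dots> \<le> B * B'" using b(1) c B unfolding bnd_def by (intro mult_right_mono) auto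
  finally show "real (card (?r (I \<union> I') ` ?X)) \<le> B * B'" .
qed

lemma bnd_single:
  assumes C: "finite C" and b: "\<And>c. c \<in> C \<Longrightarrow> real (card (q i ` {c'\<in>C. \<forall>j\<in>J. q j c' = q j c})) \<le> B"
  shows "bnd C q J {i} B"
  unfolding bnd_def
proof
  fix c assume c: "c \<in> C"
  let ?X = "{c'\<in>C. \<forall>j\<in>J. q j c' = q j c}"
  have "(\<lambda>c'. restrict (\<lambda>i. q i c') {i}) ` ?X = (\<lambda>y. \<lambda>j\<in>{i}. y) ` (q i ` ?X)"
    by (auto simp: image_image restrict_def fun_eq_iff)
  then have "card ((\<lambda>c'. restrict (\<lambda>i. q i c') {i}) ` ?X) \<le> card (q i ` ?X)"
    using C by (simp add: card_image_le)
  then show "real (card ((\<lambda>c'. restrict (\<lambda>i. q i c') {i}) ` ?X)) \<le> B" using b[OF c] by linarith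
qed

lemma bnd_determined:
  assumes C: "finite C" and d: "\<And>c c'. c \<in> C \<Longrightarrow> c' \<in> C \<Longrightarrow> (\<forall>j\<in>J. q j c' = q j c) \<Longrightarrow> q i c' = q i c"
  shows "bnd C q J {i} 1"
proof (rule bnd_single[OF C])
  fix c assume c: "c \<in> C"
  have "q i ` {c'\<in>C. \<forall>j\<in>J. q j c' = q j c} \<subseteq> {q i c}" using d c by blast
  then have "card (q i ` {c'\<in>C. \<forall>j\<in>J. q j c' = q j c}) \<le> card {q i c}" by (rule card_mono[rotated]) simp
  then show "real (card (q i ` {c'\<in>C. \<forall>j\<in>J. q j c' = q j c})) \<le> 1" by simp
qed

lemma bnd_total:
  assumes "finite C" "bnd C q {} I B" "inj_on (\<lambda>c. restrict (\<lambda>i. q i c) I) C" "0 \<le> B"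
  shows "real (card C) \<le> B"
proof (cases "C = {}")
  case False
  then obtain c where "c \<in> C" by blast
  then have "real (card ((\<lambda>c'. restrict (\<lambda>i. q i c') I) ` C)) \<le> B" using assms(2) by (auto simp: bnd_def)
  then show ?thesis using card_image[OF assms(3)] by simp
qed (use assms in auto)

section \<open>Upper bounds\<close>

text \<open>Both \<open>z\<close> and \<open>z'\<close> are multiples of \<open>cross3 p p'\<close>,
  which vanishes only if \<open>p\<close> and \<open>p'\<close> are equal or antipodal.\<close>

lemma common_orthogonal:
  fixes p p' z z' :: "real ^ 3"
  assumes S: "p \<in> S2" "p' \<in> S2" "z \<in> S2" "z' \<in> S2" and ne: "p \<noteq> p'" "p \<noteq> - p'"
    and o: "p \<bullet> z = 0" "p' \<bullet> z = 0" "p \<bullet> z' = 0" "p' \<bullet> z' = 0"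
  shows "z = z' \<or> z = - z'"
proof -
  define w where "w = cross3 p p'"
  have w0: "w \<noteq> 0"
  proof
    assume "w = 0"
    then have "collinear {0, p', p}" unfolding w_def cross_eq_0 by (simp add: insert_commute)
    then obtain c where "p = c *\<^sub>R p'" using S2_nonzero[OF S(1)] S2_nonzero[OF S(2)] by (auto simp: collinear_lemma)
    then show False using S2_parallel[OF S(1,2)] ne by blast
  qed
  have par: "\<exists>c. y = c *\<^sub>R w" if "p \<bullet> y = 0" "p' \<bullet> y = 0" "y \<in> S2" for y
  proof -
    have "cross3 y w = 0" using that unfolding w_def Lagrange by (simp add: inner_commute)
    then have "collinear {0, w, y}" unfolding cross_eq_0 by (simp add: insert_commute)
    then show ?thesis using w0 S2_nonzero[OF that(3)] by (auto simp: collinear_lemma)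
  qed
  obtain c where c: "z = c *\<^sub>R w" using par[OF o(1,2) S(3)] by blast
  obtain d where d: "z' = d *\<^sub>R w" using par[OF o(3,4) S(4)] by blast
  have "d \<noteq> 0" using d S2_nonzero[OF S(4)] by auto
  then have "z = (c / d) *\<^sub>R z'" by (simp add: c d)
  then show ?thesis using S2_parallel[OF S(3,4)] by blast
qed

section \<open>Cycles as periodic vertex sequences\<close>

locale cycle_family =
  fixes k :: nat and P :: "(real ^ 3) set" and C :: "(real ^ 3) list set"
  assumes k: "k \<ge> 4" and P: "finite P" "P \<subseteq> S2" and C: "C \<subseteq> unit_cycles k P"
begin

definition q :: "nat \<Rightarrow> (real ^ 3) list \<Rightarrow> real ^ 3" where "q i c = c ! (i mod k)"

lemma finC: "finite C"
  using C finite_unit_cycles(1)[OF P(1)] finite_subset by blast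

lemma q_add [simp]: "q (i + k) c = q i c"
  by (simp add: q_def)

lemma q_mod [simp]: "q (i mod k) c = q i c" "q (Suc (i mod k)) c = q (Suc i) c"
  by (simp_all add: q_def mod_Suc_eq)

lemma q_in: "c \<in> C \<Longrightarrow> q i c \<in> P" "c \<in> C \<Longrightarrow> q i c \<in> S2"
proof -
  assume c: "c \<in> C"
  have "i mod k < k" using k by simp
  moreover have "length c = k" "set c \<subseteq> P" using c C by (auto simp: unit_cycles_def)
  ultimately show "q i c \<in> P" using nth_mem[of "i mod k" c] by (auto simp: q_def)
  then show "q i c \<in> S2" using P by blast
qed

lemma q_dist: "c \<in> C \<Longrightarrow> dist (q i c) (q (Suc i) c) = 1"
proof -
  assume c: "c \<in> C"
  have "i mod k < k" using k by simp
  then have "dist (c ! (i mod k)) (c ! (Suc (i mod k) mod k)) = 1" using c C by (auto simp: unit_cycles_def)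
  then show ?thesis by (simp add: q_def mod_Suc_eq)
qed

lemma q_orth: "c \<in> C \<Longrightarrow> q i c \<bullet> q (Suc i) c = 0"
  using q_dist q_in(2) dist_S2 by blast

lemma q_distinct: "c \<in> C \<Longrightarrow> i mod k \<noteq> j mod k \<Longrightarrow> q i c \<noteq> q j c"
proof -
  assume c: "c \<in> C" and ne: "i mod k \<noteq> j mod k"
  have "i mod k < k" "j mod k < k" using k by simp_all
  moreover have "distinct c" "length c = k" using c C by (auto simp: unit_cycles_def)
  ultimately show ?thesis using ne by (simp add: q_def nth_eq_iff_index_eq)
qed

lemma mod_shift_ne:
  assumes "0 < d" "d < k" shows "i mod k \<noteq> (i + d) mod k"
proof
  assume "i mod k = (i + d) mod k"
  then have "k dvd d" using mod_eq_dvd_iff_nat[of i "i + d" k] by simp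
  then show False using assms by (auto dest: dvd_imp_le)
qed

lemma vertex_count: "card (q i ` C) \<le> card P"
  using q_in(1) P(1) by (intro card_mono) auto

lemma bnd_vertex: "bnd C q J {i} (real (card (q i ` C)))"
  by (rule bnd_single[OF finC]) (use finC in \<open>auto intro!: card_mono\<close>)

lemma bnd_skip:
  assumes "\<And>c. c \<in> C \<Longrightarrow> q i c \<noteq> - q (i + 2) c"
  shows "bnd C q {i, i + 2} {Suc i} 2"
proof (rule bnd_single[OF finC])
  fix c assume c: "c \<in> C"
  let ?X = "{c'\<in>C. \<forall>j\<in>{i, i + 2}. q j c' = q j c}"
  have ne: "q i c \<noteq> q (i + 2) c" using q_distinct[OF c] mod_shift_ne[of 2 i] k by auto
  have "q (Suc i) ` ?X \<subseteq> {q (Suc i) c, - q (Suc i) c}"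
  proof
    fix z assume "z \<in> q (Suc i) ` ?X"
    then obtain c' where c': "c' \<in> C" "q i c' = q i c" "q (i + 2) c' = q (i + 2) c" "z = q (Suc i) c'" by auto
    have "z = q (Suc i) c \<or> z = - q (Suc i) c"
    proof (rule common_orthogonal[of "q i c" "q (i + 2) c"])
      show "q i c \<bullet> z = 0" "q i c \<bullet> q (Suc i) c = 0"
        using q_orth[OF c'(1), of i] q_orth[OF c, of i] c' by auto
      show "q (i + 2) c \<bullet> z = 0" "q (i + 2) c \<bullet> q (Suc i) c = 0"
        using q_orth[OF c'(1), of "Suc i"] q_orth[OF c, of "Suc i"] c' by (auto simp: inner_commute)
    qed (use q_in[OF c] q_in[OF c'(1)] c' assms[OF c] ne in auto)
    then show "z \<in> {q (Suc i) c, - q (Suc i) c}" by blast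
  qed
  then have "card (q (Suc i) ` ?X) \<le> card {q (Suc i) c, - q (Suc i) c}" by (rule card_mono[rotated]) simp
  also have "\<dots> \<le> 2" by (simp add: card_insert_if)
  finally show "real (card (q (Suc i) ` ?X)) \<le> 2" by simp
qed

lemma bnd_antipodal:
  assumes "\<And>c. c \<in> C \<Longrightarrow> q i c = - q j c"
  shows "bnd C q {i} {j} 1"
  by (rule bnd_determined[OF finC]) (metis assms insertI1 minus_minus)

text \<open>Any \<open>k\<close> consecutive positions meet every residue modulo \<open>k\<close>,
  so they determine the list.\<close>

lemma bnd_cycle:
  assumes "bnd C q {} {s..<s + k} B" "0 \<le> B"
  shows "real (card C) \<le> B"
proof (rule bnd_total[OF finC assms(1) _ assms(2)])
  show "inj_on (\<lambda>c. restrict (\<lambda>i. q i c) {s..<s + k}) C"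
  proof (rule inj_onI)
    fix c c' assume c: "c \<in> C" "c' \<in> C" and eq: "restrict (\<lambda>i. q i c) {s..<s + k} = restrict (\<lambda>i. q i c') {s..<s + k}"
    have len: "length c = k" "length c' = k" using c C by (auto simp: unit_cycles_def)
    have "c ! j = c' ! j" if j: "j < k" for j
    proof -
      have sd: "s = k * (s div k) + s mod k" by simp
      have "\<exists>i\<in>{s..<s + k}. i mod k = j"
      proof (cases "s mod k \<le> j")
        case True
        have "s + (j - s mod k) = k * (s div k) + j" using True sd by linarith
        then have "(s + (j - s mod k)) mod k = j" using j by simp
        then show ?thesis using j by (intro bexI[of _ "s + (j - s mod k)"]) auto
      next
        case False
        have sk: "s mod k < k" using k by simp
        have "s + (k + j - s mod k) = k * (s div k) + (k + j)" using sk
sd by linarith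
        then have "(s + (k + j - s mod k)) mod k = j" using j by simp
        then show ?thesis using j False sk by (intro bexI[of _ "s + (k + j - s mod k)"]) auto
      qed
      then obtain i where i: "i \<in> {s..<s + k}" "i mod k = j" by blast
      have "q i c = q i c'" using eq i(1) by (metis restrict_apply')
      then show ?thesis by (simp add: q_def i)
    qed
    then show "c = c'" using len by (simp add: nth_equalityI)
  qed
qed

end

text \<open>What pigeonholing provides: fibres over single positions and over edges of constant size
  up to the factor \<open>L\<close>, and antipodality at each position for all cycles or for none.
  The constant \<open>W\<close> absorbs both \<open>L\<^sup>2\<close> from
  \<open>degree_bound\<close> and 384 from \<open>unit_pairs_le\<close>.\<close>

locale regular_family = cycle_family +
  fixes TV TE :: "nat \<Rightarrow> real" and L W :: real
  assumes k5: "k \<ge> 5" and ne: "C \<noteq> {}" and n2: "card P \<ge> 2"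
    and TV: "\<And>i c. c \<in> C \<Longrightarrow> TV i \<le> real (card {c'\<in>C. q i c' = q i c})"
      "\<And>i c. c \<in> C \<Longrightarrow> real (card {c'\<in>C. q i c' = q i c}) \<le> L * TV i" "\<And>i. 0 < TV i"
    and TE: "\<And>i c. c \<in> C \<Longrightarrow> TE i \<le> real (card {c'\<in>C. (q i c', q (Suc i) c') = (q i c, q (Suc i) c)})"
      "\<And>i c. c \<in> C \<Longrightarrow> real (card {c'\<in>C. (q i c', q (Suc i) c') = (q i c, q (Suc i) c)}) \<le> L * TE i" "\<And>i. 0 < TE i"
    and L: "0 \<le> L" "L\<^sup>2 \<le> W" and W: "384 \<le> W"
    and pattern: "\<And>i. (\<forall>c\<in>C. q i c = - q (i + 2) c) \<or> (\<forall>c\<in>C. q i c \<noteq> - q (i + 2) c)"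
begin

abbreviation n :: real where "n \<equiv> real (card P)"

definition V :: "nat \<Rightarrow> real" where "V i = real (card (q i ` C))"
definition E :: "nat \<Rightarrow> real" where "E i = real (card ((\<lambda>c. (q i c, q (Suc i) c)) ` C))"
text \<open>The cyclic predecessor of \<open>i\<close> is written \<open>i + k - 1\<close> so that
  it is also correct at 0.\<close>

definition A :: "nat set" where "A = {i. \<forall>c\<in>C. q (i + k - 1) c = - q (Suc i) c}"

lemma Suc_A: "Suc i \<in> A \<longleftrightarrow> (\<forall>c\<in>C. q i c = - q (i + 2) c)"
proof -
  have "Suc i + k - 1 = i + k" by simp
  then show ?thesis by (simp add: A_def)
qed

lemma n_gt_1: "n > 1" using n2 by linarith

lemma V_pos: "V i \<ge> 1"
proof -
  have "card (q i ` C) > 0" using finC ne by (simp add: card_gt_0_iff)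
  then show ?thesis unfolding V_def by linarith
qed

lemma E_pos: "E i \<ge> 1"
proof -
  have "card ((\<lambda>c. (q i c, q (Suc i) c)) ` C) > 0" using finC ne by (simp add: card_gt_0_iff)
  then show ?thesis unfolding E_def by linarith
qed

lemma powr_log [simp]: "x > 0 \<Longrightarrow> n powr log n x = x"
  using n_gt_1 by (simp add: powr_log_cancel)

lemma bnd_step:
  assumes "i = a \<and> j = Suc a \<or> i = Suc a \<and> j = a"
  shows "bnd C q {i} {j} (n powr (log n (E a) - log n (V i) + log n W))"
proof (rule bnd_single[OF finC])
  fix c assume c: "c \<in> C"
  have "real (card (q j ` {c'\<in>C. q i c' = q i c})) \<le> L\<^sup>2 * real (card ((\<lambda>c. (q a c, q (Suc a) c)) ` C)) / real (card (q i ` C))"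
    by (rule degree_bound[OF finC c, where T="TV i" and U="TE a"]) (use TV TE L assms in auto)
  also have "\<dots> = L\<^sup>2 * (E a / V i)" by (simp add: E_def V_def)
  also have "\<dots> \<le> W * (E a / V i)" using L E_pos[of a] V_pos[of i] by (intro mult_right_mono) auto
  also have "\<dots> = n powr (log n (E a) - log n (V i) + log n W)"
    using E_pos[of a] V_pos[of i] W by (simp add: powr_add powr_diff)
  finally show "real (card (q j ` {c'\<in>C. \<forall>j\<in>{i}. q j c' = q j c})) \<le> n powr (log n (E a) - log n (V i) + log n W)"
    by simp
qed

lemma edge_count:
  "log n (E i) \<le> max (2/3 * (log n (V i) + log n (V (Suc i)))) (max (log n (V i)) (log n (V (Suc i)))) + log n W"
    (is "_ \<le> ?M + _")
proof -
  let ?X = "q i ` C" and ?Y = "q (Suc i) ` C"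
  have X: "finite ?X" "finite ?Y" "?X \<subseteq> S2" "?Y \<subseteq> S2" using finC q_in by auto
  have "E i \<le> real (card {(p, p') \<in> ?X \<times> ?Y. dist p p' = 1})"
    unfolding E_def using q_dist X by (intro of_nat_mono card_mono) (auto intro: finite_subset[of _ "?X \<times> ?Y"])
  also have "\<dots> \<le> 384 * max ((V i * V (Suc i)) powr (2/3)) (max (V i) (V (Suc i)))"
    using unit_pairs_le[OF X] by (simp add: V_def of_nat_max)
  also have "\<dots> \<le> W * n powr ?M"
  proof (rule mult_mono)
    have "n powr (log n (V i) + log n (V (Suc i))) = V i * V (Suc i)"
      using V_pos[of i] V_pos[of "Suc i"] by (simp add: powr_add)
    then have 1: "n powr (2/3 * (log n (V i) + log n (V (Suc i)))) = (V i * V (Suc i)) powr (2/3)"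
      by (metis powr_powr mult.commute)
    have 2: "n powr log n (V i) = V i" "n powr log n (V (Suc i)) = V (Suc i)"
      using V_pos[of i] V_pos[of "Suc i"] by simp_all
    have mono: "n powr a \<le> n powr ?M" if "a \<le> ?M" for a using n_gt_1 that by (intro powr_mono) auto
    show "max ((V i * V (Suc i)) powr (2/3)) (max (V i) (V (Suc i))) \<le> n powr ?M"
      using mono[of "2/3 * (log n (V i) + log n (V (Suc i)))"] mono[of "log n (V i)"] mono[of "log n (V (Suc i))"]
      unfolding 1 2 by simp
  qed (use W V_pos[of i] in auto)
  also have "\<dots> = n powr (?M + log n W)" using W by (simp add: powr_add)
  finally have "log n (E i) \<le> log n (n powr (?M + log n W))"
    using E_pos[of i] n_gt_1 by (subst log_le_cancel_iff) auto
  then show ?thesis using n_gt_1 by simp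
qed

text \<open>With \<open>eps = log n W\<close>, every \<open>eps\<close> lost in an exponent is a
  factor \<open>W\<close> in the count.\<close>

sublocale cyclic_tours "\<lambda>J I r. bnd C q J I (n powr r)" "\<lambda>i. log n (V i)" "\<lambda>i. log n (E i)" A "log n W" k
proof
  show "k \<ge> 5" by (rule k5)
  fix J I J' I' :: "nat set" and r r' :: real and i :: nat
  show "bnd C q J (I \<union> I') (n powr (r + r'))" if "bnd C q J I (n powr r)" "bnd C q (J \<union> I) I' (n powr r')"
    using bnd_chain[OF finC that] by (simp add: powr_add)
  show "bnd C q J' I' (n powr r')" if "bnd C q J I (n powr r)" "J \<subseteq> J'" "I' \<subseteq> I \<union> J'" "r \<le> r'"
    by (rule bnd_weaken[OF finC that(1-3)]) (use that(4) n_gt_1 in \<open>auto intro: powr_mono\<close>)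
  show "bnd C q {} {} (n powr 0)"
    using n_gt_1 by (auto simp: bnd_def restrict_def image_constant_conv)
  show "bnd C q {} {i} (n powr log n (V i))" using bnd_vertex[of "{}" i] V_pos[of i] by (simp add: V_def)
  show "bnd C q {i} {Suc i} (n powr (log n (E i) - log n (V i) + log n W))" by (rule bnd_step) simp
  show "bnd C q {Suc i} {i} (n powr (log n (E i) - log n (V (Suc i)) + log n W))" by (rule bnd_step) simp
  show "0 \<le> log n (V i)" using V_pos[of i] n_gt_1 by (subst zero_le_log_cancel_iff) auto
  show "log n (V i) \<le> 1"
  proof -
    have "log n (V i) \<le> log n n" unfolding V_def using vertex_count[of i] V_pos[of i] n_gt_1
      by (subst log_le_cancel_iff) (auto simp: V_def)
    then show ?thesis using n_gt_1 by simp
  qed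
  show "log n (E i) \<le> max (2/3 * (log n (V i) + log n (V (Suc i)))) (max (log n (V i)) (log n (V (Suc i)))) + log n W"
    by (rule edge_count)
  show "bnd C q {i, i + 2} {Suc i} (n powr log n W)" if "Suc i \<notin> A"
  proof (rule bnd_weaken[OF finC bnd_skip])
    show "q i c \<noteq> - q (i + 2) c" if "c \<in> C" for c
      using \<open>Suc i \<notin> A\<close> pattern[of i] that unfolding Suc_A by blast
  qed (use W in auto)
  show "bnd C q {i} {i + 2} (n powr 0)" if "Suc i \<in> A"
    using bnd_antipodal[of i "i + 2"] that n_gt_1 unfolding Suc_A by simp
  show "log n (V (i + 2)) = log n (V i)" if "Suc i \<in> A"
  proof -
    have "q i ` C = uminus ` (q (i + 2) ` C)" using that unfolding Suc_A image_image by auto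
    then show ?thesis unfolding V_def by (simp add: card_image)
  qed
  \<comment> \<open>Two such positions would make vertices four steps apart equal, against
    distinctness for \<open>k \<ge> 5\<close>. A 4-cycle can have both diagonals antipodal, which is
    why it is treated separately.\<close>
  show "i + 2 \<notin> A" if "i \<in> A"
  proof
    assume "i + 2 \<in> A"
    obtain c where c: "c \<in> C" using ne by blast
    have 1: "q (i + k - 1) c = - q (Suc i) c" using that c by (simp add: A_def)
    have 2: "q (Suc i) c = - q (Suc i + 2) c" using \<open>i + 2 \<in> A\<close> Suc_A[of "Suc i"] c by simp
    have "i + k - 1 + 4 = Suc i + 2 + k" using k5 by simp
    then have "q (i + k - 1 + 4) c = q (Suc i + 2) c" by (simp only: q_add)
    then have "q (i + k - 1) c = q (i + k - 1 + 4) c" using 1 2 by simp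
    then show False using q_distinct[OF c mod_shift_ne[of 4 "i + k - 1"]] k5 by simp
  qed
  show "0 \<le> log n W" using W n_gt_1 by simp
  show "bnd C q {i} {i + k} (n powr 0)"
    using bnd_determined[OF finC, of "{i}" q "i + k"] n_gt_1 by simp
  show "i + k \<in> A \<longleftrightarrow> i \<in> A"
  proof -
    have "i + k + k - 1 = (i + k - 1) + k" "Suc (i + k) = Suc i + k" using k by simp_all
    then show ?thesis unfolding A_def mem_Collect_eq by (simp only: q_add)
  qed
qed

lemma regular_bound:
  assumes "k \<notin> {6, 7, 9}"
  shows "real (card C) \<le> n powr (real (phi k) / 3) * W ^ (3 * k)"
proof -
  obtain s where "bnd C q {} {s..<s + k} (n powr (real (phi k) / 3 + 3 * real k * log n W))"
    using cycle_bound[OF assms] by blast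
  then have "real (card C) \<le> n powr (real (phi k) / 3 + 3 * real k * log n W)" by (rule bnd_cycle) simp
  also have "\<dots> = n powr (real (phi k) / 3) * (n powr log n W) powr (3 * real k)"
    by (simp add: powr_add powr_powr mult.commute)
  also have "(n powr log n W) powr (3 * real k) = W ^ (3 * k)"
    using W by (simp add: powr_realpow[symmetric])
  finally show ?thesis .
qed

end


text \<open>The factor \<open>2 ^ k\<close> pays for fixing the antipodality pattern and
  \<open>2 * l ^ (2 * k)\<close> for regularizing \<open>2 * k\<close> projections, \<open>k\<close>
  to positions and \<open>k\<close> to edges; \<open>l\<close> is large enough because there are at
  most \<open>card P ^ k\<close> cycles. The last factor is \<open>W ^ (3 * k)\<close> with
  \<open>W = 384 * L\<^sup>2\<close>.\<close>

lemma unit_cycles_le: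
  assumes k: "k \<ge> 5" "k \<notin> {6, 7, 9}" and P: "finite P" "P \<subseteq> S2" "card P \<ge> 2" and m: "card P < 2 ^ m"
  defines "l \<equiv> k * m"
  shows "real (card (unit_cycles k P))
    \<le> 2 ^ (k + 1) * real l ^ (2 * k) * (real (card P) powr (real (phi k) / 3) * (384 * (8 * real k * real l ^ (2 * k))\<^sup>2) ^ (3 * k))"
proof (cases "unit_cycles k P = {}")
  case False
  let ?D = "unit_cycles k P"
  interpret D: cycle_family k P ?D by unfold_locales (use k P in auto)
  define pat where "pat c = {i. i < k \<and> D.q i c = - D.q (i + 2) c}" for c
  obtain c0 where c0: "c0 \<in> ?D" "card ?D \<le> card (pat ` ?D) * card {c\<in>?D. pat c = pat c0}"
    using popular_fibre[OF D.finC False, of pat] by blast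
  define C where "C = {c\<in>?D. pat c = pat c0}"
  have C: "finite C" "C \<noteq> {}" "C \<subseteq> ?D" using c0 D.finC by (auto simp: C_def)
  have "card (pat ` ?D) \<le> card (Pow {..<k})" by (intro card_mono) (auto simp: pat_def)
  then have "card (pat ` ?D) * card C \<le> 2 ^ k * card C" by (intro mult_le_mono1) (simp add: card_Pow)
  then have DC: "card ?D \<le> 2 ^ k * card C" using c0(2) unfolding C_def[symmetric] by linarith
  have "card C \<le> card ?D" using C(3) D.finC by (rule card_mono[rotated])
  also have "\<dots> \<le> card P ^ k" by (rule finite_unit_cycles(2)[OF P(1)])
  also have "\<dots> < (2 ^ m) ^ k" using m k by (intro power_strict_mono) auto
  finally have Cl: "card C < 2 ^ l" by (simp add: l_def power_mult[symmetric] mult.commute)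
  \<comment> \<open>Single vertices are doubled so that projections to positions and to edges have
    the same type.\<close>
  define f where "f j c = (if j < k then (D.q j c, D.q j c) else (D.q (j - k) c, D.q (Suc (j - k)) c))" for j c
  have "0 \<in> {..<2 * k}" using k by simp
  then have J: "finite {..<2 * k}" "{..<2 * k} \<noteq> {}" by blast+
  obtain S and T :: "nat \<Rightarrow> real" where ST: "S \<subseteq> C \<and> S \<noteq> {} \<and> card C \<le> 2 * l ^ card {..<2 * k} * card S \<and>
    (\<forall>j\<in>{..<2 * k}. \<forall>c\<in>S. T j \<le> real (card {c'\<in>S. f j c' = f j c}) \<and>
       real (card {c'\<in>S. f j c' = f j c}) \<le> (4 * card {..<2 * k} * l ^ card {..<2 * k}) * T j \<and> 0 < T j)"
    using regularize[OF C(1,2) J Cl, of f] by blast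
  have S: "S \<subseteq> C" "S \<noteq> {}" "card C \<le> 2 * l ^ (2 * k) * card S" using ST by auto
  have T: "T j \<le> real (card {c'\<in>S. f j c' = f j c})"
      "real (card {c'\<in>S. f j c' = f j c}) \<le> (8 * k * l ^ (2 * k)) * T j" "0 < T j"
    if "j < 2 * k" "c \<in> S" for j c using ST that by auto
  define L where "L = 8 * real k * real l ^ (2 * k)"
  define W where "W = 384 * L\<^sup>2"
  have l: "l \<ge> 1"
  proof -
    have "m > 0" using m P by (cases m) auto
    then show ?thesis using k by (simp add: l_def)
  qed
  have "1 * 1 \<le> 8 * real k * real l ^ (2 * k)" using l k by (intro mult_mono one_le_power) auto
  then have L1: "L \<ge> 1" by (simp add: L_def)
  have L2: "1 \<le> L\<^sup>2" using L1 by (rule one_le_power)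
  interpret R: regular_family k P S "\<lambda>i. T (i mod k)" "\<lambda>i. T (k + i mod k)" L W
  proof
    have fV: "(f (i mod k) c = f (i mod k) c') = (D.q i c = D.q i c')" for i c c'
      using k by (simp add: f_def)
    have fE: "(f (k + i mod k) c = f (k + i mod k) c') = ((D.q i c, D.q (Suc i) c) = (D.q i c', D.q (Suc i) c'))" for i c c'
      by (simp add: f_def)
    have lt: "i mod k < 2 * k" "k + i mod k < 2 * k" for i
    proof -
      have "i mod k < k" using k by simp
      then show "i mod k < 2 * k" "k + i mod k < 2 * k" by linarith+
    qed
    obtain s0 where s0: "s0 \<in> S" using S(2) by blast
    fix i c
    show "T (i mod k) \<le> real (card {c' \<in> S. D.q i c' = D.q i c})" if "c \<in> S"
      using T(1)[OF lt(1)[of i] that] unfolding fV .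
    show "real (card {c' \<in> S. D.q i c' = D.q i c}) \<le> L * T (i mod k)" if "c \<in> S"
      using T(2)[OF lt(1)[of i] that] unfolding fV L_def by simp
    show "0 < T (i mod k)" "0 < T (k + i mod k)" using T(3)[OF lt(1) s0] T(3)[OF lt(2) s0] by simp_all
    show "T (k + i mod k) \<le> real (card {c' \<in> S. (D.q i c', D.q (Suc i) c') = (D.q i c, D.q (Suc i) c)})" if "c \<in> S"
      using T(1)[OF lt(2)[of i] that] unfolding fE .
    show "real (card {c' \<in> S. (D.q i c', D.q (Suc i) c') = (D.q i c, D.q (Suc i) c)}) \<le> L * T (k + i mod k)" if "c \<in> S"
      using T(2)[OF lt(2)[of i] that] unfolding fE L_def by simp
    show "(\<forall>c\<in>S. D.q i c = - D.q (i + 2) c) \<or> (\<forall>c\<in>S. D.q i c \<noteq> - D.q (i + 2) c)"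
    proof -
      have "D.q (i mod k + 2) c = D.q (i + 2) c" for c
        unfolding D.q_def by (simp only: mod_add_left_eq)
      then have "i mod k \<in> pat c \<longleftrightarrow> D.q i c = - D.q (i + 2) c" for c
        using k by (simp add: pat_def)
      moreover have "pat c = pat c0" if "c \<in> S" for c using that S(1) by (auto simp: C_def)
      ultimately show ?thesis by metis
    qed
  qed (use k P S C L1 L2 in \<open>auto simp: W_def\<close>)
  have "real (card S) \<le> real (card P) powr (real (phi k) / 3) * W ^ (3 * k)"
    by (rule R.regular_bound) (use k in auto)
  then have bS: "2 ^ (k + 1) * real l ^ (2 * k) * real (card S)
      \<le> 2 ^ (k + 1) * real l ^ (2 * k) * (real (card P) powr (real (phi k) / 3) * W ^ (3 * k))"
    by (intro mult_left_mono) auto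
  have "2 ^ k * card C \<le> 2 ^ k * (2 * l ^ (2 * k) * card S)" by (intro mult_le_mono2 S(3))
  also have "\<dots> = 2 ^ (k + 1) * l ^ (2 * k) * card S" by (simp add: mult_ac)
  finally have "card ?D \<le> 2 ^ (k + 1) * l ^ (2 * k) * card S" using DC by linarith
  then have "real (card ?D) \<le> real (2 ^ (k + 1) * l ^ (2 * k) * card S)" by (rule of_nat_mono)
  also have "\<dots> = 2 ^ (k + 1) * real l ^ (2 * k) * real (card S)" by simp
  finally show ?thesis using bS unfolding W_def L_def by linarith
qed simp

lemma unit_cycles_soft_upper:
  assumes k: "k \<ge> 5" "k \<notin> {6, 7, 9}"
  shows "\<exists>K>0. \<exists>c>0. \<forall>P. finite P \<longrightarrow> P \<subseteq> S2 \<longrightarrow> card P \<ge> 3 \<longrightarrow>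
    real (card (unit_cycles k P)) \<le> K * real (card P) powr (real (phi k) / 3) * ln (real (card P)) powr c"
proof -
  \<comment> \<open>The power of \<open>l\<close>: \<open>2 * k\<close> from regularization, and
    \<open>4 * k\<close> from \<open>W\<close> raised to the power \<open>3 * k\<close>.\<close>
  define e where "e = 2 * k + 12 * k * k"
  define K0 :: real where "K0 = 2 ^ (k + 1) * (24576 * real k ^ 2) ^ (3 * k)"
  define K where "K = K0 * (4 * real k) ^ e"
  have K: "K > 0" "K0 > 0" unfolding K_def K0_def using k by auto
  have "e > 0" unfolding e_def using k by simp
  then have e: "real e > 0" by simp
  have "real (card (unit_cycles k P)) \<le> K * real (card P) powr (real (phi k) / 3) * ln (real (card P)) powr real e"
    if P: "finite P" "P \<subseteq> S2" "card P \<ge> 3" for P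
  proof -
    let ?n = "real (card P)"
    have n: "?n \<ge> 3" using P by simp
    have "exp 1 \<le> ?n" using exp_le n by linarith
    then have ln1: "ln ?n \<ge> 1" using n by (simp add: ln_ge_iff)
    define m where "m = nat \<lceil>log 2 ?n\<rceil> + 1"
    have l0: "log 2 ?n \<ge> 0" using n by simp
    have m1: "log 2 ?n < real m" "real m \<le> log 2 ?n + 2" unfolding m_def using l0 by linarith+
    have "?n < 2 powr real m" using m1(1) n by (simp add: log_less_iff)
    then have "card P < 2 ^ m" by (simp add: powr_realpow flip: of_nat_less_iff)
    note bound = unit_cycles_le[OF k P(1,2) _ this]
    have "ln (2::real) \<ge> 1/2" using ln2_ge_two_thirds by linarith
    then have "log 2 ?n \<le> 2 * ln ?n" using ln1 unfolding log_def
      by (simp add: divide_le_eq)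
    then have "real m \<le> 4 * ln ?n" using m1(2) ln1 by linarith
    then have "real k * real m \<le> real k * (4 * ln ?n)" by (intro mult_left_mono) auto
    then have l: "real (k * m) \<le> 4 * real k * ln ?n" by simp
    have "real (card (unit_cycles k P)) \<le> K0 * real (k * m) ^ e * ?n powr (real (phi k) / 3)"
    proof -
      have "(384 * (8 * real k * x ^ (2 * k))\<^sup>2) ^ (3 * k) = (24576 * real k ^ 2) ^ (3 * k) * x ^ (12 * k * k)" for x :: real
      proof -
        have "384 * (8 * real k * x ^ (2 * k))\<^sup>2 = (24576 * real k ^ 2) * x ^ (4 * k)"
          by (simp add: power_mult_distrib power_mult[symmetric])
        then show ?thesis by (simp add: power_mult_distrib power_mult[symmetric] mult_ac)
      qed
      then have eq: "2 ^ (k + 1) * x ^ (2 * k) * (y * (384 * (8 * real k * x ^ (2 * k))\<^sup>2) ^ (3 * k)) = K0 * x ^ e * y" for x y :: real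
        by (simp add: K0_def e_def power_add mult_ac)
      show ?thesis using bound P(3) unfolding eq by linarith
    qed
    also have "\<dots> \<le> K0 * (4 * real k * ln ?n) ^ e * ?n powr (real (phi k) / 3)"
      using l K by (intro mult_right_mono mult_left_mono power_mono) auto
    also have "\<dots> = K * ?n powr (real (phi k) / 3) * ln ?n powr real e"
      using ln1 by (simp add: K_def power_mult_distrib powr_realpow mult_ac)
    finally show ?thesis .
  qed
  then show ?thesis using K e by blast
qed

text \<open>If \<open>0\<close> and \<open>2\<close> are not antipodal, both are free and the other
  two vertices have two choices each: \<open>4 * n\<^sup>2\<close>. If only \<open>1\<close> and
  \<open>3\<close> are not antipodal, they are free, vertex 2 has two choices and vertex 0 is its
  antipode: \<open>2 * n\<^sup>2\<close>. If both diagonals are antipodal, two vertices determine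
  the rest: \<open>n\<^sup>2\<close>.\<close>

lemma four_cycles_le:
  assumes P: "finite P" "P \<subseteq> S2"
  shows "real (card (unit_cycles 4 P)) \<le> 7 * (real (card P))\<^sup>2"
proof -
  interpret D: cycle_family 4 P "unit_cycles 4 P" by unfold_locales (use P in auto)
  let ?n = "real (card P)"
  let ?D = "unit_cycles 4 P"
  define C1 where "C1 = {c\<in>?D. D.q 0 c \<noteq> - D.q 2 c}"
  define C2 where "C2 = {c\<in>?D. D.q 0 c = - D.q 2 c \<and> D.q 1 c \<noteq> - D.q 3 c}"
  define C3 where "C3 = {c\<in>?D. D.q 0 c = - D.q 2 c \<and> D.q 1 c = - D.q 3 c}"
  interpret C1: cycle_family 4 P C1 by unfold_locales (use P in \<open>auto simp: C1_def\<close>)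
  interpret C2: cycle_family 4 P C2 by unfold_locales (use P in \<open>auto simp: C2_def\<close>)
  interpret C3: cycle_family 4 P C3 by unfold_locales (use P in \<open>auto simp: C3_def\<close>)
  have per: "D.q 4 c = D.q 0 c" "D.q 5 c = D.q 1 c" for c by (simp_all add: D.q_def)
  have two: "bnd C D.q {} ({i} \<union> {j}) (?n * ?n)" if "cycle_family 4 P C" for C i j
  proof -
    interpret C: cycle_family 4 P C by (rule that)
    have v: "bnd C D.q J {i} ?n" for J i
      by (rule bnd_weaken[OF C.finC C.bnd_vertex]) (use C.vertex_count in auto)
    show ?thesis by (rule bnd_chain[OF C.finC v v]) simp
  qed
  have step: "bnd C D.q {} (I \<union> I') (B * B')"
    if "cycle_family 4 P C" "bnd C D.q {} I B" "bnd C D.q J I' B'" "J \<subseteq> I" "0 \<le> B'" for C I I' J B B'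
  proof -
    interpret C: cycle_family 4 P C by (rule that(1))
    have "bnd C D.q ({} \<union> I) I' B'" by (rule bnd_weaken[OF C.finC that(3)]) (use that in auto)
    then show ?thesis using bnd_chain[OF C.finC that(2) _ that(5)] by simp
  qed
  have all: "real (card C) \<le> B" if C: "cycle_family 4 P C" and b: "bnd C D.q {} I B" "{0,1,2,3} \<subseteq> I" "0 \<le> B" for C B I
  proof -
    interpret C: cycle_family 4 P C by (rule C)
    have "{0..<0 + 4} \<subseteq> I \<union> {}"
    proof
      fix x :: nat assume "x \<in> {0..<0 + 4}"
      then have "x = 0 \<or> x = 1 \<or> x = 2 \<or> x = 3" by (simp; presburger)
      then show "x \<in> I \<union> {}" using b(2) by auto
    qed
    then have "bnd C D.q {} {0..<0 + 4} B" by (rule bnd_weaken[OF C.finC b(1) order_refl]) simp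
    then show ?thesis using b(3) by (rule C.bnd_cycle)
  qed
  have c1: "real (card C1) \<le> 4 * ?n\<^sup>2"
  proof -
    have F: "cycle_family 4 P C1" by (rule C1.cycle_family_axioms)
    have a: "bnd C1 D.q {0, 0 + 2} {Suc 0} 2" by (rule C1.bnd_skip) (simp add: C1_def numeral_2_eq_2)
    have b: "bnd C1 D.q {2, 2 + 2} {Suc 2} 2" by (rule C1.bnd_skip) (use per in \<open>auto simp: C1_def\<close>)
    have c: "bnd C1 D.q {0} {4} 1" by (rule bnd_determined[OF C1.finC]) (simp add: per)
    have "bnd C1 D.q {} ({0} \<union> {2} \<union> {Suc 0} \<union> {4} \<union> {Suc 2}) (?n * ?n * 2 * 1 * 2)"
      by (rule step[OF F step[OF F step[OF F two[OF F] a] c] b]) auto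
    from all[OF F this] show ?thesis by (simp add: power2_eq_square numeral_3_eq_3)
  qed
  have c2: "real (card C2) \<le> 2 * ?n\<^sup>2"
  proof -
    have F: "cycle_family 4 P C2" by (rule C2.cycle_family_axioms)
    have a: "bnd C2 D.q {1, 1 + 2} {Suc 1} 2" by (rule C2.bnd_skip) (simp add: C2_def numeral_3_eq_3)
    have b: "bnd C2 D.q {2} {0} 1" by (rule C2.bnd_antipodal) (simp add: C2_def)
    have "bnd C2 D.q {} ({1} \<union> {3} \<union> {Suc 1} \<union> {0}) (?n * ?n * 2 * 1)"
      by (rule step[OF F step[OF F two[OF F] a] b]) auto
    from all[OF F this] show ?thesis by (simp add: power2_eq_square numeral_2_eq_2)
  qed
  have c3: "real (card C3) \<le> ?n\<^sup>2"
  proof -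
    have F: "cycle_family 4 P C3" by (rule C3.cycle_family_axioms)
    have a: "bnd C3 D.q {0} {2} 1" by (rule C3.bnd_antipodal) (simp add: C3_def)
    have b: "bnd C3 D.q {1} {3} 1" by (rule C3.bnd_antipodal) (simp add: C3_def)
    have "bnd C3 D.q {} ({0} \<union> {1} \<union> {2} \<union> {3}) (?n * ?n * 1 * 1)"
      by (rule step[OF F step[OF F two[OF F] a] b]) auto
    from all[OF F this] show ?thesis by (simp add: power2_eq_square)
  qed
  have "?D = C1 \<union> (C2 \<union> C3)" by (auto simp: C1_def C2_def C3_def)
  then have "card ?D \<le> card C1 + (card C2 + card C3)"
    using card_Un_le[of C1 "C2 \<union> C3"] card_Un_le[of C2 C3] by simp
  then show ?thesis using c1 c2 c3 by linarith
qed

section \<open>Constructions\<close>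

definition to_S2 :: "real ^ 3 \<Rightarrow> real ^ 3" where
  "to_S2 v = (1 / (sqrt 2 * norm v)) *\<^sub>R v"

lemma to_S2_in: "v \<noteq> 0 \<Longrightarrow> to_S2 v \<in> S2"
  by (simp add: to_S2_def S2_def)

lemma to_S2_inner [simp]: "to_S2 v \<bullet> w = 0 \<longleftrightarrow> v \<bullet> w = 0" "w \<bullet> to_S2 v = 0 \<longleftrightarrow> w \<bullet> v = 0"
  by (auto simp: to_S2_def)

lemma to_S2_eq:
  assumes "to_S2 v = to_S2 w" "v \<noteq> 0" "w \<noteq> 0"
  shows "v = (norm v / norm w) *\<^sub>R w"
proof -
  have "(sqrt 2 * norm v) *\<^sub>R to_S2 v = v" using assms(2) by (simp add: to_S2_def)
  then have "v = (sqrt 2 * norm v) *\<^sub>R to_S2 w" using assms(1) by simp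
  then show ?thesis by (simp add: to_S2_def)
qed

lemma cross_eq_0_S2: "p \<in> S2 \<Longrightarrow> p' \<in> S2 \<Longrightarrow> cross3 p p' = 0 \<Longrightarrow> p = p' \<or> p = - p'"
proof -
  assume S: "p \<in> S2" "p' \<in> S2" "cross3 p p' = 0"
  then have "collinear {0, p', p}" unfolding cross_eq_0 by (simp add: insert_commute)
  then obtain c where "p = c *\<^sub>R p'" using S2_nonzero[OF S(1)] S2_nonzero[OF S(2)] by (auto simp: collinear_lemma)
  then show ?thesis using S2_parallel[OF S(1,2)] by blast
qed

lemma S2_neq_uminus: "p \<in> S2 \<Longrightarrow> p \<noteq> - p"
proof
  assume "p \<in> S2" "p = - p"
  then have "p \<bullet> p = p \<bullet> (- p)" by metis
  then show False using \<open>p \<in> S2\<close> by (simp add: S2_inner)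
qed

lemma orth_neq: "p \<in> S2 \<Longrightarrow> p \<bullet> p' = 0 \<Longrightarrow> p \<noteq> p' \<and> p \<noteq> - p'"
  by (auto simp: S2_inner)

lemma exists_orthogonal:
  fixes f :: "real ^ 3" assumes "f \<noteq> 0" shows "\<exists>h. h \<noteq> 0 \<and> h \<bullet> f = 0"
proof -
  define h1 h2 :: "real ^ 3" where "h1 = vector [f $ 2, - f $ 1, 0]" and "h2 = vector [f $ 3, 0, - f $ 1]"
  have "h1 \<bullet> f = 0" "h2 \<bullet> f = 0" by (simp_all add: h1_def h2_def inner_vec_def sum_3)
  moreover have "h1 \<noteq> 0 \<or> h2 \<noteq> 0" if "f $ 1 \<noteq> 0 \<or> f $ 2 \<noteq> 0 \<or> f $ 3 \<noteq> 0"
    using that by (auto simp: h1_def h2_def vec_eq_iff forall_3)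
  moreover have "f $ 1 \<noteq> 0 \<or> f $ 2 \<noteq> 0 \<or> f $ 3 \<noteq> 0" using assms by (auto simp: vec_eq_iff forall_3)
  ultimately show ?thesis by blast
qed

text \<open>Turns the condition of being parallel to \<open>f\<close> into a consequence that is one
  linear equation, so that general position arguments handle only orthogonality.\<close>

definition perp :: "real ^ 3 \<Rightarrow> real ^ 3" where
  "perp f = (SOME h. h \<noteq> 0 \<and> h \<bullet> f = 0)"

lemma perp: "f \<noteq> 0 \<Longrightarrow> perp f \<noteq> 0" "f \<noteq> 0 \<Longrightarrow> perp f \<bullet> f = 0" "f \<noteq> 0 \<Longrightarrow> f \<bullet> perp f = 0"
  using someI_ex[OF exists_orthogonal[of f]] by (auto simp: perp_def inner_commute)

lemma finite_quadratic_roots: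
  fixes a b c :: real
  assumes "a \<noteq> 0 \<or> b \<noteq> 0 \<or> c \<noteq> 0"
  shows "finite {t. a + b * t + c * t\<^sup>2 = 0}"
proof -
  have "[:a, b, c:] \<noteq> 0" using assms by auto
  then have "finite {t. poly [:a, b, c:] t = 0}" by (rule poly_roots_finite)
  then show ?thesis by (simp add: algebra_simps power2_eq_square)
qed

text \<open>The moment curve: a plane through the origin meets it in the roots of a nonzero
  quadratic, so all but finitely many parameters satisfy any finite list of genericity
  conditions.\<close>

definition curve :: "real \<Rightarrow> real ^ 3" where
  "curve t = vector [1, t, t\<^sup>2]"

lemma curve_nonzero [simp]: "curve t \<noteq> 0"
  by (simp add: curve_def vec_eq_iff forall_3)

lemma finite_curve: "f \<noteq> 0 \<Longrightarrow> finite {t. f \<bullet> curve t = 0}"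
proof -
  assume "f \<noteq> 0"
  then have "f $ 1 \<noteq> 0 \<or> f $ 2 \<noteq> 0 \<or> f $ 3 \<noteq> 0" by (auto simp: vec_eq_iff forall_3)
  from finite_quadratic_roots[OF this] show ?thesis by (simp add: curve_def inner_vec_def sum_3)
qed

lemma finite_curve_parallel: "f \<noteq> 0 \<Longrightarrow> finite {t. \<exists>c. curve t = c *\<^sub>R f}"
  by (rule finite_subset[OF _ finite_curve[OF perp(1)]]) (auto simp: perp)

lemma finite_curve_cross: "f \<noteq> 0 \<Longrightarrow> finite {t. cross3 (curve t) f = 0}"
proof (rule finite_subset[OF _ finite_curve_parallel])
  assume f: "f \<noteq> 0"
  show "{t. cross3 (curve t) f = 0} \<subseteq> {t. \<exists>c. curve t = c *\<^sub>R f}"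
  proof clarify
    fix t assume "cross3 (curve t) f = 0"
    then have "collinear {0, f, curve t}" unfolding cross_eq_0 by (simp add: insert_commute)
    then show "\<exists>c. curve t = c *\<^sub>R f" using f by (auto simp: collinear_lemma)
  qed
qed

lemma finite_curve_to_S2: "f \<noteq> 0 \<Longrightarrow> finite {t. to_S2 (curve t) = f}"
proof (rule finite_subset[OF _ finite_curve_parallel])
  show "{t. to_S2 (curve t) = f} \<subseteq> {t. \<exists>c. curve t = c *\<^sub>R f}"
  proof clarify
    fix t
    have "curve t = (sqrt 2 * norm (curve t)) *\<^sub>R to_S2 (curve t)" by (simp add: to_S2_def)
    then show "\<exists>c. curve t = c *\<^sub>R to_S2 (curve t)" by blast
  qed
qed

lemma finite_curve_cross_to_S2: "f \<noteq> 0 \<Longrightarrow> finite {t. to_S2 (cross3 (curve t) u) = f}"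
  by (rule finite_subset[OF _ finite_curve[of f]]) (auto simp: inner_commute dot_cross_self)

section \<open>Families of paths between prescribed ends\<close>

definition unit_path :: "(real ^ 3) list \<Rightarrow> bool" where
  "unit_path xs \<longleftrightarrow> successively (\<lambda>a b. dist a b = 1) xs"

text \<open>The number of points is measured in units of \<open>M\<^sup>3\<close>, so that exponents in thirds become natural
  numbers \<open>g\<close>. The finite set \<open>F\<close> collects the points already used elsewhere on the cycle. In
  \<open>path_family\<close>, the set \<open>R\<close> consists of fixed points the paths must be allowed to visit, such as the
  antipode of \<open>u\<close>.\<close>

definition many_paths :: "nat \<Rightarrow> real ^ 3 \<Rightarrow> real ^ 3 \<Rightarrow> nat \<Rightarrow> nat \<Rightarrow> nat \<Rightarrow> (real ^ 3) set \<Rightarrow> bool" where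
  "many_paths C u w L g M F \<longleftrightarrow> (\<exists>T. finite T \<and>
     (\<forall>t\<in>T. length t = L \<and> distinct t \<and> set t \<subseteq> S2 \<and> set t \<inter> (F \<union> {u, w}) = {} \<and> unit_path (u # t @ [w])) \<and>
     M ^ g \<le> card T \<and> card (\<Union> (set ` T)) \<le> C * M ^ 3)"

definition path_family :: "nat \<Rightarrow> (real ^ 3) set \<Rightarrow> real ^ 3 \<Rightarrow> real ^ 3 \<Rightarrow> nat \<Rightarrow> nat \<Rightarrow> bool" where
  "path_family C R u w L g \<longleftrightarrow> (\<forall>M F. M \<ge> 1 \<and> finite F \<and> F \<inter> R = {} \<longrightarrow> many_paths C u w L g M F)"

lemma path_familyD:
  "path_family C R u w L g \<Longrightarrow> M \<ge> 1 \<Longrightarrow> finite F \<Longrightarrow> F \<inter> R = {} \<Longrightarrow> many_paths C u w L g M F"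
  unfolding path_family_def by blast

lemma path_family_mono: "path_family C R u w L g \<Longrightarrow> R \<subseteq> R' \<Longrightarrow> path_family C R' u w L g"
  unfolding path_family_def by blast

text \<open>Only finitely many parameters give a path that touches \<open>F\<close>, and each path
  comes from finitely many parameters, so \<open>M ^ 3\<close> distinct paths can be chosen. This is
  one factor \<open>n\<close>.\<close>

lemma curve_family:
  assumes B: "finite B" and L: "L \<ge> 1"
    and good: "\<And>t. t \<notin> B \<Longrightarrow> length (\<tau> t) = L \<and> distinct (\<tau> t) \<and> set (\<tau> t) \<subseteq> S2 \<and> unit_path (u # \<tau> t @ [w])"
    and fin: "\<And>f. f \<in> S2 \<Longrightarrow> finite {t :: real. t \<notin> B \<and> f \<in> set (\<tau> t)}"
  shows "path_family L {} u w L 3"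
  unfolding path_family_def
proof (intro allI impI)
  fix M :: nat and F :: "(real ^ 3) set"
  assume MF: "1 \<le> M \<and> finite F \<and> F \<inter> {} = {}"
  define F' where "F' = (F \<union> {u, w}) \<inter> S2"
  define Bad where "Bad = B \<union> (\<Union>f\<in>F'. {t. t \<notin> B \<and> f \<in> set (\<tau> t)})"
  have "finite Bad" unfolding Bad_def using B MF fin by (auto simp: F'_def)
  then have inf: "infinite (- Bad)" using infinite_UNIV_char_0 by (simp add: Compl_eq_Diff_UNIV)
  have "infinite (\<tau> ` (- Bad))"
  proof
    assume "finite (\<tau> ` (- Bad))"
    then obtain a where a: "a \<in> - Bad" "infinite {t \<in> - Bad. \<tau> t = \<tau> a}" using pigeonhole_infinite[OF inf] by blast
    have g: "length (\<tau> a) = L" "set (\<tau> a) \<subseteq> S2" using good[of a] a by (auto simp: Bad_def)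
    then obtain f where f: "f \<in> set (\<tau> a)" "f \<in> S2" using L by (cases "\<tau> a") auto
    have "{t \<in> - Bad. \<tau> t = \<tau> a} \<subseteq> {t. t \<notin> B \<and> f \<in> set (\<tau> t)}" using f by (auto simp: Bad_def)
    then show False using a(2) fin[OF f(2)] finite_subset by blast
  qed
  then obtain T where T: "finite T" "card T = M ^ 3" "T \<subseteq> \<tau> ` (- Bad)" using infinite_arbitrarily_large by blast
  have tT: "length t = L \<and> distinct t \<and> set t \<subseteq> S2 \<and> set t \<inter> (F \<union> {u, w}) = {} \<and> unit_path (u # t @ [w])" if t: "t \<in> T" for t
  proof -
    obtain s where s: "s \<notin> Bad" "t = \<tau> s" using t T(3) by blast
    have sB: "s \<notin> B" using s by (auto simp: Bad_def)
    have "f \<notin> set t" if "f \<in> F \<union> {u, w}" for f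
    proof
      assume f: "f \<in> set t"
      then have "f \<in> F'" using that good[OF sB] s(2) by (auto simp: F'_def)
      then show False using s f sB by (auto simp: Bad_def)
    qed
    then show ?thesis using good[OF sB] s(2) by blast
  qed
  have "card (\<Union> (set ` T)) \<le> (\<Sum>t\<in>T. card (set t))" using card_UN_le[OF T(1)] .
  also have "\<dots> \<le> (\<Sum>t\<in>T. L)" using tT by (intro sum_mono) (metis card_length)
  finally show "many_paths L u w L 3 M F"
    unfolding many_paths_def using T tT by (intro exI[of _ T]) (auto simp: mult.commute)
qed

lemma single_family:
  assumes u: "u \<in> S2" shows "path_family 1 {} u (- u) 1 3"
proof (rule curve_family[where \<tau>="\<lambda>t. [to_S2 (cross3 (curve t) u)]" and B="{t. cross3 (curve t) u = 0}"])
  show "finite {t. cross3 (curve t) u = 0}" using finite_curve_cross S2_nonzero[OF u] by blast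
  show "finite {t. t \<notin> {t. cross3 (curve t) u = 0} \<and> f \<in> set [to_S2 (cross3 (curve t) u)]}" if "f \<in> S2" for f
    by (rule finite_subset[OF _ finite_curve_cross_to_S2[OF S2_nonzero[OF that], of u]]) auto
  fix t assume "t \<notin> {t. cross3 (curve t) u = 0}"
  then have S: "to_S2 (cross3 (curve t) u) \<in> S2" by (simp add: to_S2_in)
  then show "length [to_S2 (cross3 (curve t) u)] = 1 \<and> distinct [to_S2 (cross3 (curve t) u)]
    \<and> set [to_S2 (cross3 (curve t) u)] \<subseteq> S2 \<and> unit_path (u # [to_S2 (cross3 (curve t) u)] @ [- u])"
    using u dist_S2[OF u S] dist_S2[OF S, of "- u"] by (simp add: unit_path_def dot_cross_self)
qed simp

text \<open>Here \<open>x\<close> is free on the great circle of \<open>u\<close>, and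
  \<open>y\<close> is orthogonal to both \<open>x\<close> and \<open>w\<close>. The condition on
  \<open>u\<close> and \<open>w\<close> keeps \<open>x\<close> from being parallel to
  \<open>w\<close> and \<open>y\<close> from being parallel to \<open>u\<close>, so each point is
  used for finitely many parameters only.\<close>

lemma two_family:
  assumes u: "u \<in> S2" and w: "w \<in> S2" and uw: "u \<bullet> w \<noteq> 0"
  shows "path_family 2 {} u w 2 3"
proof -
  define x where "x t = to_S2 (cross3 (curve t) u)" for t
  define y where "y t = to_S2 (cross3 (x t) w)" for t
  have xu: "u \<bullet> x t = 0" "curve t \<bullet> x t = 0" for t by (simp_all add: x_def dot_cross_self)
  have yw: "y t \<bullet> w = 0" "x t \<bullet> y t = 0" for t by (simp_all add: y_def dot_cross_self)
  let ?B = "{t. cross3 (curve t) u = 0}"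
  have xS: "x t \<in> S2" if "t \<notin> ?B" for t using that by (simp add: x_def to_S2_in)
  have yS: "y t \<in> S2" if "t \<notin> ?B" for t
  proof -
    have "cross3 (x t) w \<noteq> 0"
    proof
      assume "cross3 (x t) w = 0"
      then have "x t = w \<or> x t = - w" by (rule cross_eq_0_S2[OF xS[OF that] w])
      then show False using xu(1)[of t] uw by auto
    qed
    then show ?thesis by (simp add: y_def to_S2_in)
  qed
  show ?thesis
  proof (rule curve_family[where \<tau>="\<lambda>t. [x t, y t]" and B="?B"])
    show "finite ?B" using finite_curve_cross S2_nonzero[OF u] by blast
    show "finite {t. t \<notin> ?B \<and> f \<in> set [x t, y t]}" if f: "f \<in> S2" for f
    proof -
      have 1: "finite {t. x t = f}" unfolding x_def by (rule finite_curve_cross_to_S2[OF S2_nonzero[OF f]])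
      have 2: "finite {t. t \<notin> ?B \<and> y t = f}"
      proof (cases "cross3 u f = 0")
        case True
        then have "u = f \<or> u = - f" by (rule cross_eq_0_S2[OF u f])
        then have "{t. t \<notin> ?B \<and> y t = f} = {}" using yw(1) uw by force
        then show ?thesis by (simp only: finite.emptyI)
      next
        case False
        have "cross3 u f \<bullet> curve t = 0" if "y t = f" for t
        proof -
          have "cross3 (curve t) u \<bullet> f = 0" using yw(2)[of t] that by (simp add: x_def)
          then show ?thesis using cross_triple[of "curve t" u f] by metis
        qed
        then show ?thesis by (intro finite_subset[OF _ finite_curve[OF False]]) auto
      qed
      have "{t. t \<notin> ?B \<and> f \<in> set [x t, y t]} \<subseteq> {t. x t = f} \<union> {t. t \<notin> ?B \<and> y t = f}" by auto
      then show ?thesis using 1 2 by (meson finite_UnI finite_subset)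
    qed
    fix t assume t: "t \<notin> ?B"
    show "length [x t, y t] = 2 \<and> distinct [x t, y t] \<and> set [x t, y t] \<subseteq> S2 \<and> unit_path (u # [x t, y t] @ [w])"
      using xS[OF t] yS[OF t] xu[of t] yw[of t] orth_neq[OF xS[OF t] yw(2)] dist_S2[OF u xS[OF t]] dist_S2[OF xS[OF t] yS[OF t]]
        dist_S2[OF yS[OF t] w] by (simp add: unit_path_def)
  qed simp
qed

lemma edge_family:
  assumes "u \<in> S2" "v \<in> S2" "u \<bullet> v = 0"
  shows "path_family 0 {} u v 0 0"
  unfolding path_family_def many_paths_def
  using assms by (auto intro!: exI[of _ "{[]}"] simp: unit_path_def dist_S2)

text \<open>All pairs of a left and a right path are joined at \<open>v\<close>, so the exponents
  add up.\<close>

lemma glue: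
  assumes p1: "path_family C1 R1 u v L1 g1" and p2: "path_family C2 R2 v w L2 g2"
    and R: "finite R2" "w \<notin> R1" "R1 \<inter> R2 = {}" "u \<notin> R2" and v: "v \<noteq> u" "v \<noteq> w" "v \<in> S2"
  shows "path_family (C1 + C2 + 1) (R1 \<union> R2 \<union> {v}) u w (L1 + L2 + 1) (g1 + g2)"
  unfolding path_family_def
proof (intro allI impI)
  fix M :: nat and F assume "1 \<le> M \<and> finite F \<and> F \<inter> (R1 \<union> R2 \<union> {v}) = {}"
  then have M: "M \<ge> 1" and F: "finite F" "F \<inter> R1 = {}" "F \<inter> R2 = {}" "v \<notin> F" by auto
  \<comment> \<open>The left paths keep off \<open>R2\<close>, which the right ones may have to
    visit; afterwards the right paths avoid every point used on the left. Quantifying over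
    \<open>F\<close> makes this order of choices possible.\<close>
  have "many_paths C1 u v L1 g1 M (F \<union> {w} \<union> R2)"
    by (rule path_familyD[OF p1]) (use M F R in auto)
  then obtain T1 where T1: "finite T1" "M ^ g1 \<le> card T1" "card (\<Union> (set ` T1)) \<le> C1 * M ^ 3"
    and t1: "\<And>t. t \<in> T1 \<Longrightarrow> length t = L1 \<and> distinct t \<and> set t \<subseteq> S2 \<and> set t \<inter> (F \<union> {w} \<union> R2 \<union> {u, v}) = {} \<and> unit_path (u # t @ [v])"
    unfolding many_paths_def by blast
  have "finite (\<Union> (set ` T1))" using T1(1) by simp
  moreover have "\<Union> (set ` T1) \<inter> R2 = {}" using t1 by blast
  ultimately have "many_paths C2 v w L2 g2 M (F \<union> {u} \<union> \<Union> (set ` T1))"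
    by (intro path_familyD[OF p2]) (use M F R in auto)
  then obtain T2 where T2: "finite T2" "M ^ g2 \<le> card T2" "card (\<Union> (set ` T2)) \<le> C2 * M ^ 3"
    and t2: "\<And>t. t \<in> T2 \<Longrightarrow> length t = L2 \<and> distinct t \<and> set t \<subseteq> S2 \<and> set t \<inter> (F \<union> {u} \<union> \<Union> (set ` T1) \<union> {v, w}) = {} \<and> unit_path (v # t @ [w])"
    unfolding many_paths_def by blast
  let ?h = "\<lambda>(s, t). s @ v # t"
  define T where "T = ?h ` (T1 \<times> T2)"
  have inj: "inj_on ?h (T1 \<times> T2)"
  proof (rule inj_onI, clarify)
    fix s t s' t' assume a: "s \<in> T1" "s' \<in> T1" "s @ v # t = s' @ v # t'"
    then have "length s = length s'" using t1 by metis
    then show "s = s' \<and> t = t'" using a(3) by simp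
  qed
  have "M ^ (g1 + g2) \<le> card T1 * card T2" using T1 T2 by (simp add: power_add mult_le_mono)
  also have "\<dots> = card T" unfolding T_def using inj by (simp add: card_image card_cartesian_product)
  finally have cT: "M ^ (g1 + g2) \<le> card T" .
  have tT: "length t = L1 + L2 + 1 \<and> distinct t \<and> set t \<subseteq> S2 \<and> set t \<inter> (F \<union> {u, w}) = {} \<and> unit_path (u # t @ [w])" if t: "t \<in> T" for t
  proof -
    obtain r s where rs: "r \<in> T1" "s \<in> T2" "t = r @ v # s" using t by (auto simp: T_def)
    note a = t1[OF rs(1)] and b = t2[OF rs(2)]
    have "set s \<inter> set r = {}" using b rs(1) by blast
    moreover have "v \<notin> set r" "v \<notin> set s" using a b by auto
    ultimately have "distinct t" using a b unfolding rs(3) by auto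
    moreover have "unit_path ((u # r) @ (v # (s @ [w])))"
    proof -
      have "unit_path ((u # r) @ [v])" "unit_path (v # (s @ [w]))" using a b by simp_all
      then show ?thesis unfolding unit_path_def successively_append_iff by simp
    qed
    ultimately show ?thesis using a b v F unfolding rs(3) by auto
  qed
  have "\<Union> (set ` T) \<subseteq> \<Union> (set ` T1) \<union> (\<Union> (set ` T2) \<union> {v})" by (auto simp: T_def)
  then have "card (\<Union> (set ` T)) \<le> card (\<Union> (set ` T1) \<union> (\<Union> (set ` T2) \<union> {v}))"
    using T1 T2 by (intro card_mono) auto
  also have "\<dots> \<le> card (\<Union> (set ` T1)) + (card (\<Union> (set ` T2)) + card {v})"
    by (intro order_trans[OF card_Un_le] add_left_mono order_refl)
  also have "\<dots> \<le> C1 * M ^ 3 + (C2 * M ^ 3 + 1 * M ^ 3)" using T1 T2 M by (intro add_mono) auto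
  also have "\<dots> = (C1 + C2 + 1) * M ^ 3" by (simp add: algebra_simps)
  finally show "many_paths (C1 + C2 + 1) u w (L1 + L2 + 1) (g1 + g2) M F"
    unfolding many_paths_def using cT tT T1 T2 by (intro exI[of _ T]) (auto simp: T_def)
qed

text \<open>The constant \<open>C\<close> is uniform in the ends because compositions pick
  intermediate points depending on \<open>M\<close> and \<open>F\<close>.\<close>

definition connects :: "nat \<Rightarrow> nat \<Rightarrow> bool" where
  "connects L g \<longleftrightarrow> (\<exists>C. \<forall>u\<in>S2. \<forall>w\<in>S2. u \<bullet> w \<noteq> 0 \<longrightarrow> w \<noteq> u \<longrightarrow> w \<noteq> - u \<longrightarrow> path_family C {- u} u w L g)"

lemma compose_paths:
  assumes "connects L1 g1" "connects L2 g2"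
  shows "\<exists>C. \<forall>u\<in>S2. \<forall>w\<in>S2. u \<bullet> w \<noteq> 0 \<longrightarrow> w \<noteq> - u \<longrightarrow> path_family C {- u} u w (L1 + L2 + 1) (g1 + g2)"
proof -
  obtain C1 where C1: "\<And>u w. u\<in>S2 \<Longrightarrow> w\<in>S2 \<Longrightarrow> u \<bullet> w \<noteq> 0 \<Longrightarrow> w \<noteq> u \<Longrightarrow> w \<noteq> - u \<Longrightarrow> path_family C1 {- u} u w L1 g1"
    using assms(1) unfolding connects_def by blast
  obtain C2 where C2: "\<And>u w. u\<in>S2 \<Longrightarrow> w\<in>S2 \<Longrightarrow> u \<bullet> w \<noteq> 0 \<Longrightarrow> w \<noteq> u \<Longrightarrow> w \<noteq> - u \<Longrightarrow> path_family C2 {- u} u w L2 g2"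
    using assms(2) unfolding connects_def by blast
  have "path_family (C1 + C2 + 1) {- u} u w (L1 + L2 + 1) (g1 + g2)"
    if uw: "u \<in> S2" "w \<in> S2" "u \<bullet> w \<noteq> 0" "w \<noteq> - u" for u w
    unfolding path_family_def
  proof (intro allI impI)
    fix M :: nat and F assume MF: "1 \<le> M \<and> finite F \<and> F \<inter> {- u} = {}"
    define F' where "F' = (F \<union> uminus ` F \<union> {u, - u, w, - w}) \<inter> S2"
    define Bad where "Bad = {t. u \<bullet> curve t = 0} \<union> {t. w \<bullet> curve t = 0} \<union> (\<Union>f\<in>F'. {t. to_S2 (curve t) = f})"
    have "finite F'" unfolding F'_def using MF by auto
    moreover have "finite {t. to_S2 (curve t) = f}" if "f \<in> F'" for f
      using that finite_curve_to_S2[of f] S2_nonzero[of f] by (auto simp: F'_def)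
    ultimately have "finite Bad" unfolding Bad_def
      using finite_curve[OF S2_nonzero[OF uw(1)]] finite_curve[OF S2_nonzero[OF uw(2)]] by auto
    then obtain t where t: "t \<notin> Bad" using ex_new_if_finite[OF infinite_UNIV_char_0] by blast
    define v where "v = to_S2 (curve t)"
    have v: "v \<in> S2" "u \<bullet> v \<noteq> 0" "v \<bullet> w \<noteq> 0" using t by (auto simp: v_def to_S2_in Bad_def inner_commute)
    have "v \<notin> F'" using t by (auto simp: v_def Bad_def)
    then have nF: "v \<notin> F" "v \<notin> uminus ` F" "v \<noteq> u" "v \<noteq> - u" "v \<noteq> w" "v \<noteq> - w" using v(1) by (auto simp: F'_def)
    then have nF2: "- v \<notin> F" "- v \<noteq> u" "w \<noteq> - v" by (force, auto)
    have "path_family C1 {- u} u v L1 g1" by (rule C1) (use uw v nF in auto)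
    moreover have "path_family C2 {- v} v w L2 g2" by (rule C2) (use uw v nF nF2 in auto)
    ultimately have "path_family (C1 + C2 + 1) ({- u} \<union> {- v} \<union> {v}) u w (L1 + L2 + 1) (g1 + g2)"
      by (rule glue) (use uw v nF nF2 in auto)
    then show "many_paths (C1 + C2 + 1) u w (L1 + L2 + 1) (g1 + g2) M F"
      by (rule path_familyD) (use MF nF nF2 in auto)
  qed
  then show ?thesis by blast
qed

lemma connects_compose: "connects L1 g1 \<Longrightarrow> connects L2 g2 \<Longrightarrow> connects (L1 + L2 + 1) (g1 + g2)"
  using compose_paths[of L1 g1 L2 g2] unfolding connects_def by blast

text \<open>Adds a vertex without gain: a neighbour \<open>v\<close> of \<open>u\<close>, generic on
  its great circle, becomes the new start. Genericity includes
  \<open>v \<bullet> w \<noteq> 0\<close>, which fails for all \<open>v\<close> on the circle only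
  if \<open>w\<close> is parallel to \<open>u\<close>.\<close>

lemma connects_insert:
  assumes "connects L g" shows "connects (L + 1) g"
proof -
  obtain C where C: "\<And>u w. u\<in>S2 \<Longrightarrow> w\<in>S2 \<Longrightarrow> u \<bullet> w \<noteq> 0 \<Longrightarrow> w \<noteq> u \<Longrightarrow> w \<noteq> - u \<Longrightarrow> path_family C {- u} u w L g"
    using assms unfolding connects_def by blast
  have "path_family (C + 1) {- u} u w (L + 1) g"
    if uw: "u \<in> S2" "w \<in> S2" "u \<bullet> w \<noteq> 0" "w \<noteq> u" "w \<noteq> - u" for u w
    unfolding path_family_def
  proof (intro allI impI)
    fix M :: nat and F assume MF: "1 \<le> M \<and> finite F \<and> F \<inter> {- u} = {}"
    define F' where "F' = (F \<union> uminus ` F \<union> {w, - w}) \<inter> S2"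
    have cr: "cross3 u w \<noteq> 0" using cross_eq_0_S2[OF uw(1,2)] uw(4,5) by auto
    define Bad where "Bad = {t. cross3 (curve t) u = 0} \<union> {t. cross3 u w \<bullet> curve t = 0}
      \<union> (\<Union>f\<in>F'. {t. to_S2 (cross3 (curve t) u) = f})"
    have "finite F'" unfolding F'_def using MF by auto
    moreover have "finite {t. to_S2 (cross3 (curve t) u) = f}" if "f \<in> F'" for f
      using that finite_curve_cross_to_S2[of f] S2_nonzero[of f] by (auto simp: F'_def)
    ultimately have "finite Bad" unfolding Bad_def
      using finite_curve[OF cr] finite_curve_cross[OF S2_nonzero[OF uw(1)]] by auto
    then obtain t where t: "t \<notin> Bad" using ex_new_if_finite[OF infinite_UNIV_char_0] by blast
    define v where "v = to_S2 (cross3 (curve t) u)"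
    have v: "v \<in> S2" "u \<bullet> v = 0" using t by (auto simp: v_def to_S2_in Bad_def dot_cross_self)
    have "cross3 (curve t) u \<bullet> w = cross3 u w \<bullet> curve t" by (rule cross_triple)
    then have "cross3 (curve t) u \<bullet> w \<noteq> 0" using t by (auto simp: Bad_def)
    then have vw: "v \<bullet> w \<noteq> 0" by (simp add: v_def)
    have "v \<notin> F'" using t by (auto simp: v_def Bad_def)
    then have nF: "v \<notin> F" "v \<notin> uminus ` F" "v \<noteq> w" "v \<noteq> - w" using v(1) by (auto simp: F'_def)
    then have nF2: "- v \<notin> F" "w \<noteq> - v" by (force, auto)
    have uv: "v \<noteq> u" "u \<noteq> - v" using orth_neq[OF uw(1) v(2)] by auto
    have "path_family 0 {} u v 0 0" by (rule edge_family) (use uw v in auto)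
    moreover have "path_family C {- v} v w L g" by (rule C) (use uw v vw nF nF2 in auto)
    ultimately have "path_family (0 + C + 1) ({} \<union> {- v} \<union> {v}) u w (0 + L + 1) (0 + g)"
      by (rule glue) (use uw v nF nF2 uv in auto)
    then have "many_paths (0 + C + 1) u w (0 + L + 1) (0 + g) M F"
      by (rule path_familyD) (use MF nF nF2 in auto)
    then show "many_paths (C + 1) u w (L + 1) g M F" by simp
  qed
  then show ?thesis unfolding connects_def by blast
qed

text \<open>Starting with \<open>u, x, -u\<close> adds two vertices and a factor
  \<open>M ^ 3\<close>, since \<open>x\<close> is free.\<close>

lemma double_family:
  assumes "path_family C {} (- u) w L g" "u \<in> S2" "w \<noteq> - u"
  shows "path_family (C + 2) {- u} u w (L + 2) (g + 3)"
proof -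
  have "path_family (1 + C + 1) ({} \<union> {} \<union> {- u}) u w (1 + L + 1) (3 + g)"
    by (rule glue[OF single_family[OF assms(2)] assms(1)]) (use assms S2_neq_uminus[OF assms(2)] in auto)
  then show ?thesis by (simp add: add.commute)
qed


text \<open>The grid extremal for the Szemeredi-Trotter theorem, with one free scaling parameter \<open>s\<close> that serves to
  avoid any given finite set.\<close>

definition grid_pt :: "real \<Rightarrow> nat \<Rightarrow> nat \<Rightarrow> real ^ 3" where
  "grid_pt s a b = vector [real a, s * real b, s\<^sup>2]"

definition grid_line :: "real \<Rightarrow> nat \<Rightarrow> nat \<Rightarrow> real ^ 3" where
  "grid_line s m c = vector [real m * s\<^sup>2, - s, real c]"

lemma grid_incidence: "grid_pt s a (m * a + c) \<bullet> grid_line s m c = 0"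
  by (simp add: grid_pt_def grid_line_def inner_vec_def sum_3 algebra_simps power2_eq_square)

lemma grid_nonzero: "s > 0 \<Longrightarrow> grid_pt s a b \<noteq> 0" "s > 0 \<Longrightarrow> grid_line s m c \<noteq> 0"
  by (simp_all add: grid_pt_def grid_line_def vec_eq_iff forall_3)

lemma finite_grid_pt: "h \<noteq> 0 \<Longrightarrow> a \<ge> 1 \<Longrightarrow> b \<ge> 1 \<Longrightarrow> finite {s. grid_pt s a b \<bullet> h = 0}"
proof -
  assume h: "h \<noteq> 0" "a \<ge> 1" "b \<ge> 1"
  then have "real a * h $ 1 \<noteq> 0 \<or> real b * h $ 2 \<noteq> 0 \<or> h $ 3 \<noteq> 0" by (auto simp: vec_eq_iff forall_3)
  from finite_quadratic_roots[OF this] show ?thesis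
    by (rule rev_finite_subset) (auto simp: grid_pt_def inner_vec_def sum_3 algebra_simps)
qed

lemma finite_grid_line: "h \<noteq> 0 \<Longrightarrow> m \<ge> 1 \<Longrightarrow> c \<ge> 1 \<Longrightarrow> finite {s. grid_line s m c \<bullet> h = 0}"
proof -
  assume h: "h \<noteq> 0" "m \<ge> 1" "c \<ge> 1"
  then have "real c * h $ 3 \<noteq> 0 \<or> - h $ 2 \<noteq> 0 \<or> real m * h $ 1 \<noteq> 0" by (auto simp: vec_eq_iff forall_3)
  from finite_quadratic_roots[OF this] show ?thesis
    by (rule rev_finite_subset) (auto simp: grid_line_def inner_vec_def sum_3 algebra_simps)
qed

lemma to_S2_eq_perp: "to_S2 v = f \<Longrightarrow> f \<noteq> 0 \<Longrightarrow> v \<bullet> perp f = 0"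
  using perp(3)[of f] to_S2_inner(1)[of v "perp f"] by simp

lemma cross_to_S2_eq: "to_S2 (cross3 y u) = f \<Longrightarrow> y \<bullet> f = 0"
  using to_S2_inner(2)[of y "cross3 y u"] by (simp add: dot_cross_self)

text \<open>The path is \<open>u, x, y, z, v, w\<close>, with \<open>y\<close> and \<open>z\<close>
  an incident grid point and grid line. A triple \<open>(a, m, c)\<close> fixes it, giving
  \<open>M ^ 4\<close> paths, while \<open>x\<close> and \<open>y\<close> range over
  \<open>2 * M ^ 3\<close> points each and \<open>z\<close> and \<open>v\<close> over
  \<open>M ^ 3\<close> each: exponent 4/3 for four vertices.\<close>

lemma grid_family:
  assumes u: "u \<in> S2" and w: "w \<in> S2" and uw: "w \<noteq> u" "w \<noteq> - u"
  shows "path_family 6 {} u w 4 4"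
  unfolding path_family_def
proof (intro allI impI)
  fix M :: nat and F :: "(real ^ 3) set" assume MF: "1 \<le> M \<and> finite F \<and> F \<inter> {} = {}"
  define F' where "F' = (F \<union> {u, w, - u, - w}) \<inter> S2"
  \<comment> \<open>No grid vector may be orthogonal to a member of \<open>H\<close>. Members of
    \<open>F'\<close> keep \<open>x\<close> and \<open>v\<close> out of \<open>F'\<close>, their
    \<open>perp\<close> keeps \<open>y\<close> and \<open>z\<close> out, and
    \<open>cross3 u w\<close> prevents \<open>x = v\<close>.\<close>
  define H where "H = F' \<union> {cross3 u w} \<union> perp ` F'"
  have cr: "cross3 u w \<noteq> 0" using cross_eq_0_S2[OF u w] uw by auto
  have finH: "finite H" using MF by (auto simp: H_def F'_def)
  have H0: "h \<noteq> 0" if "h \<in> H" for h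
    using that cr S2_nonzero perp(1) by (auto simp: H_def F'_def)
  define Bad where "Bad = (\<Union>h\<in>H. (\<Union>a\<in>{1..M}. \<Union>b\<in>{1..2 * M\<^sup>2}. {s. grid_pt s a b \<bullet> h = 0})
     \<union> (\<Union>m\<in>{1..M}. \<Union>c\<in>{1..M\<^sup>2}. {s. grid_line s m c \<bullet> h = 0}))"
  have "finite Bad" unfolding Bad_def
    by (intro finite_UN_I finite_UnI finH finite_atLeastAtMost finite_grid_pt finite_grid_line H0) simp_all
  then have "infinite ({0::real<..} - Bad)" by (simp add: infinite_Ioi Diff_infinite_finite)
  from infinite_imp_nonempty[OF this] obtain s where "s \<in> {0<..} - Bad" by blast
  then have s: "s > 0" "s \<notin> Bad" by simp_all
  have P: "grid_pt s a b \<bullet> h \<noteq> 0" if "h \<in> H" "a \<in> {1..M}" "b \<in> {1..2 * M\<^sup>2}" for a b h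
    using that s by (auto simp: Bad_def)
  have Ln: "grid_line s m c \<bullet> h \<noteq> 0" if "h \<in> H" "m \<in> {1..M}" "c \<in> {1..M\<^sup>2}" for m c h
    using that s by (auto simp: Bad_def)
  define y where "y a b = to_S2 (grid_pt s a b)" for a b
  define z where "z m c = to_S2 (grid_line s m c)" for m c
  define x where "x a b = to_S2 (cross3 (y a b) u)" for a b
  define v where "v m c = to_S2 (cross3 (z m c) w)" for m c
  have uF: "u \<in> F'" "- u \<in> F'" "w \<in> F'" "- w \<in> F'" using u w by (auto simp: F'_def)
  have F'H: "f \<in> H" "perp f \<in> H" if "f \<in> F'" for f using that by (auto simp: H_def)
  have yS: "y a b \<in> S2" and zS: "z a b \<in> S2" for a b using s by (auto simp: y_def z_def to_S2_in grid_nonzero)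
  have yF: "y a b \<notin> F'" "f \<in> F' \<Longrightarrow> y a b \<bullet> f \<noteq> 0" if "a \<in> {1..M}" "b \<in> {1..2 * M\<^sup>2}" for a b f
  proof -
    show "y a b \<notin> F'"
    proof
      assume f: "y a b \<in> F'"
      then have "grid_pt s a b \<bullet> perp (y a b) = 0"
        using to_S2_eq_perp[of "grid_pt s a b" "y a b"] S2_nonzero[OF yS] by (simp add: y_def)
      then show False using P F'H(2)[OF f] that by blast
    qed
    show "f \<in> F' \<Longrightarrow> y a b \<bullet> f \<noteq> 0" using P F'H(1) that by (auto simp: y_def)
  qed
  have zF: "z a b \<notin> F'" "f \<in> F' \<Longrightarrow> z a b \<bullet> f \<noteq> 0" if "a \<in> {1..M}" "b \<in> {1..M\<^sup>2}" for a b f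
  proof -
    show "z a b \<notin> F'"
    proof
      assume f: "z a b \<in> F'"
      then have "grid_line s a b \<bullet> perp (z a b) = 0"
        using to_S2_eq_perp[of "grid_line s a b" "z a b"] S2_nonzero[OF zS] by (simp add: z_def)
      then show False using Ln F'H(2)[OF f] that by blast
    qed
    show "f \<in> F' \<Longrightarrow> z a b \<bullet> f \<noteq> 0" using Ln F'H(1) that by (auto simp: z_def)
  qed
  have xS: "x a b \<in> S2" "x a b \<notin> F'" if ab: "a \<in> {1..M}" "b \<in> {1..2 * M\<^sup>2}" for a b
  proof -
    have "cross3 (y a b) u \<noteq> 0" using cross_eq_0_S2[OF yS u] yF(1)[OF ab] uF by metis
    then show "x a b \<in> S2" by (simp add: x_def to_S2_in)
    show "x a b \<notin> F'" using cross_to_S2_eq[of "y a b" u] yF(2)[OF ab] unfolding x_def by blast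
  qed
  have vS: "v a b \<in> S2" "v a b \<notin> F'" if ab: "a \<in> {1..M}" "b \<in> {1..M\<^sup>2}" for a b
  proof -
    have "cross3 (z a b) w \<noteq> 0" using cross_eq_0_S2[OF zS w] zF(1)[OF ab] uF by metis
    then show "v a b \<in> S2" by (simp add: v_def to_S2_in)
    show "v a b \<notin> F'" using cross_to_S2_eq[of "z a b" w] zF(2)[OF ab] unfolding v_def by blast
  qed
  have o: "u \<bullet> x a b = 0" "x a b \<bullet> y a b = 0" "z a b \<bullet> v a b = 0" "v a b \<bullet> w = 0" for a b
    by (simp_all add: x_def v_def dot_cross_self)
  have yz: "y a (m * a + c) \<bullet> z m c = 0" for a m c
    using grid_incidence by (simp add: y_def z_def)
  define J where "J = {1..M} \<times> {1..M} \<times> {1..M\<^sup>2}"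
  define tau where "tau = (\<lambda>(a, m, c). [x a (m * a + c), y a (m * a + c), z m c, v m c])"
  have b: "m * a + c \<in> {1..2 * M\<^sup>2}" if "(a, m, c) \<in> J" for a m c
  proof -
    have "m * a \<le> M * M" using that by (intro mult_le_mono) (auto simp: J_def)
    then show ?thesis using that by (auto simp: J_def power2_eq_square)
  qed
  have good: "length t = 4 \<and> distinct t \<and> set t \<subseteq> S2 \<and> set t \<inter> (F \<union> {u, w}) = {} \<and> unit_path (u # t @ [w])" if "t \<in> tau ` J" for t
  proof -
    obtain a m c where amc: "(a, m, c) \<in> J" "t = tau (a, m, c)" using \<open>t \<in> tau ` J\<close> by auto
    define bb where "bb = m * a + c"
    have t: "t = [x a bb, y a bb, z m c, v m c]" by (simp add: amc(2) tau_def bb_def)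
    have r: "a \<in> {1..M}" "bb \<in> {1..2 * M\<^sup>2}" "m \<in> {1..M}" "c \<in> {1..M\<^sup>2}" using amc(1) b[OF amc(1)] by (auto simp: J_def bb_def)
    note S = xS(1)[OF r(1,2)] yS[of a bb] zS[of m c] vS(1)[OF r(3,4)]
    have yz: "y a bb \<bullet> z m c = 0" using yz by (simp add: bb_def)
    have "x a bb \<noteq> y a bb" "y a bb \<noteq> z m c" "z m c \<noteq> v m c"
      using orth_neq[OF S(1) o(2)] orth_neq[OF S(2) yz] orth_neq[OF S(3) o(3)] by auto
    moreover have "x a bb \<noteq> z m c" using zF(2)[OF r(3,4) uF(1)] o(1)[of a bb] by (auto simp: inner_commute)
    moreover have "y a bb \<noteq> v m c" using yF(2)[OF r(1,2) uF(3)] o(4)[of m c] by auto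
    \<comment> \<open>A common value would be orthogonal to \<open>u\<close> and \<open>w\<close>,
      hence parallel to \<open>cross3 u w\<close>, and also orthogonal to
      \<open>y a bb\<close>.\<close>
    moreover have "x a bb \<noteq> v m c"
    proof
      assume xv: "x a bb = v m c"
      have "y a bb \<bullet> cross3 u w \<noteq> 0" using P[OF _ r(1,2), of "cross3 u w"] by (simp add: H_def y_def)
      moreover have "\<exists>k. cross3 u w = k *\<^sub>R x a bb"
      proof -
        have "cross3 (x a bb) (cross3 u w) = 0"
          using o(1)[of a bb] o(4)[of m c] xv unfolding Lagrange by (simp add: inner_commute)
        then have "collinear {0, x a bb, cross3 u w}" unfolding cross_eq_0 .
        then show ?thesis using S2_nonzero[OF S(1)] cr by (auto simp: collinear_lemma)
      qed
      ultimately show False using o(2)[of a bb] by (auto simp: inner_commute)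
    qed
    ultimately have "distinct t" unfolding t by auto
    moreover have "f \<notin> F \<union> {u, w}" if "f \<in> set t" for f
    proof -
      have "f \<in> S2" "f \<notin> F'" using that S xS(2)[OF r(1,2)] yF(1)[OF r(1,2)] zF(1)[OF r(3,4)] vS(2)[OF r(3,4)]
        unfolding t by auto
      then show ?thesis by (auto simp: F'_def)
    qed
    moreover have "unit_path (u # t @ [w])"
      unfolding t using dist_S2[OF u S(1)] dist_S2[OF S(1,2)] dist_S2[OF S(2,3)] dist_S2[OF S(3,4)] dist_S2[OF S(4) w]
        o yz by (simp add: unit_path_def)
    ultimately show ?thesis using S unfolding t by auto
  qed
  have "inj_on tau J"
  proof (rule inj_onI)
    fix p p' assume eq0: "tau p = tau p'"
    obtain a m c a' m' c' where pp: "p = (a, m, c)" "p' = (a', m', c')" by (cases p, cases p')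
    have eq: "tau (a, m, c) = tau (a', m', c')" using eq0 pp by simp
    have "z m c = z m' c'" using eq by (simp add: tau_def)
    then have "grid_line s m c = (norm (grid_line s m c) / norm (grid_line s m' c')) *\<^sub>R grid_line s m' c'"
      unfolding z_def using grid_nonzero[OF s(1)] by (intro to_S2_eq) auto
    then obtain k where k: "grid_line s m c = k *\<^sub>R grid_line s m' c'" by blast
    have "- s = k * - s" using arg_cong[OF k, of "\<lambda>v. v $ 2"] by (simp add: grid_line_def)
    then have "k = 1" using s(1) by simp
    then have mc: "m = m'" "c = c'" using arg_cong[OF k, of "\<lambda>v. v $ 1"] arg_cong[OF k, of "\<lambda>v. v $ 3"] s(1)
      by (simp_all add: grid_line_def)
    have "y a (m * a + c) = y a' (m' * a' + c')" using eq by (simp add: tau_def)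
    then have "grid_pt s a (m * a + c) = (norm (grid_pt s a (m * a + c)) / norm (grid_pt s a' (m' * a' + c'))) *\<^sub>R grid_pt s a' (m' * a' + c')"
      unfolding y_def using grid_nonzero[OF s(1)] by (intro to_S2_eq) auto
    then obtain k where k: "grid_pt s a (m * a + c) = k *\<^sub>R grid_pt s a' (m' * a' + c')" by blast
    have "s\<^sup>2 = k * s\<^sup>2" using arg_cong[OF k, of "\<lambda>v. v $ 3"] by (simp add: grid_pt_def)
    then have "k = 1" using s(1) by simp
    then have "a = a'" using arg_cong[OF k, of "\<lambda>v. v $ 1"] by (simp add: grid_pt_def)
    then show "p = p'" using mc pp by simp
  qed
  then have "card (tau ` J) = M ^ 4"
    by (simp add: card_image J_def card_cartesian_product eval_nat_numeral)
  moreover have "card (\<Union> (set ` tau ` J)) \<le> 6 * M ^ 3"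
  proof -
    let ?A = "{1..M} \<times> {1..2 * M\<^sup>2}" and ?B = "{1..M} \<times> {1..M\<^sup>2}"
    have "\<Union> (set ` tau ` J) \<subseteq> (case_prod x ` ?A \<union> case_prod y ` ?A) \<union> (case_prod z ` ?B \<union> case_prod v ` ?B)"
    proof
      fix p assume "p \<in> \<Union> (set ` tau ` J)"
      then obtain a m c where amc: "(a, m, c) \<in> J" "p \<in> set (tau (a, m, c))" by auto
      have "(a, m * a + c) \<in> ?A" "(m, c) \<in> ?B" using b[OF amc(1)] amc(1) by (auto simp: J_def)
      then show "p \<in> (case_prod x ` ?A \<union> case_prod y ` ?A) \<union> (case_prod z ` ?B \<union> case_prod v ` ?B)"
        using amc(2) by (force simp: tau_def)
    qed
    then have "card (\<Union> (set ` tau ` J)) \<le> card ((case_prod x ` ?A \<union> case_prod y ` ?A) \<union> (case_prod z ` ?B \<union> case_prod v ` ?B))"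
      by (intro card_mono) auto
    also have "\<dots> \<le> (card (case_prod x ` ?A) + card (case_prod y ` ?A)) + (card (case_prod z ` ?B) + card (case_prod v ` ?B))"
      by (intro order_trans[OF card_Un_le] add_mono card_Un_le)
    also have "\<dots> \<le> (card ?A + card ?A) + (card ?B + card ?B)"
      by (intro add_mono card_image_le) auto
    also have "\<dots> = 6 * M ^ 3" by (simp add: card_cartesian_product eval_nat_numeral algebra_simps)
    finally show ?thesis .
  qed
  ultimately show "many_paths 6 u w 4 4 M F"
    unfolding many_paths_def using good by (intro exI[of _ "tau ` J"]) (auto simp: J_def)
qed

text \<open>The blocks: two vertices with one free, the same after an antipodal pair, and the grid
  after an antipodal pair.\<close>

lemma connects_basic: "connects 2 3" "connects 4 6" "connects 6 7"
proof -
  show "connects 2 3" unfolding connects_def using path_family_mono[OF two_family] by (intro exI[of _ 2]) auto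
  have "path_family (2 + 2) {- u} u w (2 + 2) (3 + 3)" if "u \<in> S2" "w \<in> S2" "u \<bullet> w \<noteq> 0" "w \<noteq> - u" for u w
    by (intro double_family two_family) (use that in auto)
  then have "path_family 4 {- u} u w 4 6" if "u \<in> S2" "w \<in> S2" "u \<bullet> w \<noteq> 0" "w \<noteq> - u" for u w
    using that by simp
  then show "connects 4 6" unfolding connects_def by blast
  have "path_family (6 + 2) {- u} u w (4 + 2) (4 + 3)" if "u \<in> S2" "w \<in> S2" "w \<noteq> u" "w \<noteq> - u" for u w
    by (intro double_family grid_family) (use that in auto)
  then have "path_family 8 {- u} u w 6 7" if "u \<in> S2" "w \<in> S2" "w \<noteq> u" "w \<noteq> - u" for u w
    using that by simp
  then show "connects 6 7" unfolding connects_def by blast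
qed

text \<open>Each further group of five vertices, consisting of an intermediate point and the block
  with four vertices, brings \<open>n\<^sup>2\<close>.\<close>

lemma connects_multiple: "connects (5 * j + 4) (6 * j + 6)"
proof (induction j)
  case (Suc j)
  have "connects (5 * j + 4 + 4 + 1) (6 * j + 6 + 6)" by (rule connects_compose[OF Suc connects_basic(2)])
  then show ?case by (simp add: algebra_simps)
qed (simp add: connects_basic)

section \<open>Closing paths to cycles of every admissible length\<close>

definition many_cycles :: "nat \<Rightarrow> nat \<Rightarrow> bool" where
  "many_cycles k g \<longleftrightarrow> (\<exists>C. \<forall>M\<ge>1. \<exists>P. finite P \<and> P \<subseteq> S2 \<and> card P \<le> C * M ^ 3 + 1 \<and> M ^ g \<le> card (unit_cycles k P))"

lemma close_path:
  assumes u: "u \<in> S2" and p: "path_family C {- u} u u L g"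
  shows "many_cycles (L + 1) g"
  unfolding many_cycles_def
proof (intro exI[of _ C] allI impI)
  fix M :: nat assume M: "1 \<le> M"
  have "many_paths C u u L g M {}" by (rule path_familyD[OF p M]) auto
  then obtain T where T: "finite T" "M ^ g \<le> card T" "card (\<Union> (set ` T)) \<le> C * M ^ 3"
    and t: "\<And>t. t \<in> T \<Longrightarrow> length t = L \<and> distinct t \<and> set t \<subseteq> S2 \<and> set t \<inter> ({} \<union> {u, u}) = {} \<and> unit_path (u # t @ [u])"
    unfolding many_paths_def by blast
  define P where "P = insert u (\<Union> (set ` T))"
  have P: "finite P" "P \<subseteq> S2" using T(1) t u by (auto simp: P_def)
  have "(#) u ` T \<subseteq> unit_cycles (L + 1) P"
  proof
    fix p assume "p \<in> (#) u ` T"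
    then obtain t' where t': "t' \<in> T" "p = u # t'" by blast
    note tt = t[OF t'(1)]
    have "dist (p ! i) (p ! (Suc i mod (L + 1))) = 1" if i: "i < L + 1" for i
    proof -
      have "dist ((u # t' @ [u]) ! i) ((u # t' @ [u]) ! Suc i) = 1"
        using tt i unfolding unit_path_def successively_conv_nth by auto
      moreover have "(u # t' @ [u]) ! i = p ! i" using tt i unfolding t'(2)
        by (metis append_Cons length_Cons nth_append Suc_eq_plus1)
      moreover have "(u # t' @ [u]) ! Suc i = p ! (Suc i mod (L + 1))"
      proof (cases "i = L")
        case True
        then show ?thesis using tt unfolding t'(2) by (simp add: nth_append)
      next
        case False
        then show ?thesis using tt i unfolding t'(2) by (simp add: nth_append)
      qed
      ultimately show ?thesis by simp
    qed
    moreover have "distinct p" "length p = L + 1" "set p \<subseteq> P" using tt t' by (auto simp: P_def)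
    ultimately show "p \<in> unit_cycles (L + 1) P" by (auto simp: unit_cycles_def)
  qed
  then have "card ((#) u ` T) \<le> card (unit_cycles (L + 1) P)"
    using finite_unit_cycles(1)[OF P(1)] by (rule card_mono[rotated])
  moreover have "card ((#) u ` T) = card T" by (simp add: card_image)
  moreover have "card P \<le> C * M ^ 3 + 1" unfolding P_def using T by (simp add: card_insert_if)
  ultimately show "\<exists>P. finite P \<and> P \<subseteq> S2 \<and> card P \<le> C * M ^ 3 + 1 \<and> M ^ g \<le> card (unit_cycles (L + 1) P)"
    using P T(2) by (intro exI[of _ P]) auto
qed

lemma S2_point: "\<exists>u. u \<in> S2"
  using infinite_S2 by (metis finite.emptyI ex_in_conv)

text \<open>The two extra vertices are the base point \<open>u\<close>, which serves as both ends,
  and the intermediate point of \<open>compose_paths\<close>.\<close>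

lemma connects_cycles: "connects L1 g1 \<Longrightarrow> connects L2 g2 \<Longrightarrow> many_cycles (L1 + L2 + 2) (g1 + g2)"
proof -
  assume c: "connects L1 g1" "connects L2 g2"
  obtain u where u: "u \<in> S2" using S2_point by blast
  have "u \<bullet> u \<noteq> 0" using S2_nonzero[OF u] by simp
  then obtain C where "path_family C {- u} u u (L1 + L2 + 1) (g1 + g2)"
    using compose_paths[OF c] u S2_neq_uminus[OF u] S2_nonzero[OF u] by blast
  from close_path[OF u this] show ?thesis by simp
qed

lemma many_4_cycles: "many_cycles 4 6"
proof -
  obtain u where u: "u \<in> S2" using S2_point by blast
  have "path_family (1 + 2) {- u} u u (1 + 2) (3 + 3)"
    using single_family[of "- u"] u S2_neq_uminus[OF u] by (intro double_family) auto
  from close_path[OF u this] show ?thesis by (simp add: eval_nat_numeral)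
qed

lemma many_5_cycles: "many_cycles 5 6"
proof -
  obtain u where u: "u \<in> S2" using S2_point by blast
  have "path_family (2 + 2) {- u} u u (2 + 2) (3 + 3)"
    using u S2_neq_uminus[OF u] by (intro double_family two_family) (auto simp: S2_inner)
  from close_path[OF u this] show ?thesis by simp
qed

lemma many_cycles_phi:
  assumes "k \<ge> 5" "k \<notin> {6, 7, 9}" shows "many_cycles k (phi k)"
proof -
  define m r where "m = k div 5" and "r = k mod 5"
  have k: "k = 5 * m + r" and r: "r < 5" by (simp_all add: m_def r_def)
  have m1: "m \<ge> 1" using assms by (simp add: m_def)
  have ph: "phi k = 6 * m + phi r" unfolding k by (rule phi_add)
  have "r = 0 \<or> r = 1 \<or> r = 2 \<or> r = 3 \<or> r = 4" using r by linarith
  \<comment> \<open>The residue decides which block follows \<open>connects_multiple\<close>. Length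
    5 is too short for two blocks of four and is built directly; 6 and 7 are excluded by
    assumption.\<close>
  then consider "m = 1" "r = 0" | j where "m = j + 2" "r = 0" | j where "m = j + 2" "r = 1"
    | j where "m = j + 2" "r = 2" | j where "m = j + 1" "r = 3" | j where "m = j + 1" "r = 4"
  proof -
    obtain j where j: "m = Suc j" using m1 by (cases m) auto
    have "j = 0 \<Longrightarrow> r \<noteq> 1 \<and> r \<noteq> 2" using assms k j by auto
    then show ?thesis using \<open>r = 0 \<or> r = 1 \<or> r = 2 \<or> r = 3 \<or> r = 4\<close> that j by (cases j) auto
  qed
  then show ?thesis
  proof cases
    case 1 then show ?thesis using many_5_cycles unfolding ph k by (simp add: phi_def)
  next
    case (2 j)
    show ?thesis using connects_cycles[OF connects_multiple[of j] connects_basic(2)] unfolding ph k 2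
      by (simp add: phi_def algebra_simps)
  next
    case (3 j)
    show ?thesis using connects_cycles[OF connects_multiple[of j] connects_insert[OF connects_basic(2)]] unfolding ph k 3
      by (simp add: phi_def algebra_simps)
  next
    case (4 j)
    show ?thesis using connects_cycles[OF connects_multiple[of j] connects_basic(3)] unfolding ph k 4
      by (simp add: phi_def algebra_simps)
  next
    case (5 j)
    show ?thesis using connects_cycles[OF connects_multiple[of j] connects_basic(1)] unfolding ph k 5
      by (simp add: phi_def algebra_simps)
  next
    case (6 j)
    show ?thesis using connects_cycles[OF connects_multiple[of j] connects_insert[OF connects_basic(1)]] unfolding ph k 6
      by (simp add: phi_def algebra_simps)
  qed
qed

section \<open>Asymptotics\<close>

text \<open>A smaller set can be filled up to \<open>n\<close> points without losing cycles.\<close>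

lemma max_cycles_ge:
  assumes "finite P" "P \<subseteq> S2" "card P \<le> n"
  shows "card (unit_cycles k P) \<le> max_cycles k n"
proof -
  have "infinite (S2 - P)" using infinite_S2 assms(1) by (rule Diff_infinite_finite[rotated])
  then obtain Q where Q: "finite Q" "card Q = n - card P" "Q \<subseteq> S2 - P" using infinite_arbitrarily_large by blast
  have "card (P \<union> Q) = n" using Q assms by (subst card_Un_disjoint) auto
  then have "card (unit_cycles k (P \<union> Q)) \<in> cycle_counts k n"
    unfolding cycle_counts_def using Q assms by blast
  then have "card (unit_cycles k (P \<union> Q)) \<le> max_cycles k n"
    unfolding max_cycles_def using finite_cycle_counts by (rule Max_ge[rotated])
  moreover have "card (unit_cycles k P) \<le> card (unit_cycles k (P \<union> Q))"
    using finite_unit_cycles(1)[of "P \<union> Q" k] Q assms by (intro card_mono) (auto simp: unit_cycles_def)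
  ultimately show ?thesis by simp
qed

lemma max_cycles_attained:
  "\<exists>P. finite P \<and> P \<subseteq> S2 \<and> card P = n \<and> max_cycles k n = card (unit_cycles k P)"
proof -
  have "max_cycles k n \<in> cycle_counts k n"
    unfolding max_cycles_def by (rule Max_in[OF finite_cycle_counts cycle_counts_nonempty])
  then show ?thesis unfolding cycle_counts_def by blast
qed

lemma max_cycles_lower:
  assumes "many_cycles k g"
  shows "\<exists>c>0. \<forall>\<^sub>F n in sequentially. c * real n powr (real g / 3) \<le> real (max_cycles k n)"
proof -
  obtain C0 where C0: "\<And>M. M \<ge> 1 \<Longrightarrow> \<exists>P. finite P \<and> P \<subseteq> S2 \<and> card P \<le> C0 * M ^ 3 + 1 \<and> M ^ g \<le> card (unit_cycles k P)"
    using assms unfolding many_cycles_def by blast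
  define C where "C = real C0 + 1"
  have C: "C \<ge> 1" by (simp add: C_def)
  \<comment> \<open>Rounding \<open>(n / C) powr (1/3) \<ge> 2\<close> down to \<open>M\<close>
    loses at most a factor 2, hence 8 after cubing. The extra 1 in \<open>C\<close> accounts for the
    base point of the cycles.\<close>
  define c where "c = (1 / (8 * C)) powr (real g / 3)"
  have "c * real n powr (real g / 3) \<le> real (max_cycles k n)" if n: "real n \<ge> 8 * C" for n
  proof -
    define s where "s = (real n / C) powr (1/3)"
    define M where "M = nat \<lfloor>s\<rfloor>"
    have n0: "real n > 0" using n C by linarith
    have s3: "s ^ 3 = real n / C" unfolding s_def using n0 C by (simp add: powr_power)
    have "real n / C \<ge> 8" using n C by (simp add: le_divide_eq)
    then have "2 ^ 3 \<le> s ^ 3" by (simp add: s3)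
    moreover have "s \<ge> 0" by (simp add: s_def)
    ultimately have s2: "s \<ge> 2" using power_mono_iff[of 2 s 3] by simp
    have M: "M \<ge> 1" "real M \<le> s" "s \<le> 2 * real M" unfolding M_def using s2 by linarith+
    obtain P where P: "finite P" "P \<subseteq> S2" "card P \<le> C0 * M ^ 3 + 1" "M ^ g \<le> card (unit_cycles k P)"
      using C0[OF M(1)] by blast
    have "C0 * M ^ 3 + 1 \<le> C0 * M ^ 3 + M ^ 3" using M(1) by simp
    then have "real (card P) \<le> real (C0 * M ^ 3 + M ^ 3)" using P(3) by linarith
    also have "\<dots> = C * real M ^ 3" by (simp add: C_def algebra_simps)
    also have "\<dots> \<le> C * s ^ 3" using M C by (intro mult_left_mono power_mono) auto
    also have "\<dots> = real n" using s3 C by simp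
    finally have "card P \<le> n" by simp
    then have "card (unit_cycles k P) \<le> max_cycles k n" by (rule max_cycles_ge[OF P(1,2)])
    then have "M ^ g \<le> max_cycles k n" using P(4) by linarith
    then have ub: "real M ^ g \<le> real (max_cycles k n)" by (metis of_nat_le_iff of_nat_power)
    have "c * real n powr (real g / 3) = (real n / (8 * C)) powr (real g / 3)"
      unfolding c_def using n0 C by (simp add: powr_mult[symmetric])
    also have "real n / (8 * C) = (s / 2) powr 3"
    proof -
      have "(s / 2) powr 3 = s ^ 3 / 8" using s2 by (simp add: power_divide)
      then show ?thesis by (simp add: s3)
    qed
    also have "((s / 2) powr 3) powr (real g / 3) = (s / 2) powr real g" by (simp add: powr_powr)
    also have "\<dots> \<le> real M powr real g" using M s2 by (intro powr_mono2) auto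
    also have "\<dots> = real M ^ g" using M by (simp add: powr_realpow)
    finally show ?thesis using ub by linarith
  qed
  moreover have "\<forall>\<^sub>F n in sequentially. real n \<ge> 8 * C"
    using filterlim_real_sequentially filterlim_at_top by blast
  ultimately have "\<forall>\<^sub>F n in sequentially. c * real n powr (real g / 3) \<le> real (max_cycles k n)"
    by (auto elim: eventually_mono)
  moreover have "c > 0" unfolding c_def using C by simp
  ultimately show ?thesis by blast
qed

lemma max_cycles_soft_Theta:
  assumes k: "k \<ge> 5" "k \<notin> {6, 7, 9}"
  shows "soft_Theta (\<lambda>n. real (max_cycles k n)) (\<lambda>n. real n powr (real (phi k) / 3))"
proof -
  obtain K c where K: "K > 0" and c: "c > 0" and up: "\<And>P. finite P \<Longrightarrow> P \<subseteq> S2 \<Longrightarrow> card P \<ge> 3 \<Longrightarrow>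
      real (card (unit_cycles k P)) \<le> K * real (card P) powr (real (phi k) / 3) * ln (real (card P)) powr c"
    using unit_cycles_soft_upper[OF k] by blast
  obtain b where b: "b > 0" and lo: "\<forall>\<^sub>F n in sequentially. b * real n powr (real (phi k) / 3) \<le> real (max_cycles k n)"
    using max_cycles_lower[OF many_cycles_phi[OF k]] by blast
  \<comment> \<open>The lower bound has no logarithmic loss; dividing by the logarithm only weakens
    it for \<open>n \<ge> 3\<close>, where \<open>ln n \<ge> 1\<close>.\<close>
  define D where "D = max K (1 / b)"
  have D: "D > 0" "D \<ge> K" "D \<ge> 1 / b" using K by (auto simp: D_def)
  have "\<forall>\<^sub>F n in sequentially. real n powr (real (phi k) / 3) / (D * ln (real n) powr c) \<le> real (max_cycles k n)
      \<and> real (max_cycles k n) \<le> D * real n powr (real (phi k) / 3) * ln (real n) powr c"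
    using lo eventually_ge_at_top[of 3]
  proof eventually_elim
    case (elim n)
    let ?g = "real n powr (real (phi k) / 3)" and ?l = "ln (real n) powr c"
    have "exp 1 \<le> real n" using exp_le elim(2) by linarith
    then have "ln (real n) \<ge> 1" using elim(2) by (simp add: ln_ge_iff)
    then have l: "?l \<ge> 1" using c by (intro ge_one_powr_ge_zero) auto
    have "1 / b * 1 \<le> D * ?l" using D l b by (intro mult_mono) auto
    then have "1 \<le> b * (D * ?l)" using b by (simp add: field_simps)
    then have "?g * 1 \<le> ?g * (b * (D * ?l))" by (intro mult_left_mono) auto
    then have "?g / (D * ?l) \<le> b * ?g" using D l by (subst pos_divide_le_eq) (auto simp: mult_ac intro!: mult_pos_pos)
    moreover obtain P where P: "finite P" "P \<subseteq> S2" "card P = n" "max_cycles k n = card (unit_cycles k P)"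
      using max_cycles_attained by blast
    have "real (max_cycles k n) \<le> K * ?g * ?l" using up[OF P(1,2)] P elim(2) by simp
    moreover have "K * ?g * ?l \<le> D * ?g * ?l" using D by (intro mult_right_mono) auto
    ultimately show ?case using elim(1) by linarith
  qed
  then show ?thesis unfolding soft_Theta_def using D(1) c by blast
qed

lemma max_4_cycles: "(\<lambda>n. real (max_cycles 4 n)) \<in> \<Theta>(\<lambda>n. real n ^ 2)"
proof (rule bigthetaI)
  have "real (max_cycles 4 n) \<le> 7 * real n ^ 2" for n
    using max_cycles_attained[of n 4] four_cycles_le by metis
  then show "(\<lambda>n. real (max_cycles 4 n)) \<in> O(\<lambda>n. real n ^ 2)" by (intro bigoI[of _ 7]) auto
  obtain c where c: "c > 0" and lo: "\<forall>\<^sub>F n in sequentially. c * real n powr (real 6 / 3) \<le> real (max_cycles 4 n)"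
    using max_cycles_lower[OF many_4_cycles] by auto
  have "\<forall>\<^sub>F n in sequentially. norm (real n ^ 2) \<le> (1 / c) * norm (real (max_cycles 4 n))"
    using lo eventually_gt_at_top[of 0]
  proof eventually_elim
    case (elim n)
    then have "c * real n ^ 2 \<le> real (max_cycles 4 n)" by (simp add: powr_numeral)
    then show ?case using c by (simp add: field_simps)
  qed
  then show "(\<lambda>n. real (max_cycles 4 n)) \<in> \<Omega>(\<lambda>n. real n ^ 2)"
    unfolding bigomega_iff_bigo by (rule bigoI)
qed

lemma floor_two_fifths: "\<lfloor>2 * real k / 5\<rfloor> = int (2 * k div 5)"
proof -
  have "\<lfloor>real (2 * k) / real 5\<rfloor> = int (2 * k div 5)" by (rule floor_divide_of_nat_eq)
  then show ?thesis by simp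
qed

lemma phi_floor:
  "k mod 5 \<in> {0, 1, 3, 4} \<Longrightarrow> real (phi k) / 3 = real_of_int \<lfloor>2 * real k / 5\<rfloor>"
  "k mod 5 = 2 \<Longrightarrow> real (phi k) / 3 = real_of_int \<lfloor>2 * real k / 5\<rfloor> + 1 / 3"
proof -
  have k: "k = 5 * (k div 5) + k mod 5" by simp
  have d: "2 * k div 5 = 2 * (k div 5) + 2 * (k mod 5) div 5"
  proof -
    have "2 * k = 2 * (k mod 5) + 5 * (2 * (k div 5))" by (subst k) (simp only: algebra_simps)
    then show ?thesis by simp
  qed
  show "k mod 5 \<in> {0, 1, 3, 4} \<Longrightarrow> real (phi k) / 3 = real_of_int \<lfloor>2 * real k / 5\<rfloor>"
    unfolding floor_two_fifths d by (auto simp: phi_def)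
  show "k mod 5 = 2 \<Longrightarrow> real (phi k) / 3 = real_of_int \<lfloor>2 * real k / 5\<rfloor> + 1 / 3"
    unfolding floor_two_fifths d by (simp add: phi_def field_simps)
qed

theorem theorem2:
  shows "(\<lambda>n. real (max_cycles 4 n)) \<in> \<Theta>(\<lambda>n. real n ^ 2) \<and>
    (\<forall>k::nat. k \<ge> 5 \<and> k \<notin> {6, 7, 9} \<longrightarrow>
      (k mod 5 \<in> {0, 1, 3, 4} \<longrightarrow>
        soft_Theta (\<lambda>n. real (max_cycles k n))
          (\<lambda>n. real n powr real_of_int \<lfloor>2 * real k / 5\<rfloor>)) \<and>
      (k mod 5 = 2 \<longrightarrow>
        soft_Theta (\<lambda>n. real (max_cycles k n))
          (\<lambda>n. real n powr (real_of_int \<lfloor>2 * real k / 5\<rfloor> + 1 / 3))))"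
proof (intro conjI allI impI)
  show "(\<lambda>n. real (max_cycles 4 n)) \<in> \<Theta>(\<lambda>n. real n ^ 2)" by (rule max_4_cycles)
  fix k :: nat assume k: "5 \<le> k \<and> k \<notin> {6, 7, 9}"
  then have T: "soft_Theta (\<lambda>n. real (max_cycles k n)) (\<lambda>n. real n powr (real (phi k) / 3))"
    using max_cycles_soft_Theta by blast
  show "soft_Theta (\<lambda>n. real (max_cycles k n)) (\<lambda>n. real n powr real_of_int \<lfloor>2 * real k / 5\<rfloor>)"
    if "k mod 5 \<in> {0, 1, 3, 4}" using T unfolding phi_floor(1)[OF that] .
  show "soft_Theta (\<lambda>n. real (max_cycles k n)) (\<lambda>n. real n powr (real_of_int \<lfloor>2 * real k / 5\<rfloor> + 1 / 3))"
    if "k mod 5 = 2" using T unfolding phi_floor(2)[OF that] .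
qed

end
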